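(* Let $m<n$, $D\subseteq\mathbb R^n$, and consider the driftless control-affine system with output $$\dot x=\sum_{i=1}^m u_i f_i(x),\qquad y=J(x),\qquad x\in D,\ u\in\mathbb R^m,\ y\in\mathbb R,$$ where the vector fields $f_1,\dots,f_m:D\to\mathbb R^n$ are linearly independent. Let $J\in C^2(D;\mathbb R)$ and suppose that there are $x^*\in D$ and positive constants $\sigma_{11},\sigma_{12},\sigma_{21},\sigma_{22},\sigma_3$ such that, with $J^*=J(x^* )$, for all $x\in D$, $$\sigma_{11}\|x-x^*\|^2\le J(x)-J^*\le\sigma_{12}\|x-x^*\|^2,$$ $$\sigma_{21}(J(x)-J^* )\le\|\nabla J(x)\|^2\le\sigma_{22}(J(x)-J^* ),\qquad \Big\|\frac{\partial^2J(x)}{\partial x^2}\Big\|\le\sigma_3 .$$ Assume that: (1) $f_i\in C^2(D;\mathbb R^n)$ for $i=1,\dots,m$, and there are index sets $S_1\subseteq\{1,\dots,m\}$, $S_2\subseteq\{1,\dots,m\}^2$ with $|S_1|+|S_2|=n$ such that $$\mathrm{span}\{f_i(x),\,[f_{j_1},f_{j_2}](x)\;:\;i\in S_1,\ (j_1,j_2)\in S_2\}=\mathbb R^n\quad\text{for all }x\in D;$$ moreover, there is an $\alpha>0$ such that $\|\mathcal F^{-1}(x)\|\le\alpha$ for all $x\in D$, where $\mathcal F(x)$ is the $n\times n$ matrix with columns $f_{j}(x)$, $j\in S_1$, and $[f_{j_1},f_{j_2}](x)$, $(j_1,j_2)\in S_2$; (2) $g_j(J(\cdot))\in C^2(D\setminus\{x^*\};\mathbb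 R)$, and $L_{g_j}g_i(J(\cdot))$, $L_{g_l}L_{g_j}g_i(J(\cdot))\in C(D;\mathbb R)$ for all $i,j,l\in\{1,\dots,2n\}$; (3) for any compact $D'\subseteq D$ there are $L_g,L_{2g},M_{3g}\ge0$ such that, for all $x,\xi\in D'$ and all $i,j_1,j_2,j_3\in\{1,\dots,2n\}$, $$\|g_i(J(x))-g_i(J(\xi))\|\le L_g\|x-\xi\|,$$ $$\|L_{(g_{j_2}(J(x))-g_{j_2}(J(\xi)))}\,g_{j_1}(J(\xi))\|\le L_{2g}\|x-\xi\|,$$ $$\|L_{g_{j_3}(J(x))}L_{g_{j_2}(J(\xi))}\,g_{j_1}(J(\xi))\|\le M_{3g}.$$ Here $g_1,\dots,g_{2n}$ are the generating functions of the extremum seeking component of the extended system described in the context, and the Lie derivative notation in (2), (3) is explained there. Then for any $\delta\in\big(0,\sqrt{\sigma_{11}/\sigma_{12}}\,\mathrm{dist}(x^*,\partial D)\big)$ and any $\rho>0$ there exist $\bar\mu>0$, $\bar\gamma_1(\mu)>0$ and $\bar\varepsilon(\gamma_1,\mu)>0$ such that, for any $\mu\in(0,\bar\mu]$, any $\gamma_1\in[\bar\gamma_1(\mu),\infty)$ and any $\varepsilon\in(0,\bar\varepsilon(\gamma_1,\mu)]$, each $\pi_\varepsilon$-solution $(x(t),\xi(t))$ of the extended system (described in the context, with feedback $u_i=\varphi_i^\varepsilon(x,\xi,t)$ and with $x(0)=\xi(0)=x^0$), with $x^0\in\overline{B_\delta(x^* )}$, satisfies $$\|x(t)-x^*\|\le\beta\|x^0-x^*\|e^{-\lambda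 t}+\rho\quad\text{for all }t\in[0,\infty),$$ with some constants $\beta,\lambda>0$ (not depending on the solution or on $x^0$).
   Context: Basic notation. $\|\cdot\|$ is the Euclidean norm (or the induced matrix norm); $\delta_{ij}$ is the Kronecker delta; $B_\delta(x^* )$ is the $\delta$-neighborhood of $x^*$ and $\overline{B_\delta(x^* )}$ its closure; $\partial D$ is the boundary of $D$; $\mathrm{dist}(x^*,\partial D)$ is the Euclidean distance from $x^*$ to $\partial D$ (equal to $+\infty$ if $\partial D=\emptyset$). For functions or vector fields, $L_gf(x)=\lim_{s\to0}\frac{f(x+sg(x))-f(x)}{s}$, and the Lie bracket is $[f,g](x)=L_fg(x)-L_gf(x)$. The extended system. It is the system for $(x,\xi)\in D\times D$ $$\dot x=\sum_{i=1}^m u_if_i(x),\quad u_i=\varphi_i^\varepsilon(x,\xi,t),\quad y=J(x),\quad \dot\xi=g(y,t)=\sum_{j=1}^{2n}g_j(y)v_j^\mu(t)e_j,\quad x(0)=\xi(0)=x^0,$$ with positive parameters $\varepsilon,\mu,\gamma_1$. Stabilizing component. For $i=1,\dots,m$, $$\varphi_i^\varepsilon(x,\xi,t)=\sum_{i_1\in S_1}a_{i_1}(x,\xi)\delta_{ii_1}+\sqrt{\frac{4\pi}{\varepsilon}}\sum_{(i_1,i_2)\in S_2}\sqrt{\kappa_{i_1i_2}|a_{i_1i_2}(x,\xi)|}\Big(\delta_{ii_1}\mathrm{sign}(a_{i_1i_2}(x,\xi))\cos\frac{2\pi\kappa_{i_1i_2}t}{\varepsilon}+\delta_{ii_2}\sin\frac{2\pi\kappa_{i_1i_2}t}{\varepsilon}\Big),$$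 where $\kappa_{i_1i_2}\in\mathbb N$ (positive integers) are fixed and pairwise distinct for distinct pairs in $S_2$, and the vector $a(x,\xi)=\big((a_{i_1}(x,\xi))_{i_1\in S_1}\ (a_{i_1i_2}(x,\xi))_{(i_1,i_2)\in S_2}\big)^\top\in\mathbb R^n$ is $$a(x,\xi)=-\gamma_1\mathcal F^{-1}(x)(x-\xi),\qquad \mathcal F(x)=\Big((f_{j_1}(x))_{j_1\in S_1}\ \ ([f_{j_1},f_{j_2}](x))_{(j_1,j_2)\in S_2}\Big),$$ with the entries of $a$ ordered as the columns of $\mathcal F$; $\mathcal F^{-1}(x)$ is the inverse matrix, which exists by the span condition. Extremum seeking component. For $1\le j\le n$, $e_j$ is the $j$-th standard unit vector of $\mathbb R^n$; for $n+1\le j\le 2n$, $e_j$ is the $(j-n)$-th standard unit vector of $\mathbb R^n$. The real-valued functions $g_1,\dots,g_{2n}$ of one real variable satisfy, for a fixed constant $\gamma_2>0$, $$[g_j(z),g_{j+n}(z)]=g_j(z)g_{j+n}'(z)-g_{j+n}(z)g_j'(z)=-\gamma_2,\qquad j=1,\dots,n,$$ for $z\in J(D\setminus\{x^*\})$. (This holds, e.g., for $g_j=r_j\sin\phi_j$, $g_{j+n}=r_j\cos\phi_j$ with $r_j^2\phi_j'\equiv\gamma_2$.) The inputs are $$v_j^\mu(t)=\sqrt{\frac{4\pi k_j}{\mu}}\cos\frac{2\pi k_jt}{\mu}\ (1\le j\le n),\qquad v_j^\mu(t)=\sqrt{\frac{4\pi k_{j-n}}{\mu}}\sin\frac{2\pi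 k_{j-n}t}{\mu}\ (n+1\le j\le2n),$$ where $k_1,\dots,k_n\in\mathbb N$ (positive integers) are fixed and pairwise distinct. Lie derivative notation for the generating functions. Each $g_j(J(\cdot))$ appearing as the subscript of $L$ stands for the vector field $g_j(J(\cdot))e_j$. Thus $L_{g_j}g_i(J(\cdot))$ is the derivative of $x\mapsto g_i(J(x))$ along $g_j(J(x))e_j$, and $L_{g_l}L_{g_j}g_i(J(\cdot))$ is the derivative of the function $L_{g_j}g_i(J(\cdot))$ along $g_l(J(x))e_l$. In $L_{(g_{j_2}(J(x))-g_{j_2}(J(\xi)))}g_{j_1}(J(\xi))$ the function $\xi\mapsto g_{j_1}(J(\xi))$ is differentiated at the point $\xi$ in the direction $\big(g_{j_2}(J(x))-g_{j_2}(J(\xi))\big)e_{j_2}$. In $L_{g_{j_3}(J(x))}L_{g_{j_2}(J(\xi))}g_{j_1}(J(\xi))$ the function $\xi\mapsto L_{g_{j_2}}g_{j_1}(J(\xi))$ is differentiated at the point $\xi$ in the direction $g_{j_3}(J(x))e_{j_3}$ ($x$ fixed). $\pi_\varepsilon$-solution. Given $\varepsilon>0$, let $t_j=\varepsilon j$ and $I_j=[t_j,t_{j+1})$, $j=0,1,2,\dots$. A $\pi_\varepsilon$-solution of the extended system is an absolutely continuous function $(x(t),\xi(t))\in D\times D$, defined for $t\in[0,+\infty)$, with $x(0)=\xi(0)=x^0$, satisfying for each $j=0,1,2,\dots$ and $t\in I_j$ $$\dot x(t)=\sum_{i=1}^m\varphi_i^\varepsilon\big(x(t_j),\xi(t_j),t\big)f_i(x(t)),\qquad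 \dot\xi(t)=g\big(J(x(t)),t\big).$$ *)

theory Defs
  imports "HOL-Analysis.Analysis"
begin

section \<open>Calculus\<close>

text \<open>
  Functions on a set \<open>S\<close> are total functions of which only the behaviour on \<open>S\<close> matters.
  Derivatives are full ones (\<^term>\<open>at x\<close>); for open \<open>S\<close> this is the usual class of \<open>k\<close> times
  continuously differentiable functions on \<open>S\<close>, all iterated directional derivatives of order at
  most \<open>k\<close> being continuous.
\<close>

primrec Ck_on :: "nat \<Rightarrow> 'a::real_normed_vector set \<Rightarrow> ('a \<Rightarrow> 'b::real_normed_vector) \<Rightarrow> bool" where
  "Ck_on 0 S f \<longleftrightarrow> continuous_on S f"
| "Ck_on (Suc k) S f \<longleftrightarrow>
     (\<forall>x\<in>S. f differentiable (at x)) \<and> (\<forall>v. Ck_on k S (\<lambda>x. frechet_derivative f (at x) v))"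

definition grad :: "(real ^ 'n \<Rightarrow> real) \<Rightarrow> real ^ 'n \<Rightarrow> real ^ ('n::finite)" where
  "grad F x = (\<chi> i. frechet_derivative F (at x) (axis i 1))"

definition hessian :: "(real ^ 'n \<Rightarrow> real) \<Rightarrow> real ^ 'n \<Rightarrow> real ^ 'n ^ ('n::finite)" where
  "hessian F x = (\<chi> i j. frechet_derivative (\<lambda>y. frechet_derivative F (at y) (axis j 1)) (at x) (axis i 1))"

definition matrix_norm :: "real ^ 'n ^ 'm \<Rightarrow> real" where
  "matrix_norm A = onorm (\<lambda>v. A *v v)"

text \<open>The infimum of the empty set is \<open>\<infinity>\<close>, which is the intended value if \<open>D\<close> has no boundary.\<close>

definition boundary_dist :: "'a::metric_space \<Rightarrow> 'a set \<Rightarrow> ereal" where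
  "boundary_dist x D = (INF y\<in>frontier D. ereal (dist x y))"

definition abs_continuous_on :: "real set \<Rightarrow> (real \<Rightarrow> 'a::metric_space) \<Rightarrow> bool" where
  "abs_continuous_on S h \<longleftrightarrow>
     (\<forall>e>0. \<exists>d>0. \<forall>I :: (real \<times> real) set.
        finite I \<and> (\<forall>(a, b)\<in>I. a \<le> b \<and> {a..b} \<subseteq> S) \<and>
        pairwise (\<lambda>p q. {fst p<..<snd p} \<inter> {fst q<..<snd q} = {}) I \<and>
        (\<Sum>(a, b)\<in>I. b - a) < d
        \<longrightarrow> (\<Sum>(a, b)\<in>I. dist (h a) (h b)) < e)"


section \<open>Lie derivatives and Lie brackets\<close>

text \<open>
  \<open>lie_deriv g f x\<close> is \<open>L\<^sub>g f (x)\<close>. It is a limit and hence unspecified if the limit does not exist;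
  \<open>lie_differentiable\<close> says that it does.
\<close>

definition lie_quotient ::
    "('a::real_normed_vector \<Rightarrow> 'a) \<Rightarrow> ('a \<Rightarrow> 'b::real_normed_vector) \<Rightarrow> 'a \<Rightarrow> real \<Rightarrow> 'b" where
  "lie_quotient g f x s = (f (x + s *\<^sub>R g x) - f x) /\<^sub>R s"

definition lie_differentiable ::
    "('a::real_normed_vector \<Rightarrow> 'a) \<Rightarrow> ('a \<Rightarrow> 'b::real_normed_vector) \<Rightarrow> 'a \<Rightarrow> bool" where
  "lie_differentiable g f x \<longleftrightarrow> (\<exists>l. (lie_quotient g f x \<longlongrightarrow> l) (at 0))"

definition lie_deriv ::
    "('a::real_normed_vector \<Rightarrow> 'a) \<Rightarrow> ('a \<Rightarrow> 'b::real_normed_vector) \<Rightarrow> 'a \<Rightarrow> 'b" where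
  "lie_deriv g f x = Lim (at 0) (lie_quotient g f x)"

definition lie_bracket ::
    "('a::real_normed_vector \<Rightarrow> 'a) \<Rightarrow> ('a \<Rightarrow> 'a) \<Rightarrow> 'a \<Rightarrow> 'a" where
  "lie_bracket f g x = lie_deriv f g x - lie_deriv g f x"


section \<open>The stabilizing component\<close>

text \<open>
  The columns of the matrix \<open>\<F>(x)\<close> are labelled by \<open>S\<^sub>1 <+> S\<^sub>2\<close>, with \<open>Inl i\<close> standing for
  \<open>f\<^sub>i\<close> and \<open>Inr (i, j)\<close> for \<open>[f\<^sub>i, f\<^sub>j]\<close>. The order of the columns is given by a bijection
  \<open>c\<close> from the index type \<open>'n\<close> onto \<open>S\<^sub>1 <+> S\<^sub>2\<close>.
\<close>

definition frame_field ::
    "('m \<Rightarrow> real ^ 'n \<Rightarrow> real ^ 'n) \<Rightarrow> 'm + 'm \<times> 'm \<Rightarrow> real ^ 'n \<Rightarrow> real ^ ('n::finite)" where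
  "frame_field f s = (case s of Inl i \<Rightarrow> f i | Inr (i, j) \<Rightarrow> lie_bracket (f i) (f j))"

definition frame_matrix ::
    "('m \<Rightarrow> real ^ 'n \<Rightarrow> real ^ 'n) \<Rightarrow> ('n \<Rightarrow> 'm + 'm \<times> 'm) \<Rightarrow> real ^ 'n \<Rightarrow> real ^ 'n ^ ('n::finite)" where
  "frame_matrix f c x = (\<chi> row col. frame_field f (c col) x $ row)"

definition stab_coeff ::
    "('m \<Rightarrow> real ^ 'n \<Rightarrow> real ^ 'n) \<Rightarrow> ('n \<Rightarrow> 'm + 'm \<times> 'm) \<Rightarrow> real \<Rightarrow>
     real ^ 'n \<Rightarrow> real ^ ('n::finite) \<Rightarrow> 'm + 'm \<times> 'm \<Rightarrow> real" where
  "stab_coeff f c \<gamma>1 x \<xi> s = ((- \<gamma>1) *\<^sub>R (matrix_inv (frame_matrix f c x) *v (x - \<xi>))) $ (inv c s)"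

definition stab_input ::
    "('m \<Rightarrow> real ^ 'n \<Rightarrow> real ^ 'n) \<Rightarrow> ('n \<Rightarrow> 'm + 'm \<times> 'm) \<Rightarrow> 'm set \<Rightarrow> ('m \<times> 'm) set \<Rightarrow>
     ('m \<times> 'm \<Rightarrow> nat) \<Rightarrow> real \<Rightarrow> real \<Rightarrow> 'm \<Rightarrow> real ^ 'n \<Rightarrow> real ^ ('n::finite) \<Rightarrow> real \<Rightarrow> real" where
  "stab_input f c S1 S2 \<kappa> \<gamma>1 \<epsilon> i x \<xi> t =
     (let a = stab_coeff f c \<gamma>1 x \<xi> in
       (\<Sum>i1\<in>S1. a (Inl i1) * of_bool (i = i1)) +
       sqrt (4 * pi / \<epsilon>) *
         (\<Sum>(i1, i2)\<in>S2.
            sqrt (real (\<kappa> (i1, i2)) * \<bar>a (Inr (i1, i2))\<bar>) *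
              (of_bool (i = i1) * sgn (a (Inr (i1, i2))) * cos (2 * pi * real (\<kappa> (i1, i2)) * t / \<epsilon>) +
               of_bool (i = i2) * sin (2 * pi * real (\<kappa> (i1, i2)) * t / \<epsilon>))))"


section \<open>The extremum seeking component\<close>

text \<open>
  The \<open>2n\<close> generating functions are indexed by \<open>'n + 'n\<close>: \<open>Inl j\<close> stands for the index \<open>j\<close>
  and \<open>Inr j\<close> for the index \<open>j + n\<close>.
\<close>

definition es_dir :: "'n + 'n \<Rightarrow> real ^ ('n::finite)" where
  "es_dir j = (case j of Inl i \<Rightarrow> axis i 1 | Inr i \<Rightarrow> axis i 1)"

definition es_input :: "('n \<Rightarrow> nat) \<Rightarrow> real \<Rightarrow> 'n + 'n \<Rightarrow> real \<Rightarrow> real" where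
  "es_input k \<mu> j t =
     (case j of
        Inl i \<Rightarrow> sqrt (4 * pi * real (k i) / \<mu>) * cos (2 * pi * real (k i) * t / \<mu>)
      | Inr i \<Rightarrow> sqrt (4 * pi * real (k i) / \<mu>) * sin (2 * pi * real (k i) * t / \<mu>))"

definition es_rhs ::
    "('n + 'n \<Rightarrow> real \<Rightarrow> real) \<Rightarrow> ('n \<Rightarrow> nat) \<Rightarrow> real \<Rightarrow> real \<Rightarrow> real \<Rightarrow> real ^ ('n::finite)" where
  "es_rhs g k \<mu> y t = (\<Sum>j\<in>UNIV. (g j y * es_input k \<mu> j t) *\<^sub>R es_dir j)"

definition gen_field ::
    "('n + 'n \<Rightarrow> real \<Rightarrow> real) \<Rightarrow> (real ^ 'n \<Rightarrow> real) \<Rightarrow> 'n + 'n \<Rightarrow> real ^ 'n \<Rightarrow> real ^ ('n::finite)" where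
  "gen_field g J j x = g j (J x) *\<^sub>R es_dir j"

definition gen_lie1 ::
    "('n + 'n \<Rightarrow> real \<Rightarrow> real) \<Rightarrow> (real ^ 'n \<Rightarrow> real) \<Rightarrow> 'n + 'n \<Rightarrow> 'n + 'n \<Rightarrow> real ^ ('n::finite) \<Rightarrow> real" where
  "gen_lie1 g J j i = lie_deriv (gen_field g J j) (\<lambda>x. g i (J x))"


section \<open>Sampled solutions of the extended system\<close>

text \<open>
  On \<open>[0, \<infinity>)\<close>, absolute continuity means absolute continuity on every \<open>[0, T]\<close>. The derivatives
  are taken within the sampling interval, hence they are right derivatives at the sampling instants,
  where \<open>x\<close> may have a corner.
\<close>

definition pi_solution ::
    "(real ^ 'n) set \<Rightarrow> ('m \<Rightarrow> real ^ 'n \<Rightarrow> real ^ 'n) \<Rightarrow> ('n \<Rightarrow> 'm + 'm \<times> 'm) \<Rightarrow> 'm set \<Rightarrow> ('m \<times> 'm) set \<Rightarrow>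
     ('m \<times> 'm \<Rightarrow> nat) \<Rightarrow> (real ^ 'n \<Rightarrow> real) \<Rightarrow> ('n + 'n \<Rightarrow> real \<Rightarrow> real) \<Rightarrow> ('n \<Rightarrow> nat) \<Rightarrow>
     real \<Rightarrow> real \<Rightarrow> real \<Rightarrow> real ^ 'n \<Rightarrow> (real \<Rightarrow> real ^ 'n) \<Rightarrow> (real \<Rightarrow> real ^ ('n::finite)) \<Rightarrow> bool" where
  "pi_solution D f c S1 S2 \<kappa> J g k \<mu> \<gamma>1 \<epsilon> x0 x \<xi> \<longleftrightarrow>
     (\<forall>T\<ge>0. abs_continuous_on {0..T} (\<lambda>t. (x t, \<xi> t))) \<and>
     (\<forall>t\<ge>0. x t \<in> D \<and> \<xi> t \<in> D) \<and>
     x 0 = x0 \<and> \<xi> 0 = x0 \<and>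
     (\<forall>j::nat. \<forall>t\<in>{\<epsilon> * real j..<\<epsilon> * real (j + 1)}.
        (x has_vector_derivative
           (\<Sum>i\<in>UNIV. stab_input f c S1 S2 \<kappa> \<gamma>1 \<epsilon> i (x (\<epsilon> * real j)) (\<xi> (\<epsilon> * real j)) t *\<^sub>R f i (x t)))
          (at t within {\<epsilon> * real j..<\<epsilon> * real (j + 1)}) \<and>
        (\<xi> has_vector_derivative es_rhs g k \<mu> (J (x t)) t)
          (at t within {\<epsilon> * real j..<\<epsilon> * real (j + 1)}))"

end

theory Submission
  imports Defs
begin

text \<open>
  Near a trajectory that stays in a compact ball \<open>K\<close> around \<open>x\<^sup>*\<close>, both high-frequency inputs are
  averaged by the same near-identity change of variables: for \<open>y' = e + \<Sum>\<^sub>b u\<^sub>b F\<^sub>b(y)\<close> with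
  \<open>U\<^sub>b' = u\<^sub>b\<close> and \<open>W\<^sub>b\<^sub>c' = U\<^sub>b u\<^sub>c - m\<^sub>b\<^sub>c\<close> all vanishing at multiples of the period, the quantity
  \<open>y - \<Sum> U\<^sub>b F\<^sub>b(y) + \<Sum> W\<^sub>b\<^sub>c (DF\<^sub>b F\<^sub>c)(y)\<close> has the averaged derivative \<open>e - \<Sum> m\<^sub>b\<^sub>c DF\<^sub>b F\<^sub>c\<close>, a sum
  of Lie brackets, up to an error of the order of the square root of the period.

  Over one sampling interval this gives \<open>x - \<xi> \<mapsto> (1 - \<epsilon>\<gamma>\<^sub>1)(x - \<xi>) + O(\<epsilon>)\<close>, so that \<open>x\<close> tracks \<open>\<xi>\<close> as
  closely as desired. Over one period \<open>\<mu>\<close> it gives \<open>\<xi> \<mapsto> \<xi> - \<mu>\<gamma>\<^sub>2\<nabla>J(\<xi>) + O(\<mu>\<^bsup>3/2\<^esup>)\<close> as long as \<open>\<xi>\<close> keeps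
  away from \<open>x\<^sup>*\<close>, where the generating functions need not be smooth; hence \<open>J - J\<^sup>*\<close> decreases
  geometrically. Once \<open>\<xi>\<close> is within a small distance \<open>r\<close> of \<open>x\<^sup>*\<close>, a single period moves it by
  \<open>O(\<surd>\<mu>)\<close> only, so it remains within \<open>2r\<close> until the decrease sets in again. These bounds keep the
  trajectory strictly inside \<open>K\<close>.
\<close>

section \<open>Periodic primitives of the inputs\<close>

text \<open>Three obstacles shape the argument. The feedback contains
  \<open>sqrt \<bar>a\<bar>\<close>, which is not smooth in the state. Sampling removes this: over a
  window of length \<epsilon> the coefficients are frozen, so the averaged fields are constant
  multiples of the \<open>f i\<close>. Next, the two oscillations are averaged separately: \<mu> is
  chosen first, then \<gamma>1 so large that \<open>norm (x - \<xi>)\<close> is at most \<mu>, then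
  \<epsilon>. Reading the generating functions at \<open>x\<close> instead of \<xi> then costs \<mu>
  times a dither amplitude of order 1 / sqrt \<mu>, hence no more than the averaging error. Last,
  the constants are bounds on compact sets, so each estimate presupposes that the trajectory is in
  \<open>K\<close> up to a time \<open>T\<close>; the thresholds do not depend on \<open>T\<close>,
  and a first-exit argument removes the presupposition. It needs room: passing from distance to cost
  and back loses the factor sqrt (\<sigma>12 / \<sigma>11), whence the inverse factor in the range
  of \<delta>.\<close>

lemma norm_diff_le_derivative_bound:
  fixes z :: "real \<Rightarrow> 'a::euclidean_space"
  assumes ab: "a \<le> b" and S: "finite S" and cont: "continuous_on {a..b} z" and B: "0 \<le> B"
    and der: "\<And>t. t \<in> {a<..<b} - S \<Longrightarrow> (z has_vector_derivative z' t) (at t)"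
    and bd: "\<And>t. t \<in> {a<..<b} - S \<Longrightarrow> norm (z' t) \<le> B"
  shows "norm (z b - z a) \<le> B * (b - a)"
proof -
  define w where "w t = (if t \<in> {a<..<b} - S then z' t else 0)" for t
  have "(w has_integral (z b - z a)) {a..b}"
  proof (rule fundamental_theorem_of_calculus_interior_strong[OF S ab _ cont])
    fix t assume "t \<in> {a<..<b} - S"
    then show "(z has_vector_derivative w t) (at t)"
      using der by (simp add: w_def)
  qed
  then have "norm (z b - z a) \<le> B * measure lborel (cbox a b)"
    by (intro has_integral_bound[OF B]) (auto simp: w_def B bd)
  then show ?thesis using ab by simp
qed

text \<open>In place of periodicity, only the zeros at window ends and a global bound are recorded:
  the zeros make the change of variables trivial at the ends of a window, the bound controls it in
  between.\<close>

definition periodic_primitive :: "real \<Rightarrow> real \<Rightarrow> (real \<Rightarrow> real) \<Rightarrow> (real \<Rightarrow> real) \<Rightarrow> bool" where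
  "periodic_primitive \<epsilon> B \<phi> W \<longleftrightarrow>
     (\<forall>t. (W has_real_derivative \<phi> t) (at t)) \<and> (\<forall>j::nat. W (\<epsilon> * real j) = 0) \<and> (\<forall>t. \<bar>W t\<bar> \<le> B)"

lemma periodic_primitive_add:
  assumes "periodic_primitive \<epsilon> A \<phi> V" "periodic_primitive \<epsilon> B \<psi> W"
  shows "periodic_primitive \<epsilon> (A + B) (\<lambda>t. \<phi> t + \<psi> t) (\<lambda>t. V t + W t)"
  using assms unfolding periodic_primitive_def
  by (auto intro!: derivative_eq_intros order_trans[OF abs_triangle_ineq] add_mono)

lemma periodic_primitive_cmult:
  assumes "periodic_primitive \<epsilon> A \<phi> V"
  shows "periodic_primitive \<epsilon> (\<bar>c\<bar> * A) (\<lambda>t. c * \<phi> t) (\<lambda>t. c * V t)"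
  using assms unfolding periodic_primitive_def
  by (auto intro!: derivative_eq_intros mult_left_mono simp: abs_mult)

lemma periodic_primitive_mono:
  "periodic_primitive \<epsilon> A \<phi> V \<Longrightarrow> A \<le> B \<Longrightarrow> periodic_primitive \<epsilon> B \<phi> V"
  unfolding periodic_primitive_def by (meson order_trans)

lemma sin_cos_period:
  fixes n :: int
  assumes "\<epsilon> > 0"
  shows "sin (2 * pi * real_of_int n * (\<epsilon> * real j) / \<epsilon>) = 0"
    and "cos (2 * pi * real_of_int n * (\<epsilon> * real j) / \<epsilon>) = 1"
proof -
  have eq: "2 * pi * real_of_int n * (\<epsilon> * real j) / \<epsilon> = 2 * pi * real_of_int (n * int j)"
    using assms by (simp add: field_simps)
  show "sin (2 * pi * real_of_int n * (\<epsilon> * real j) / \<epsilon>) = 0"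
    unfolding eq by (rule sin_int_2pin)
  show "cos (2 * pi * real_of_int n * (\<epsilon> * real j) / \<epsilon>) = 1"
    unfolding eq by (rule cos_int_2pin)
qed

text \<open>The primitive of the sine is normalised with \<open>1 - cos\<close> so that it vanishes
  at multiples of \<epsilon>. The numerators are at most 2 and
  \<open>\<epsilon> * \<bar>\<omega>\<bar>\<close> is at least 2 pi, which gives the bound
  \<epsilon>. An integer \<open>n\<close> admits the negative frequency differences of the product
  formulas.\<close>

lemma periodic_primitive_trig:
  fixes n :: int
  assumes e: "\<epsilon> > 0" and n: "n \<noteq> 0"
  defines "\<omega> \<equiv> 2 * pi * real_of_int n / \<epsilon>"
  shows "periodic_primitive \<epsilon> \<epsilon> (\<lambda>t. cos (2 * pi * real_of_int n * t / \<epsilon>)) (\<lambda>t. sin (2 * pi * real_of_int n * t / \<epsilon>) / \<omega>)"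
    and "periodic_primitive \<epsilon> \<epsilon> (\<lambda>t. sin (2 * pi * real_of_int n * t / \<epsilon>)) (\<lambda>t. (1 - cos (2 * pi * real_of_int n * t / \<epsilon>)) / \<omega>)"
proof -
  have w: "\<omega> \<noteq> 0" using e n by (simp add: \<omega>_def)
  have eq: "2 * pi * real_of_int n * t / \<epsilon> = \<omega> * t" for t
    by (simp add: \<omega>_def)
  have n1: "1 \<le> \<bar>real_of_int n\<bar>" using n by linarith
  have "2 \<le> \<epsilon> * \<bar>\<omega>\<bar>"
  proof -
    have "\<epsilon> * \<bar>\<omega>\<bar> = 2 * pi * \<bar>real_of_int n\<bar>" using e by (simp add: \<omega>_def abs_mult)
    also have "\<dots> \<ge> 2 * pi * 1" using n1 by (intro mult_left_mono) auto
    moreover have "2 * pi * 1 \<ge> 2" using pi_ge_two by linarith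
    ultimately show ?thesis by linarith
  qed
  then have bd: "\<bar>x\<bar> \<le> 2 \<Longrightarrow> \<bar>x / \<omega>\<bar> \<le> \<epsilon>" for x
    using w by (simp add: field_simps)
  have bc: "\<bar>1 - cos (x::real)\<bar> \<le> 2" for x
    using cos_ge_minus_one[of x] cos_le_one[of x] by linarith
  have bs: "\<bar>sin (x::real)\<bar> \<le> 2" for x
    using abs_sin_le_one[of x] by linarith
  have bs': "\<bar>sin x\<bar> / \<bar>\<omega>\<bar> \<le> \<epsilon>" for x
    using bd[OF bs] by simp
  note per = sin_cos_period[OF e, of n, unfolded eq]
  show "periodic_primitive \<epsilon> \<epsilon> (\<lambda>t. cos (2 * pi * real_of_int n * t / \<epsilon>)) (\<lambda>t. sin (2 * pi * real_of_int n * t / \<epsilon>) / \<omega>)"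
    unfolding periodic_primitive_def eq
    using w by (auto intro!: derivative_eq_intros bs' simp: per)
  show "periodic_primitive \<epsilon> \<epsilon> (\<lambda>t. sin (2 * pi * real_of_int n * t / \<epsilon>)) (\<lambda>t. (1 - cos (2 * pi * real_of_int n * t / \<epsilon>)) / \<omega>)"
    unfolding periodic_primitive_def eq
    using w by (auto intro!: derivative_eq_intros bd bc simp: per simp del: abs_divide)
qed

text \<open>Product-to-sum formulas leave the frequencies \<open>p + q\<close>, \<open>p - q\<close>
  and, from the 1 in \<open>1 - c p t\<close>, also \<open>q\<close>. Their weights are at most 1/2,
  1/2 and 1, so the bounds add up to \<open>2 * \<epsilon>\<close>.\<close>

lemma periodic_primitive_trig_products:
  fixes p q :: nat
  assumes e: "\<epsilon> > 0" and p: "p > 0" and q: "q > 0"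
  defines "s \<equiv> (\<lambda>p t. sin (2 * pi * real p * t / \<epsilon>))" and "c \<equiv> (\<lambda>p t. cos (2 * pi * real p * t / \<epsilon>))"
  shows "\<exists>W. periodic_primitive \<epsilon> (2 * \<epsilon>) (\<lambda>t. s p t * c q t) W"
    and "\<exists>W. periodic_primitive \<epsilon> (2 * \<epsilon>) (\<lambda>t. s p t * s q t - of_bool (p = q) / 2) W"
    and "\<exists>W. periodic_primitive \<epsilon> (2 * \<epsilon>) (\<lambda>t. (1 - c p t) * c q t + of_bool (p = q) / 2) W"
    and "\<exists>W. periodic_primitive \<epsilon> (2 * \<epsilon>) (\<lambda>t. (1 - c p t) * s q t) W"
proof -
  define a where "a t = 2 * pi * real p * t / \<epsilon>" for t
  define b where "b t = 2 * pi * real q * t / \<epsilon>" for t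
  have plus: "2 * pi * real_of_int (int p + int q) * t / \<epsilon> = a t + b t" for t
    by (simp add: a_def b_def ring_distribs add_divide_distrib)
  have minus: "2 * pi * real_of_int (int p - int q) * t / \<epsilon> = a t - b t" for t
    by (simp add: a_def b_def ring_distribs diff_divide_distrib)
  have qq: "2 * pi * real_of_int (int q) * t / \<epsilon> = b t" for t
    by (simp add: b_def)
  have zero: "periodic_primitive \<epsilon> \<epsilon> (\<lambda>t. 0) (\<lambda>t. 0)"
    using e by (auto simp: periodic_primitive_def)
  note T = periodic_primitive_trig[OF e]
  have nz: "int p + int q \<noteq> 0" "int q \<noteq> 0" using p q by auto
  obtain C1 S1 where C1: "periodic_primitive \<epsilon> \<epsilon> (\<lambda>t. cos (a t + b t)) C1"
    and S1: "periodic_primitive \<epsilon> \<epsilon> (\<lambda>t. sin (a t + b t)) S1"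
    using T[OF nz(1)] unfolding plus by blast
  obtain C3 S3 where C3: "periodic_primitive \<epsilon> \<epsilon> (\<lambda>t. cos (b t)) C3"
    and S3: "periodic_primitive \<epsilon> \<epsilon> (\<lambda>t. sin (b t)) S3"
    using T[OF nz(2)] unfolding qq by blast
  \<comment> \<open>In the resonant case \<open>p = q\<close> the cosine of the difference is the
    constant 1. Its removal is the origin of all the \<open>of_bool\<close> terms, and both
    integrands become zero.\<close>
  have "\<exists>C S. periodic_primitive \<epsilon> \<epsilon> (\<lambda>t. cos (a t - b t) - of_bool (p = q)) C \<and> periodic_primitive \<epsilon> \<epsilon> (\<lambda>t. sin (a t - b t)) S"
  proof (cases "p = q")
    case True
    then have "a t - b t = 0" for t by (simp add: a_def b_def)
    then show ?thesis using True zero by auto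
  next
    case False
    then have "int p - int q \<noteq> 0" by simp
    from T[OF this] False show ?thesis unfolding minus by auto
  qed
  then obtain C2 S2 where C2: "periodic_primitive \<epsilon> \<epsilon> (\<lambda>t. cos (a t - b t) - of_bool (p = q)) C2"
    and S2: "periodic_primitive \<epsilon> \<epsilon> (\<lambda>t. sin (a t - b t)) S2" by blast
  have comb: "\<exists>W. periodic_primitive \<epsilon> (2 * \<epsilon>) \<psi> W"
    if "periodic_primitive \<epsilon> \<epsilon> x1 X1" "periodic_primitive \<epsilon> \<epsilon> x2 X2" "periodic_primitive \<epsilon> \<epsilon> x3 X3"
      "\<bar>c1\<bar> \<le> 1/2" "\<bar>c2\<bar> \<le> 1/2" "\<bar>c3\<bar> \<le> 1" "\<And>t. \<psi> t = c1 * x1 t + c2 * x2 t + c3 * x3 t"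
    for x1 x2 x3 X1 X2 X3 c1 c2 c3 \<psi>
  proof -
    have "\<psi> = (\<lambda>t. c1 * x1 t + c2 * x2 t + c3 * x3 t)" using that(7) by blast
    moreover have "periodic_primitive \<epsilon> (\<bar>c1\<bar> * \<epsilon> + \<bar>c2\<bar> * \<epsilon> + \<bar>c3\<bar> * \<epsilon>) (\<lambda>t. c1 * x1 t + c2 * x2 t + c3 * x3 t) (\<lambda>t. c1 * X1 t + c2 * X2 t + c3 * X3 t)"
      by (intro periodic_primitive_add periodic_primitive_cmult that)
    moreover have "\<bar>c1\<bar> * \<epsilon> + \<bar>c2\<bar> * \<epsilon> + \<bar>c3\<bar> * \<epsilon> \<le> 2 * \<epsilon>"
      using mult_right_mono[of "\<bar>c1\<bar> + \<bar>c2\<bar> + \<bar>c3\<bar>" 2 \<epsilon>] that e by (simp add: ring_distribs)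
    ultimately show ?thesis using periodic_primitive_mono by blast
  qed
  have unf: "s p = (\<lambda>t. sin (a t))" "c p = (\<lambda>t. cos (a t))" "s q = (\<lambda>t. sin (b t))" "c q = (\<lambda>t. cos (b t))"
    by (auto simp: s_def c_def a_def b_def)
  show "\<exists>W. periodic_primitive \<epsilon> (2 * \<epsilon>) (\<lambda>t. s p t * c q t) W"
    by (rule comb[OF S1 S2 zero, of "1/2" "1/2" 0]) (auto simp: unf sin_add sin_diff field_simps)
  show "\<exists>W. periodic_primitive \<epsilon> (2 * \<epsilon>) (\<lambda>t. s p t * s q t - of_bool (p = q) / 2) W"
    by (rule comb[OF C1 C2 zero, of "-1/2" "1/2" 0]) (auto simp: unf cos_add cos_diff field_simps)
  show "\<exists>W. periodic_primitive \<epsilon> (2 * \<epsilon>) (\<lambda>t. (1 - c p t) * c q t + of_bool (p = q) / 2) W"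
    by (rule comb[OF C1 C2 C3, of "-1/2" "-1/2" 1]) (auto simp: unf cos_add cos_diff field_simps)
  show "\<exists>W. periodic_primitive \<epsilon> (2 * \<epsilon>) (\<lambda>t. (1 - c p t) * s q t) W"
    by (rule comb[OF S1 S2 S3, of "-1/2" "1/2" 1]) (auto simp: unf sin_add sin_diff field_simps)
qed

text \<open>The mean over a period of the product of the primitive of the input \<open>b\<close> and the input \<open>b'\<close>.\<close>

definition dither_mean :: "'p + 'p \<Rightarrow> 'p + 'p \<Rightarrow> real" where
  "dither_mean b b' = (case (b, b') of
      (Inl p, Inr q) \<Rightarrow> of_bool (p = q) | (Inr p, Inl q) \<Rightarrow> - of_bool (p = q) | _ \<Rightarrow> 0)"

text \<open>A crude constant with two uses. It dominates both 4 and
  \<open>4 * real (\<kappa> p)\<close>, so its square dominates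
  \<open>4 * pi * real (\<kappa> p)\<close>, the squared amplitude of an input up to 1 / \<epsilon>;
  it also bounds the coefficients of products of an input with a primitive.\<close>

definition dither_amplitude :: "'p set \<Rightarrow> ('p \<Rightarrow> nat) \<Rightarrow> real" where
  "dither_amplitude P \<kappa> = 4 * (1 + (\<Sum>p\<in>P. real (\<kappa> p)))"

lemma dither_amplitude_nonneg: "dither_amplitude P \<kappa> \<ge> 0"
  by (simp add: dither_amplitude_def sum_nonneg add_nonneg_nonneg)

lemma frequency_le_dither_amplitude:
  assumes "finite P" "p \<in> P"
  shows "4 * real (\<kappa> p) \<le> dither_amplitude P \<kappa>"
  using member_le_sum[of p P "\<lambda>p. real (\<kappa> p)"] assms unfolding dither_amplitude_def by simp

lemma dither_amplitude_bound:
  assumes P: "finite P" "p \<in> P" and e: "\<epsilon> > 0"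
  shows "sqrt (4 * pi * real (\<kappa> p) / \<epsilon>) \<le> dither_amplitude P \<kappa> / sqrt \<epsilon>"
proof -
  have 4: "4 \<le> dither_amplitude P \<kappa>" unfolding dither_amplitude_def by (simp add: sum_nonneg)
  have "sqrt (4 * pi * real (\<kappa> p)) \<le> dither_amplitude P \<kappa>"
  proof (rule real_le_lsqrt)
    have "4 * pi * real (\<kappa> p) \<le> 4 * (4 * real (\<kappa> p))"
      using pi_less_4 by (simp add: mult_right_mono)
    also have "\<dots> \<le> dither_amplitude P \<kappa> * dither_amplitude P \<kappa>"
      using 4 frequency_le_dither_amplitude[OF P] by (intro mult_mono) auto
    finally show "4 * pi * real (\<kappa> p) \<le> (dither_amplitude P \<kappa>)\<^sup>2" by (simp add: power2_eq_square)
  qed (use 4 in auto)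
  then show ?thesis using e by (simp add: real_sqrt_divide divide_right_mono)
qed

lemma es_input_bound:
  assumes P: "finite P" and e: "\<epsilon> > 0" and b: "b \<in> P <+> P"
  shows "\<bar>es_input \<kappa> \<epsilon> b t\<bar> \<le> dither_amplitude P \<kappa> / sqrt \<epsilon>"
proof -
  have *: "\<bar>sqrt (4 * pi * real (\<kappa> p) / \<epsilon>) * x\<bar> \<le> dither_amplitude P \<kappa> / sqrt \<epsilon>" if "p \<in> P" "\<bar>x\<bar> \<le> 1" for p x
  proof -
    have "\<bar>sqrt (4 * pi * real (\<kappa> p) / \<epsilon>) * x\<bar> \<le> sqrt (4 * pi * real (\<kappa> p) / \<epsilon>) * 1"
      unfolding abs_mult using that e by (intro mult_mono) auto
    then show ?thesis using dither_amplitude_bound[where \<kappa> = \<kappa>, OF P that(1) e] by linarith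
  qed
  show ?thesis using b by (auto simp: es_input_def intro!: *)
qed

text \<open>Integration gains a factor \<epsilon> against amplitudes of order 1 / sqrt \<epsilon>,
  so \<open>U\<close> is of order sqrt \<epsilon>. In a product
  \<open>U b t * es_input \<kappa> \<epsilon> b' t\<close> the powers of \<epsilon> cancel: its
  coefficient \<open>C p q\<close> equals 2 sqrt (\<kappa> p * \<kappa> q) / \<kappa> p, and 2 for
  \<open>p = q\<close>. Together with the mean 1/2 of a squared sine or cosine this makes the
  nonzero means equal to 1 and -1, which explains the factor 4 pi in the inputs. Injectivity of
  \<kappa> excludes resonance between different pairs.\<close>

lemma dither_primitives:
  fixes \<kappa> :: "'p \<Rightarrow> nat"
  assumes P: "finite P" and pos: "\<And>p. p \<in> P \<Longrightarrow> \<kappa> p > 0" and inj: "inj_on \<kappa> P" and e: "\<epsilon> > 0"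
  defines "\<Omega> \<equiv> dither_amplitude P \<kappa>"
  obtains U W where
    "\<And>b. b \<in> P <+> P \<Longrightarrow> periodic_primitive \<epsilon> (\<Omega> * sqrt \<epsilon>) (es_input \<kappa> \<epsilon> b) (U b)"
    "\<And>b b'. b \<in> P <+> P \<Longrightarrow> b' \<in> P <+> P \<Longrightarrow>
        periodic_primitive \<epsilon> (\<Omega> * \<epsilon>) (\<lambda>t. U b t * es_input \<kappa> \<epsilon> b' t - dither_mean b b') (W b b')"
proof -
  note amp = dither_amplitude_bound[where \<kappa> = \<kappa>, OF P, folded \<Omega>_def]
  define A where "A p = sqrt (4 * pi * real (\<kappa> p) / \<epsilon>)" for p
  define \<omega> where "\<omega> p = 2 * pi * real (\<kappa> p) / \<epsilon>" for p
  define U where "U b t = (case b of Inl p \<Rightarrow> A p * (sin (2 * pi * real (\<kappa> p) * t / \<epsilon>) / \<omega> p)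
     | Inr p \<Rightarrow> A p * ((1 - cos (2 * pi * real (\<kappa> p) * t / \<epsilon>)) / \<omega> p))" for b t
  have A0: "A p \<ge> 0" for p using e by (simp add: A_def)
  have Ae: "\<bar>A p\<bar> * \<epsilon> \<le> \<Omega> * sqrt \<epsilon>" if "p \<in> P" for p
  proof -
    have "A p * \<epsilon> \<le> \<Omega> / sqrt \<epsilon> * \<epsilon>"
      using amp[OF that e] e by (intro mult_right_mono) (auto simp: A_def)
    also have "\<dots> = \<Omega> * sqrt \<epsilon>" using e by (simp add: real_div_sqrt field_simps)
    finally show ?thesis using A0[of p] by simp
  qed
  have U: "periodic_primitive \<epsilon> (\<Omega> * sqrt \<epsilon>) (es_input \<kappa> \<epsilon> b) (U b)" if b: "b \<in> P <+> P" for b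
  proof (cases b)
    case (Inl p)
    then have p: "p \<in> P" using b by auto
    have "periodic_primitive \<epsilon> (\<bar>A p\<bar> * \<epsilon>) (\<lambda>t. A p * cos (2 * pi * real (\<kappa> p) * t / \<epsilon>)) (\<lambda>t. A p * (sin (2 * pi * real (\<kappa> p) * t / \<epsilon>) / \<omega> p))"
      using periodic_primitive_cmult[OF periodic_primitive_trig(1)[OF e, of "int (\<kappa> p)"]] pos[OF p]
      by (auto simp: \<omega>_def)
    from periodic_primitive_mono[OF this Ae[OF p]] show ?thesis
      unfolding Inl by (simp add: es_input_def[abs_def] U_def[abs_def] A_def)
  next
    case (Inr p)
    then have p: "p \<in> P" using b by auto
    have "periodic_primitive \<epsilon> (\<bar>A p\<bar> * \<epsilon>) (\<lambda>t. A p * sin (2 * pi * real (\<kappa> p) * t / \<epsilon>)) (\<lambda>t. A p * ((1 - cos (2 * pi * real (\<kappa> p) * t / \<epsilon>)) / \<omega> p))"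
      using periodic_primitive_cmult[OF periodic_primitive_trig(2)[OF e, of "int (\<kappa> p)"]] pos[OF p]
      by (auto simp: \<omega>_def)
    from periodic_primitive_mono[OF this Ae[OF p]] show ?thesis
      unfolding Inr by (simp add: es_input_def[abs_def] U_def[abs_def] A_def)
  qed
  define C where "C p q = A p * A q / \<omega> p" for p q
  have C: "2 * \<bar>C p q\<bar> \<le> \<Omega>" if "p \<in> P" "q \<in> P" for p q
  proof -
    have "C p q = 2 * (sqrt (real (\<kappa> p)) * sqrt (real (\<kappa> q))) / real (\<kappa> p)"
      using e pos[OF that(1)] by (simp add: C_def A_def \<omega>_def real_sqrt_divide real_sqrt_mult field_simps)
    also have "\<dots> \<le> 2 * (sqrt (\<Omega> / 4) * sqrt (\<Omega> / 4)) / 1"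
      using frequency_le_dither_amplitude[where \<kappa> = \<kappa>, OF P that(1)] pos[OF that(1)]
        frequency_le_dither_amplitude[where \<kappa> = \<kappa>, OF P that(2)]
      by (intro frac_le mult_mono) (auto simp: \<Omega>_def)
    also have "\<dots> = \<Omega> / 2" using dither_amplitude_nonneg[of P \<kappa>] by (simp add: \<Omega>_def)
    finally have "2 * C p q \<le> \<Omega>" by simp
    moreover have "C p q \<ge> 0" using A0 e by (simp add: C_def \<omega>_def)
    ultimately show ?thesis by simp
  qed
  have C2: "C p p = 2" if "p \<in> P" for p
    using e pos[OF that] by (simp add: C_def A_def \<omega>_def real_sqrt_divide real_sqrt_mult field_simps)
  have m: "C p q * (of_bool (\<kappa> p = \<kappa> q) / 2) = of_bool (p = q)" if "p \<in> P" "q \<in> P" for p q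
    using C2 inj that by (auto dest: inj_onD)
  have lift: "\<exists>W. periodic_primitive \<epsilon> (\<Omega> * \<epsilon>) \<psi> W"
    if ex: "\<exists>W. periodic_primitive \<epsilon> (2 * \<epsilon>) \<phi> W" and "p \<in> P" "q \<in> P" and eq: "\<And>t. \<psi> t = C p q * \<phi> t" for \<phi> \<psi> p q
  proof -
    obtain W where W: "periodic_primitive \<epsilon> (2 * \<epsilon>) \<phi> W" using ex by blast
    have "\<bar>C p q\<bar> * (2 * \<epsilon>) \<le> \<Omega> * \<epsilon>"
      using mult_right_mono[OF C[OF \<open>p \<in> P\<close> \<open>q \<in> P\<close>], of \<epsilon>] e by (simp add: mult_ac)
    from periodic_primitive_mono[OF periodic_primitive_cmult[OF W] this]
    show ?thesis unfolding eq by blast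
  qed
  have "\<exists>W. periodic_primitive \<epsilon> (\<Omega> * \<epsilon>) (\<lambda>t. U b t * es_input \<kappa> \<epsilon> b' t - dither_mean b b') W"
    if b: "b \<in> P <+> P" "b' \<in> P <+> P" for b b'
  proof -
    obtain p where p: "p \<in> P" "b = Inl p \<or> b = Inr p" using b(1) by auto
    obtain q where q: "q \<in> P" "b' = Inl q \<or> b' = Inr q" using b(2) by auto
    note prods = periodic_primitive_trig_products[OF e pos[OF p(1)] pos[OF q(1)]]
    note mm = m[OF p(1) q(1), symmetric]
    note unf = U_def es_input_def dither_mean_def A_def[symmetric] mm
    show ?thesis using p(2) q(2)
    proof (elim disjE)
      assume "b = Inl p" "b' = Inl q"
      then show ?thesis
        by (intro lift[OF prods(1) p(1) q(1)]) (simp only: unf prod.case sum.case, simp add: C_def algebra_simps add_divide_distrib diff_divide_distrib)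
    next
      assume "b = Inl p" "b' = Inr q"
      then show ?thesis
        by (intro lift[OF prods(2) p(1) q(1)]) (simp only: unf prod.case sum.case, simp add: C_def algebra_simps add_divide_distrib diff_divide_distrib)
    next
      assume "b = Inr p" "b' = Inl q"
      then show ?thesis
        by (intro lift[OF prods(3) p(1) q(1)]) (simp only: unf prod.case sum.case, simp add: C_def algebra_simps add_divide_distrib diff_divide_distrib)
    next
      assume "b = Inr p" "b' = Inr q"
      then show ?thesis
        by (intro lift[OF prods(4) p(1) q(1)]) (simp only: unf prod.case sum.case, simp add: C_def algebra_simps add_divide_distrib diff_divide_distrib)
    qed
  qed
  note ex = this
  define W where "W b b' = (SOME V. periodic_primitive \<epsilon> (\<Omega> * \<epsilon>)
      (\<lambda>t. U b t * es_input \<kappa> \<epsilon> b' t - dither_mean b b') V)" for b b'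
  have "periodic_primitive \<epsilon> (\<Omega> * \<epsilon>) (\<lambda>t. U b t * es_input \<kappa> \<epsilon> b' t - dither_mean b b') (W b b')"
    if "b \<in> P <+> P" "b' \<in> P <+> P" for b b'
    unfolding W_def by (rule someI_ex[OF ex[OF that]])
  then show ?thesis using that U by blast
qed

section \<open>Derivative bounds\<close>

text \<open>
  The derivatives are separate arguments, since \<^const>\<open>frechet_derivative\<close> of a composition is
  determined by the parts only where these are differentiable, which need not be a neighbourhood of \<open>x\<close>.
\<close>

definition jet_on :: "'a::euclidean_space set \<Rightarrow> real \<Rightarrow> ('a \<Rightarrow> 'b::real_normed_vector) \<Rightarrow> ('a \<Rightarrow> 'a \<Rightarrow> 'b) \<Rightarrow> ('a \<Rightarrow> 'a \<Rightarrow> 'a \<Rightarrow> 'b) \<Rightarrow> bool" where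
  "jet_on K M F F1 F2 \<longleftrightarrow> (\<forall>x\<in>K.
     (F has_derivative F1 x) (at x) \<and> norm (F x) \<le> M \<and>
     (\<forall>w. ((\<lambda>y. F1 y w) has_derivative F2 x w) (at x)) \<and>
     (\<forall>v. norm (F1 x v) \<le> M * norm v) \<and>
     (\<forall>w v. norm (F2 x w v) \<le> M * norm w * norm v))"

lemma jet_on_mono:
  "jet_on K M F F1 F2 \<Longrightarrow> L \<subseteq> K \<Longrightarrow> M \<le> M' \<Longrightarrow> jet_on L M' F F1 F2"
  unfolding jet_on_def
  by (meson subsetD order_trans mult_right_mono norm_ge_zero)

lemma jet_on_compose_linear:
  assumes j: "jet_on K M F F1 F2" and A: "bounded_linear A" and c: "\<And>x. norm (A x) \<le> C * norm x" "C \<ge> 0"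
  shows "jet_on K (C * M) (\<lambda>x. A (F x)) (\<lambda>x v. A (F1 x v)) (\<lambda>x w v. A (F2 x w v))"
  unfolding jet_on_def
proof (intro ballI conjI allI)
  fix x assume x: "x \<in> K"
  note J = j[unfolded jet_on_def, rule_format, OF x]
  show "((\<lambda>x. A (F x)) has_derivative (\<lambda>v. A (F1 x v))) (at x)"
    using J by (intro bounded_linear.has_derivative[OF A]) auto
  show "((\<lambda>y. A (F1 y w)) has_derivative (\<lambda>v. A (F2 x w v))) (at x)" for w
    using J by (intro bounded_linear.has_derivative[OF A]) auto
  have *: "norm (A z) \<le> C * M * r" if "norm z \<le> M * r" for z r
    using c(1)[of z] mult_left_mono[OF that c(2)] by (simp add: mult.assoc)
  show "norm (A (F x)) \<le> C * M" using *[of "F x" 1] J by simp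
  show "norm (A (F1 x v)) \<le> C * M * norm v" for v using * J by blast
  show "norm (A (F2 x w v)) \<le> C * M * norm w * norm v" for w v
    using *[of "F2 x w v" "norm w * norm v"] J by (simp add: mult.assoc)
qed

text \<open>\<open>Ck_on\<close> speaks of one direction at a time, and at points outside
  \<open>S\<close> the chosen derivative need not be linear in the direction. Expanding along the
  basis gives maps that are linear in \<open>w\<close> by construction, coincide with the derivative
  on \<open>S\<close>, and are bounded through finitely many continuous functions on
  \<open>K\<close>.\<close>

lemma Ck_on_imp_jet_on:
  fixes F :: "'a::euclidean_space \<Rightarrow> 'b::real_normed_vector"
  assumes F: "Ck_on 2 S F" and K: "compact K" "K \<subseteq> S"
  obtains M F1 F2 where "M \<ge> 0" "jet_on K M F F1 F2"
proof -
  define G where "G x = frechet_derivative F (at x)" for x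
  define H where "H x w = frechet_derivative (\<lambda>y. G y w) (at x)" for x w
  define F1 where "F1 x w = (\<Sum>i\<in>Basis. (w \<bullet> i) *\<^sub>R G x i)" for x w
  define F2 where "F2 x w v = (\<Sum>i\<in>Basis. (w \<bullet> i) *\<^sub>R H x i v)" for x w v
  have F': "\<forall>x\<in>S. F differentiable (at x)"
    "\<And>w. \<forall>x\<in>S. (\<lambda>y. G y w) differentiable (at x)"
    "\<And>w v. continuous_on S (\<lambda>x. H x w v)"
    using F unfolding G_def H_def by (auto simp: numeral_2_eq_2)
  have dG: "(F has_derivative G x) (at x)" if "x \<in> S" for x
    using F'(1) that by (simp add: G_def frechet_derivative_works)
  have dH: "((\<lambda>y. G y w) has_derivative H x w) (at x)" if "x \<in> S" for x w
    using F'(2) that by (simp add: H_def frechet_derivative_works)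
  have repr: "A v = (\<Sum>i\<in>Basis. (v \<bullet> i) *\<^sub>R A i)" if "linear A" for A :: "'a \<Rightarrow> 'b" and v
  proof -
    have "A v = A (\<Sum>i\<in>Basis. (v \<bullet> i) *\<^sub>R i)" by (simp add: euclidean_representation)
    also have "\<dots> = (\<Sum>i\<in>Basis. (v \<bullet> i) *\<^sub>R A i)"
      by (simp add: linear_sum[OF that] linear_cmul[OF that])
    finally show ?thesis .
  qed
  have d1: "(F has_derivative F1 x) (at x)" if "x \<in> S" for x
  proof -
    have "F1 x = G x"
      unfolding F1_def by (intro ext) (rule repr[OF has_derivative_linear[OF dG[OF that]], symmetric])
    then show ?thesis using dG[OF that] by simp
  qed
  have d2: "((\<lambda>y. F1 y w) has_derivative F2 x w) (at x)" if "x \<in> S" for x w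
    unfolding F1_def F2_def by (intro has_derivative_sum has_derivative_scaleR_right dH that)
  have bdd: "\<exists>B. \<forall>x\<in>K. norm (\<phi> x) \<le> B" if "continuous_on S \<phi>" for \<phi> :: "'a \<Rightarrow> 'b"
  proof -
    have "bounded (\<phi> ` K)"
      using that K by (intro compact_imp_bounded compact_continuous_image) (auto intro: continuous_on_subset)
    then show ?thesis by (auto simp: bounded_iff)
  qed
  have "continuous_on S F" using dG by (meson has_derivative_continuous continuous_at_imp_continuous_on)
  then obtain B0 where B0: "\<forall>x\<in>K. norm (F x) \<le> B0" using bdd by blast
  have "continuous_on S (\<lambda>x. G x w)" for w
    using dH by (meson has_derivative_continuous continuous_at_imp_continuous_on)
  then have "\<forall>w. \<exists>B. \<forall>x\<in>K. norm (G x w) \<le> B" using bdd by blast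
  then obtain B1 where B1: "\<forall>w. \<forall>x\<in>K. norm (G x w) \<le> B1 w" by metis
  have "\<forall>w v. \<exists>B. \<forall>x\<in>K. norm (H x w v) \<le> B" using bdd F'(3) by blast
  then obtain B2 where B2: "\<forall>w v. \<forall>x\<in>K. norm (H x w v) \<le> B2 w v" by metis
  define M where "M = \<bar>B0\<bar> + (\<Sum>i\<in>Basis. \<bar>B1 i\<bar>) + (\<Sum>i\<in>Basis. \<Sum>j\<in>Basis. \<bar>B2 i j\<bar>)"
  have nn: "(\<Sum>i\<in>(Basis::'a set). \<bar>B1 i\<bar>) \<ge> 0" "(\<Sum>i\<in>(Basis::'a set). \<Sum>j\<in>(Basis::'a set). \<bar>B2 i j\<bar>) \<ge> 0"
    by (auto intro!: sum_nonneg)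
  have bound: "norm (\<Sum>i\<in>Basis. (v \<bullet> i) *\<^sub>R a i) \<le> (\<Sum>i\<in>Basis. b i) * norm v"
    if "\<And>i. i \<in> Basis \<Longrightarrow> norm (a i) \<le> b i" for a :: "'a \<Rightarrow> 'b" and b v
  proof -
    have "norm (\<Sum>i\<in>Basis. (v \<bullet> i) *\<^sub>R a i) \<le> (\<Sum>i\<in>Basis. norm v * b i)"
      by (rule sum_norm_le) (auto intro!: mult_mono Basis_le_norm that)
    then show ?thesis by (simp add: sum_distrib_left mult.commute)
  qed
  have "jet_on K M F F1 F2"
    unfolding jet_on_def
  proof (intro ballI conjI allI)
    fix x assume x: "x \<in> K"
    then have xS: "x \<in> S" using K by auto
    show "(F has_derivative F1 x) (at x)" by (rule d1[OF xS])
    show "((\<lambda>y. F1 y w) has_derivative F2 x w) (at x)" for w by (rule d2[OF xS])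
    show "norm (F x) \<le> M" using B0[rule_format, OF x] nn abs_ge_self[of B0] unfolding M_def by linarith
    show "norm (F1 x v) \<le> M * norm v" for v
    proof -
      have "norm (F1 x v) \<le> (\<Sum>i\<in>Basis. \<bar>B1 i\<bar>) * norm v"
        unfolding F1_def by (intro bound order_trans[OF B1[rule_format, OF x] abs_ge_self])
      also have "\<dots> \<le> M * norm v" using nn by (intro mult_right_mono) (simp_all add: M_def)
      finally show ?thesis .
    qed
    show "norm (F2 x w v) \<le> M * norm w * norm v" for w v
    proof -
      have "norm (H x i v) \<le> (\<Sum>j\<in>Basis. \<bar>B2 i j\<bar>) * norm v" for i
        unfolding repr[OF has_derivative_linear[OF dH[OF xS]], of i v]
        by (intro bound order_trans[OF B2[rule_format, OF x] abs_ge_self])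
      then have "norm (F2 x w v) \<le> (\<Sum>i\<in>Basis. (\<Sum>j\<in>Basis. \<bar>B2 i j\<bar>) * norm v) * norm w"
        unfolding F2_def by (intro bound)
      also have "\<dots> = (\<Sum>i\<in>Basis. \<Sum>j\<in>Basis. \<bar>B2 i j\<bar>) * (norm v * norm w)"
        by (simp add: sum_distrib_right mult.assoc)
      also have "\<dots> \<le> M * (norm v * norm w)" using nn by (intro mult_right_mono) (simp_all add: M_def)
      finally show ?thesis by (simp add: mult_ac)
    qed
  qed
  moreover have "M \<ge> 0" using nn by (simp add: M_def)
  ultimately show ?thesis using that by blast
qed

section \<open>Averaging over one period\<close>

text \<open>The summands bound, in this order, the terms with \<open>U\<close> and the drift, the
  terms with \<open>W\<close>, and the change of the bracket terms within a window. Here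
  \<open>2 * n * M\<^sup>2\<close> is a bound on the derivative of DF_b F_c, and
  \<open>E + N * \<Omega> * M\<close> is the speed up to the factor 1 / sqrt \<epsilon>.\<close>

definition averaging_constant :: "real \<Rightarrow> real \<Rightarrow> real \<Rightarrow> real \<Rightarrow> real \<Rightarrow> real" where
  "averaging_constant N n \<Omega> M E =
     N * (\<Omega> * (M * E)) + N * (N * (\<Omega> * (2 * n * M\<^sup>2 * (E + N * \<Omega> * M)))) + N * (N * (2 * n * M\<^sup>2 * (E + N * \<Omega> * M)))"

lemma averaging:
  fixes y :: "real \<Rightarrow> 'a::euclidean_space" and F :: "'b \<Rightarrow> 'a \<Rightarrow> 'a"
  assumes B: "finite B" and eps: "0 < \<epsilon>" "\<epsilon> \<le> 1" and a: "a = \<epsilon> * real j"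
    and S: "finite S" and cont: "continuous_on {a..a + \<epsilon>} y"
    and y': "\<And>t. t \<in> {a<..<a + \<epsilon>} - S \<Longrightarrow>
       (y has_vector_derivative (e t + (\<Sum>b\<in>B. u b t *\<^sub>R F b (y t)))) (at t)"
    and e: "\<And>t. t \<in> {a<..<a + \<epsilon>} - S \<Longrightarrow> norm (e t) \<le> E" "\<And>t. t \<in> {a<..<a + \<epsilon>} - S \<Longrightarrow> norm (e t - E0) \<le> d"
    and d: "d \<ge> 0" and E: "E \<ge> 0" and M: "M \<ge> 0" and \<Omega>: "\<Omega> \<ge> 0"
    and jet: "\<And>b. b \<in> B \<Longrightarrow> jet_on (y ` {a..a + \<epsilon>}) M (F b) (F1 b) (F2 b)"
    and u: "\<And>b t. b \<in> B \<Longrightarrow> \<bar>u b t\<bar> \<le> \<Omega> / sqrt \<epsilon>"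
    and U: "\<And>b. b \<in> B \<Longrightarrow> periodic_primitive \<epsilon> (\<Omega> * sqrt \<epsilon>) (u b) (U b)"
    and W: "\<And>b b'. b \<in> B \<Longrightarrow> b' \<in> B \<Longrightarrow> periodic_primitive \<epsilon> (\<Omega> * \<epsilon>) (\<lambda>t. U b t * u b' t - m b b') (W b b')"
    and m: "\<And>b b'. b \<in> B \<Longrightarrow> b' \<in> B \<Longrightarrow> \<bar>m b b'\<bar> \<le> 1"
  shows "norm (y (a + \<epsilon>) - y a - \<epsilon> *\<^sub>R (E0 - (\<Sum>b\<in>B. \<Sum>b'\<in>B. m b b' *\<^sub>R F1 b (y a) (F b' (y a)))))
    \<le> \<epsilon> * (d + averaging_constant (real (card B)) (real DIM('a)) \<Omega> M E * sqrt \<epsilon>)"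
proof -
  define N where "N = real (card B)"
  define Y where "Y = E + N * \<Omega> * M"
  define H where "H = 2 * real DIM('a) * M\<^sup>2"
  define I where "I = {a<..<a + \<epsilon>} - S"
  define y1 where "y1 t = e t + (\<Sum>b\<in>B. u b t *\<^sub>R F b (y t))" for t
  \<comment> \<open>Expanded in the basis because \<open>jet_on\<close> differentiates
    \<open>F1 b\<close> with its direction held fixed. At points of the path this is
    \<open>F1 b x (F b' x)\<close>.\<close>
  define h where "h b b' x = (\<Sum>i\<in>Basis. (F b' x \<bullet> i) *\<^sub>R F1 b x i)" for b b' x
  define h1 where "h1 b b' x v = (\<Sum>i\<in>Basis. (F b' x \<bullet> i) *\<^sub>R F2 b x i v + (F1 b' x v \<bullet> i) *\<^sub>R F1 b x i)" for b b' x v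
  have N: "N \<ge> 0" by (simp add: N_def)
  have Y: "Y \<ge> 0" using E N \<Omega> M by (simp add: Y_def)
  have H: "H \<ge> 0" by (simp add: H_def)
  have se: "sqrt \<epsilon> > 0" "sqrt \<epsilon> \<le> 1" "sqrt \<epsilon> * sqrt \<epsilon> = \<epsilon>" using eps by auto
  have sq: "x / sqrt \<epsilon> * \<epsilon> = x * sqrt \<epsilon>" for x
    using se by (metis nonzero_mult_div_cancel_right less_irrefl mult.assoc times_divide_eq_left)
  have J: "(F b has_derivative F1 b (y t)) (at (y t))" "norm (F b (y t)) \<le> M"
    "((\<lambda>x. F1 b x w) has_derivative F2 b (y t) w) (at (y t))"
    "norm (F1 b (y t) v) \<le> M * norm v" "norm (F2 b (y t) w v) \<le> M * norm w * norm v"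
    if "b \<in> B" "t \<in> {a..a + \<epsilon>}" for b t w v
    using jet[OF that(1)] that(2) unfolding jet_on_def by blast+
  have lin: "linear (F1 b (y t))" if "b \<in> B" "t \<in> {a..a + \<epsilon>}" for b t
    using J(1)[OF that] has_derivative_linear by blast
  have h: "h b b' (y t) = F1 b (y t) (F b' (y t))" if "b \<in> B" "t \<in> {a..a + \<epsilon>}" for b b' t
  proof -
    have "F1 b (y t) (F b' (y t)) = F1 b (y t) (\<Sum>i\<in>Basis. (F b' (y t) \<bullet> i) *\<^sub>R i)"
      by (simp add: euclidean_representation)
    then show ?thesis unfolding h_def
      by (simp add: linear_sum[OF lin[OF that]] linear_cmul[OF lin[OF that]])
  qed
  have h1: "(h b b' has_derivative h1 b b' (y t)) (at (y t))" if "b \<in> B" "b' \<in> B" "t \<in> {a..a + \<epsilon>}" for b b' t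
    unfolding h_def[abs_def] h1_def[abs_def]
    by (intro has_derivative_sum has_derivative_scaleR has_derivative_inner_left J that)
  have h1_bound: "norm (h1 b b' (y t) v) \<le> H * norm v" if "b \<in> B" "b' \<in> B" "t \<in> {a..a + \<epsilon>}" for b b' t v
  proof -
    have "norm (h1 b b' (y t) v) \<le> (\<Sum>i\<in>(Basis::'a set). 2 * M\<^sup>2 * norm v)"
      unfolding h1_def
    proof (rule sum_norm_le)
      fix i :: 'a assume i: "i \<in> Basis"
      have "norm ((F b' (y t) \<bullet> i) *\<^sub>R F2 b (y t) i v) \<le> M * (M * norm i * norm v)"
        unfolding norm_scaleR real_norm_def using M
        by (intro mult_mono order_trans[OF Basis_le_norm[OF i] J(2)[OF that(2,3)]] J(5)[OF that(1,3)]) auto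
      moreover have "norm ((F1 b' (y t) v \<bullet> i) *\<^sub>R F1 b (y t) i) \<le> (M * norm v) * (M * norm i)"
        unfolding norm_scaleR real_norm_def using M
        by (intro mult_mono order_trans[OF Basis_le_norm[OF i] J(4)[OF that(2,3)]] J(4)[OF that(1,3)]) auto
      moreover have "M * (M * norm i * norm v) + (M * norm v) * (M * norm i) = 2 * M\<^sup>2 * norm v"
        using i by (simp add: power2_eq_square)
      ultimately show "norm ((F b' (y t) \<bullet> i) *\<^sub>R F2 b (y t) i v + (F1 b' (y t) v \<bullet> i) *\<^sub>R F1 b (y t) i) \<le> 2 * M\<^sup>2 * norm v"
        by (intro order_trans[OF norm_triangle_ineq]) linarith
    qed
    then show ?thesis by (simp add: H_def)
  qed
  have IS: "t \<in> {a..a + \<epsilon>}" if "t \<in> I" for t using that by (auto simp: I_def)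
  have y1: "(y has_vector_derivative y1 t) (at t)" if "t \<in> I" for t
    using y'[of t] that by (simp add: I_def y1_def)
  have e1: "norm (e t) \<le> E" "norm (e t - E0) \<le> d" if "t \<in> I" for t
    using e[of t] that by (auto simp: I_def)
  have comp: "((\<lambda>t. G (y t)) has_vector_derivative G' (y1 t)) (at t)"
    if "t \<in> I" "(G has_derivative G') (at (y t))" for G :: "'a \<Rightarrow> 'a" and G' t
    using vector_derivative_diff_chain_within[OF y1[OF that(1)], of G G'] has_derivative_at_withinI[OF that(2)]
    by (simp add: o_def)
  have comp_cont: "continuous_on {a..a + \<epsilon>} (\<lambda>t. G (y t))"
    if "\<And>t. t \<in> {a..a + \<epsilon>} \<Longrightarrow> (G has_derivative G' t) (at (y t))" for G :: "'a \<Rightarrow> 'a" and G'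
  proof (rule continuous_on_compose2[OF _ cont order_refl])
    show "continuous_on (y ` {a..a + \<epsilon>}) G"
      by (rule continuous_at_imp_continuous_on) (use that has_derivative_continuous in blast)
  qed
  have y1_bound: "norm (y1 t) \<le> Y / sqrt \<epsilon>" if "t \<in> I" for t
  proof -
    have "norm (\<Sum>b\<in>B. u b t *\<^sub>R F b (y t)) \<le> (\<Sum>b\<in>B. \<Omega> / sqrt \<epsilon> * M)"
      unfolding norm_scaleR real_norm_def using \<Omega> se
      by (intro sum_norm_le, unfold norm_scaleR real_norm_def, intro mult_mono u J(2) IS[OF that]) auto
    then have "norm (\<Sum>b\<in>B. u b t *\<^sub>R F b (y t)) \<le> N * \<Omega> * M / sqrt \<epsilon>" by (simp add: N_def)
    moreover have "norm (e t) \<le> E / sqrt \<epsilon>"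
    proof -
      have "E * sqrt \<epsilon> \<le> E" using E se by (simp add: mult_left_le)
      then have "E \<le> E / sqrt \<epsilon>" using se by (simp add: field_simps)
      then show ?thesis using e1(1)[OF that] by linarith
    qed
    ultimately show ?thesis
      unfolding y1_def Y_def add_divide_distrib by (intro order_trans[OF norm_triangle_ineq]) linarith
  qed
  have hvar: "norm (h b b' (y t) - h b b' (y a)) \<le> H * Y * sqrt \<epsilon>" if "b \<in> B" "b' \<in> B" "t \<in> I" for b b' t
  proof -
    have t: "t \<in> {a..a + \<epsilon>}" by (rule IS[OF that(3)])
    have "norm (h b b' (y t) - h b b' (y a)) \<le> (H * (Y / sqrt \<epsilon>)) * (t - a)"
    proof (rule norm_diff_le_derivative_bound[OF _ S, where z' = "\<lambda>s. h1 b b' (y s) (y1 s)"])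
      show "continuous_on {a..t} (\<lambda>s. h b b' (y s))"
        by (rule continuous_on_subset[OF comp_cont[OF h1]]) (use that t in auto)
      show "((\<lambda>s. h b b' (y s)) has_vector_derivative h1 b b' (y s) (y1 s)) (at s)"
        if s: "s \<in> {a<..<t} - S" for s
      proof -
        have "s \<in> I" using s t by (auto simp: I_def)
        then show ?thesis by (intro comp h1 IS \<open>b \<in> B\<close> \<open>b' \<in> B\<close>)
      qed
      show "norm (h1 b b' (y s) (y1 s)) \<le> H * (Y / sqrt \<epsilon>)" if s: "s \<in> {a<..<t} - S" for s
      proof -
        have s': "s \<in> I" using s t by (auto simp: I_def)
        show ?thesis
          by (rule order_trans[OF h1_bound[OF \<open>b \<in> B\<close> \<open>b' \<in> B\<close> IS[OF s']] mult_left_mono[OF y1_bound[OF s'] H]])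
      qed
    qed (use t H Y se in auto)
    also have "\<dots> \<le> (H * (Y / sqrt \<epsilon>)) * \<epsilon>"
      using t H Y se by (intro mult_left_mono) auto
    also have "\<dots> = H * Y * sqrt \<epsilon>" using sq[of "H * Y"] by simp
    finally show ?thesis .
  qed
  define Q where "Q = E0 - (\<Sum>b\<in>B. \<Sum>b'\<in>B. m b b' *\<^sub>R h b b' (y a))"
  \<comment> \<open>With the averaged motion \<open>(t - a) *\<^sub>R Q\<close> subtracted, the
    increment of \<open>z\<close> over the window is exactly the averaging error.\<close>
  define z where "z t = y t - (\<Sum>b\<in>B. U b t *\<^sub>R F b (y t)) + (\<Sum>b\<in>B. \<Sum>b'\<in>B. W b b' t *\<^sub>R h b b' (y t)) - (t - a) *\<^sub>R Q" for t
  define z1 where "z1 t = y1 t - (\<Sum>b\<in>B. U b t *\<^sub>R F1 b (y t) (y1 t) + u b t *\<^sub>R F b (y t))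
     + (\<Sum>b\<in>B. \<Sum>b'\<in>B. W b b' t *\<^sub>R h1 b b' (y t) (y1 t) + (U b t * u b' t - m b b') *\<^sub>R h b b' (y t)) - Q" for t
  have dU: "(U b has_real_derivative u b t) (at t)" "U b (\<epsilon> * real i) = 0" "\<bar>U b t\<bar> \<le> \<Omega> * sqrt \<epsilon>" if "b \<in> B" for b t i
    using U[OF that] by (auto simp: periodic_primitive_def)
  have dW: "(W b b' has_real_derivative (U b t * u b' t - m b b')) (at t)" "W b b' (\<epsilon> * real i) = 0" "\<bar>W b b' t\<bar> \<le> \<Omega> * \<epsilon>"
    if "b \<in> B" "b' \<in> B" for b b' t i
    using W[OF that] by (auto simp: periodic_primitive_def)
  have zder: "(z has_vector_derivative z1 t) (at t)" if t: "t \<in> I" for t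
    unfolding z_def[abs_def] z1_def
    by (auto intro!: derivative_eq_intros has_vector_derivative_diff has_vector_derivative_add has_vector_derivative_sum
        has_vector_derivative_scaleR y1 t comp[OF t] J(1) h1 IS dU(1) dW(1))
  \<comment> \<open>The terms \<open>u b t *\<^sub>R F b (y t)\<close>, of order 1 / sqrt
    \<epsilon>, cancel against the derivative of \<open>U b\<close>. Inserting the equation of
    motion into the term with \<open>F1 b\<close> creates products \<open>U b t * u b' t\<close>,
    which cancel against the derivative of \<open>W b b'\<close>. Apart from
    \<open>e t - E0\<close>, what remains is of order sqrt \<epsilon>.\<close>
  have z1_eq: "z1 t = (e t - E0) - (\<Sum>b\<in>B. U b t *\<^sub>R F1 b (y t) (e t))
     + (\<Sum>b\<in>B. \<Sum>b'\<in>B. W b b' t *\<^sub>R h1 b b' (y t) (y1 t)) - (\<Sum>b\<in>B. \<Sum>b'\<in>B. m b b' *\<^sub>R (h b b' (y t) - h b b' (y a)))"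
    if t: "t \<in> I" for t
  proof -
    have "(\<Sum>b\<in>B. U b t *\<^sub>R F1 b (y t) (y1 t)) = (\<Sum>b\<in>B. U b t *\<^sub>R F1 b (y t) (e t)) + (\<Sum>b\<in>B. \<Sum>b'\<in>B. (U b t * u b' t) *\<^sub>R h b b' (y t))"
      unfolding sum.distrib[symmetric]
    proof (rule sum.cong[OF refl])
      fix b assume b: "b \<in> B"
      note l = lin[OF b IS[OF t]]
      show "U b t *\<^sub>R F1 b (y t) (y1 t) = U b t *\<^sub>R F1 b (y t) (e t) + (\<Sum>b'\<in>B. (U b t * u b' t) *\<^sub>R h b b' (y t))"
        unfolding y1_def h[OF b IS[OF t]]
        by (simp add: linear_add[OF l] linear_sum[OF l] linear_cmul[OF l] scaleR_add_right scaleR_sum_right)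
    qed
    then show ?thesis
      unfolding z1_def Q_def y1_def
      by (simp add: sum.distrib sum_subtractf scaleR_diff_left scaleR_diff_right algebra_simps)
  qed
  define BB where "BB = d + (N * (\<Omega> * (M * E)) + N * (N * (\<Omega> * (H * Y))) + N * (N * (H * Y))) * sqrt \<epsilon>"
  have z1_bound: "norm (z1 t) \<le> BB" if t: "t \<in> I" for t
  proof -
    have 1: "norm (e t - E0) \<le> d" by (rule e1(2)[OF t])
    have "norm (\<Sum>b\<in>B. U b t *\<^sub>R F1 b (y t) (e t)) \<le> (\<Sum>b\<in>B. (\<Omega> * sqrt \<epsilon>) * (M * E))"
    proof (rule sum_norm_le)
      fix b assume b: "b \<in> B"
      have "norm (F1 b (y t) (e t)) \<le> M * E"
        by (rule order_trans[OF J(4)[OF b IS[OF t]] mult_left_mono[OF e1(1)[OF t] M]])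
      then show "norm (U b t *\<^sub>R F1 b (y t) (e t)) \<le> (\<Omega> * sqrt \<epsilon>) * (M * E)"
        unfolding norm_scaleR using dU(3)[OF b] \<Omega> se by (intro mult_mono) auto
    qed
    then have 2: "norm (\<Sum>b\<in>B. U b t *\<^sub>R F1 b (y t) (e t)) \<le> N * (\<Omega> * (M * E)) * sqrt \<epsilon>"
      by (simp add: N_def mult_ac)
    have "norm (\<Sum>b\<in>B. \<Sum>b'\<in>B. W b b' t *\<^sub>R h1 b b' (y t) (y1 t)) \<le> (\<Sum>b\<in>B. \<Sum>b'\<in>B. (\<Omega> * \<epsilon>) * (H * (Y / sqrt \<epsilon>)))"
    proof (intro sum_norm_le)
      fix b b' assume b: "b \<in> B" "b' \<in> B"
      have "norm (h1 b b' (y t) (y1 t)) \<le> H * (Y / sqrt \<epsilon>)"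
        by (rule order_trans[OF h1_bound[OF b IS[OF t]] mult_left_mono[OF y1_bound[OF t] H]])
      then show "norm (W b b' t *\<^sub>R h1 b b' (y t) (y1 t)) \<le> (\<Omega> * \<epsilon>) * (H * (Y / sqrt \<epsilon>))"
        unfolding norm_scaleR using dW(3)[OF b] \<Omega> eps by (intro mult_mono) auto
    qed
    also have "(\<Omega> * \<epsilon>) * (H * (Y / sqrt \<epsilon>)) = \<Omega> * (H * Y) * sqrt \<epsilon>"
      using sq[of "\<Omega> * (H * Y)"] by (simp add: mult_ac)
    finally have 3: "norm (\<Sum>b\<in>B. \<Sum>b'\<in>B. W b b' t *\<^sub>R h1 b b' (y t) (y1 t)) \<le> N * (N * (\<Omega> * (H * Y))) * sqrt \<epsilon>"
      by (simp add: N_def mult_ac)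
    have "norm (\<Sum>b\<in>B. \<Sum>b'\<in>B. m b b' *\<^sub>R (h b b' (y t) - h b b' (y a))) \<le> (\<Sum>b\<in>B. \<Sum>b'\<in>B. 1 * (H * Y * sqrt \<epsilon>))"
      by (intro sum_norm_le, unfold norm_scaleR real_norm_def, intro mult_mono m hvar t) auto
    then have 4: "norm (\<Sum>b\<in>B. \<Sum>b'\<in>B. m b b' *\<^sub>R (h b b' (y t) - h b b' (y a))) \<le> N * (N * (H * Y)) * sqrt \<epsilon>"
      by (simp add: N_def mult_ac)
    have "norm (p - q + r - s) \<le> norm p + norm q + norm r + norm s" for p q r s :: 'a
      using norm_triangle_ineq4[of "p - q + r" s] norm_triangle_ineq[of "p - q" r] norm_triangle_ineq4[of p q] by linarith
    then show ?thesis
      unfolding z1_eq[OF t] BB_def distrib_right using 1 2 3 4 by (smt (verit))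
  qed
  have "norm (z (a + \<epsilon>) - z a) \<le> BB * (a + \<epsilon> - a)"
  proof (rule norm_diff_le_derivative_bound[OF _ S, where z' = z1])
    have cU: "continuous_on X (U b)" if "b \<in> B" for b X
      using dU(1)[OF that] by (meson DERIV_isCont continuous_at_imp_continuous_on)
    have cW: "continuous_on X (W b b')" if "b \<in> B" "b' \<in> B" for b b' X
      using dW(1)[OF that] by (meson DERIV_isCont continuous_at_imp_continuous_on)
    show "continuous_on {a..a + \<epsilon>} z"
      unfolding z_def[abs_def]
      by (intro continuous_intros cont cU cW comp_cont[OF J(1)] comp_cont[OF h1])
    show "0 \<le> BB" using d N \<Omega> M E H Y se by (simp add: BB_def)
    show "\<And>t. t \<in> {a<..<a + \<epsilon>} - S \<Longrightarrow> (z has_vector_derivative z1 t) (at t)"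
      "\<And>t. t \<in> {a<..<a + \<epsilon>} - S \<Longrightarrow> norm (z1 t) \<le> BB"
      using zder z1_bound unfolding I_def by blast+
  qed (use eps in auto)
  \<comment> \<open>Both ends of the window are multiples of \<epsilon>, where all \<open>U\<close>
    and \<open>W\<close> vanish.\<close>
  moreover have "a + \<epsilon> = \<epsilon> * real (Suc j)" using a by (simp add: algebra_simps)
  then have "z (a + \<epsilon>) = y (a + \<epsilon>) - \<epsilon> *\<^sub>R Q" "z a = y a"
    unfolding z_def using dU(2)[of _ "Suc j"] dW(2)[of _ _ "Suc j"] dU(2)[of _ j] dW(2)[of _ _ j] a by auto
  moreover have "Q = E0 - (\<Sum>b\<in>B. \<Sum>b'\<in>B. m b b' *\<^sub>R F1 b (y a) (F b' (y a)))"
    unfolding Q_def using h eps by (auto intro!: arg_cong2[where f = minus] sum.cong)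
  moreover have "BB = d + averaging_constant (real (card B)) (real DIM('a)) \<Omega> M E * sqrt \<epsilon>"
    by (simp add: BB_def averaging_constant_def N_def H_def Y_def)
  ultimately show ?thesis by (simp add: diff_diff_eq2 diff_diff_add add.commute mult.commute[of _ \<epsilon>])
qed

text \<open>The primitive of an input correlates only with the partner input of the same frequency,
  with opposite signs in the two orders. This antisymmetry is what produces brackets.\<close>

lemma sum_dither_mean:
  fixes X :: "'p + 'p \<Rightarrow> 'p + 'p \<Rightarrow> 'a::real_vector"
  assumes "finite P"
  shows "(\<Sum>b\<in>P <+> P. \<Sum>b'\<in>P <+> P. dither_mean b b' *\<^sub>R X b b') =
    (\<Sum>p\<in>P. X (Inl p) (Inr p) - X (Inr p) (Inl p))"
proof -
  have 1: "(\<Sum>q\<in>P. of_bool (p = q) *\<^sub>R Z q) = Z p" if "p \<in> P" for Z :: "'p \<Rightarrow> 'a" and p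
  proof -
    have "(\<Sum>q\<in>P. of_bool (p = q) *\<^sub>R Z q) = (\<Sum>q\<in>P. if p = q then Z q else 0)"
      by (intro sum.cong) auto
    then show ?thesis using assms that by simp
  qed
  have "(\<Sum>b'\<in>P <+> P. dither_mean (Inl p) b' *\<^sub>R X (Inl p) b') = X (Inl p) (Inr p)"
    "(\<Sum>b'\<in>P <+> P. dither_mean (Inr p) b' *\<^sub>R X (Inr p) b') = - X (Inr p) (Inl p)" if "p \<in> P" for p
    by (simp_all add: sum.Plus assms dither_mean_def 1[OF that] sum_negf)
  then show ?thesis
    by (simp add: sum.Plus assms sum_negf sum_subtractf)
qed

text \<open>The summand for \<open>p\<close> is the Lie bracket of the cosine field
  \<open>F (Inl p)\<close> with the sine field \<open>F (Inr p)\<close>, in this order.\<close>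

lemma dither_averaging:
  fixes \<kappa> :: "'p \<Rightarrow> nat" and y :: "real \<Rightarrow> 'a::euclidean_space"
  assumes P: "finite P" and pos: "\<And>p. p \<in> P \<Longrightarrow> \<kappa> p > 0" and inj: "inj_on \<kappa> P"
    and eps: "0 < \<epsilon>" "\<epsilon> \<le> 1" and a: "a = \<epsilon> * real j"
    and S: "finite S" and cont: "continuous_on {a..a + \<epsilon>} y"
    and y': "\<And>t. t \<in> {a<..<a + \<epsilon>} - S \<Longrightarrow>
       (y has_vector_derivative (e t + (\<Sum>b\<in>P <+> P. es_input \<kappa> \<epsilon> b t *\<^sub>R F b (y t)))) (at t)"
    and e: "\<And>t. t \<in> {a<..<a + \<epsilon>} - S \<Longrightarrow> norm (e t) \<le> E" "\<And>t. t \<in> {a<..<a + \<epsilon>} - S \<Longrightarrow> norm (e t - E0) \<le> d"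
    and d: "d \<ge> 0" and E: "E \<ge> 0" and M: "M \<ge> 0"
    and jet: "\<And>b. b \<in> P <+> P \<Longrightarrow> jet_on (y ` {a..a + \<epsilon>}) M (F b) (F1 b) (F2 b)"
  defines "C \<equiv> averaging_constant (real (card (P <+> P))) (real DIM('a)) (dither_amplitude P \<kappa>) M E"
  shows "norm (y (a + \<epsilon>) - y a - \<epsilon> *\<^sub>R
      (E0 + (\<Sum>p\<in>P. F1 (Inr p) (y a) (F (Inl p) (y a)) - F1 (Inl p) (y a) (F (Inr p) (y a)))))
    \<le> \<epsilon> * (d + C * sqrt \<epsilon>)"
proof -
  obtain U W where
    U: "\<And>b. b \<in> P <+> P \<Longrightarrow> periodic_primitive \<epsilon> (dither_amplitude P \<kappa> * sqrt \<epsilon>) (es_input \<kappa> \<epsilon> b) (U b)" and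
    W: "\<And>b b'. b \<in> P <+> P \<Longrightarrow> b' \<in> P <+> P \<Longrightarrow> periodic_primitive \<epsilon> (dither_amplitude P \<kappa> * \<epsilon>)
          (\<lambda>t. U b t * es_input \<kappa> \<epsilon> b' t - dither_mean b b') (W b b')"
    using dither_primitives[OF P pos inj eps(1)] by blast
  have fin: "finite (P <+> P)" using P by simp
  have m: "\<bar>dither_mean b b'\<bar> \<le> 1" for b b' :: "'p + 'p"
    by (auto simp: dither_mean_def split: sum.splits)
  have "norm (y (a + \<epsilon>) - y a - \<epsilon> *\<^sub>R (E0 - (\<Sum>b\<in>P <+> P. \<Sum>b'\<in>P <+> P. dither_mean b b' *\<^sub>R F1 b (y a) (F b' (y a)))))
    \<le> \<epsilon> * (d + C * sqrt \<epsilon>)"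
    unfolding C_def
    by (rule averaging[OF fin eps a S cont y' e d E M dither_amplitude_nonneg jet es_input_bound[OF P eps(1)] U W m])
  moreover have "E0 - (\<Sum>b\<in>P <+> P. \<Sum>b'\<in>P <+> P. dither_mean b b' *\<^sub>R F1 b (y a) (F b' (y a))) =
    E0 + (\<Sum>p\<in>P. F1 (Inr p) (y a) (F (Inl p) (y a)) - F1 (Inl p) (y a) (F (Inr p) (y a)))"
    unfolding sum_dither_mean[OF P] by (simp add: sum_subtractf)
  ultimately show ?thesis by simp
qed

section \<open>The feedback and its solutions\<close>

lemma lie_deriv_eq_derivative:
  fixes F :: "'a::real_normed_vector \<Rightarrow> 'b::real_normed_vector"
  assumes "(F has_derivative F') (at x)"
  shows "lie_deriv G F x = F' (G x)"
proof -
  have "((\<lambda>s. F (x + s *\<^sub>R G x)) has_derivative (\<lambda>s. F' (s *\<^sub>R G x))) (at 0)"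
  proof (rule has_derivative_compose[where f = "\<lambda>s. x + s *\<^sub>R G x" and g = F and f' = "\<lambda>s. s *\<^sub>R G x" and g' = F'])
    show "((\<lambda>s. x + s *\<^sub>R G x) has_derivative (\<lambda>s. s *\<^sub>R G x)) (at 0)"
      by (auto intro!: derivative_eq_intros)
  qed (simp add: assms)
  then have "((\<lambda>s. F (x + s *\<^sub>R G x)) has_derivative (\<lambda>s. s *\<^sub>R F' (G x))) (at 0)"
    by (simp only: linear_cmul[OF has_derivative_linear[OF assms]])
  then have "((\<lambda>s. norm (F (x + s *\<^sub>R G x) - F x - s *\<^sub>R F' (G x)) / norm s) \<longlongrightarrow> 0) (at 0)"
    unfolding has_derivative_at by simp
  moreover have "norm (F (x + s *\<^sub>R G x) - F x - s *\<^sub>R F' (G x)) / norm s = norm (lie_quotient G F x s - F' (G x))"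
    if "s \<noteq> 0" for s
  proof -
    have "lie_quotient G F x s - F' (G x) = (F (x + s *\<^sub>R G x) - F x - s *\<^sub>R F' (G x)) /\<^sub>R s"
      using that by (simp add: lie_quotient_def scaleR_diff_right)
    moreover have "norm (w /\<^sub>R s) = norm w / norm s" for w :: 'b
      by (simp add: field_simps)
    ultimately show ?thesis by (simp only:)
  qed
  then have "\<forall>\<^sub>F s in at 0. norm (F (x + s *\<^sub>R G x) - F x - s *\<^sub>R F' (G x)) / norm s = norm (lie_quotient G F x s - F' (G x))"
    by (simp add: eventually_at_filter)
  ultimately have "((\<lambda>s. norm (lie_quotient G F x s - F' (G x))) \<longlongrightarrow> 0) (at 0)"
    by (rule Lim_transform_eventually)
  then have "(lie_quotient G F x \<longlongrightarrow> F' (G x)) (at 0)"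
    by (rule LIM_zero_cancel[OF tendsto_norm_zero_cancel])
  then show ?thesis unfolding lie_deriv_def by (rule tendsto_Lim[OF trivial_limit_at])
qed

lemma norm_matrix_vector_le: "norm (A *v v) \<le> matrix_norm A * norm v"
  unfolding matrix_norm_def by (intro onorm) (simp add: matrix_vector_mul_bounded_linear)

lemma stab_coeff_bound:
  "\<bar>stab_coeff f c \<gamma> x \<xi> s\<bar> \<le> \<bar>\<gamma>\<bar> * matrix_norm (matrix_inv (frame_matrix f c x)) * norm (x - \<xi>)"
proof -
  have "\<bar>stab_coeff f c \<gamma> x \<xi> s\<bar> \<le> norm ((- \<gamma>) *\<^sub>R (matrix_inv (frame_matrix f c x) *v (x - \<xi>)))"
    unfolding stab_coeff_def by (rule component_le_norm_cart)
  also have "\<dots> \<le> \<bar>\<gamma>\<bar> * (matrix_norm (matrix_inv (frame_matrix f c x)) * norm (x - \<xi>))"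
    by (simp add: mult_left_mono norm_matrix_vector_le)
  finally show ?thesis by (simp add: mult.assoc)
qed

text \<open>The coefficient vector solves the linear system with matrix
  \<open>frame_matrix f c x\<close> and right side -\<gamma> (x - \<xi>). Reindexing by
  \<open>c\<close> cancels the \<open>inv c\<close> in \<open>stab_coeff\<close>.\<close>

lemma stab_coeff_sum:
  fixes f :: "'m::finite \<Rightarrow> real ^ 'n \<Rightarrow> real ^ ('n::finite)"
  assumes c: "bij_betw c UNIV (S1 <+> S2)" and inv: "invertible (frame_matrix f c x)"
  shows "(\<Sum>s\<in>S1 <+> S2. stab_coeff f c \<gamma> x \<xi> s *\<^sub>R frame_field f s x) = - \<gamma> *\<^sub>R (x - \<xi>)"
proof -
  define v where "v = (- \<gamma>) *\<^sub>R (matrix_inv (frame_matrix f c x) *v (x - \<xi>))"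
  have inj: "inj c" using c by (simp add: bij_betw_def)
  have "(\<Sum>s\<in>S1 <+> S2. stab_coeff f c \<gamma> x \<xi> s *\<^sub>R frame_field f s x) =
      (\<Sum>i\<in>UNIV. stab_coeff f c \<gamma> x \<xi> (c i) *\<^sub>R frame_field f (c i) x)"
    by (rule sum.reindex_bij_betw[OF c, symmetric])
  also have "\<dots> = (\<Sum>i\<in>UNIV. v $ i *\<^sub>R column i (frame_matrix f c x))"
    by (intro sum.cong) (auto simp: stab_coeff_def v_def inv_f_f[OF inj] frame_matrix_def column_def vec_eq_iff)
  also have "\<dots> = frame_matrix f c x *v v"
    unfolding matrix_mult_sum scalar_mult_eq_scaleR by simp
  also have "\<dots> = (- \<gamma>) *\<^sub>R ((frame_matrix f c x ** matrix_inv (frame_matrix f c x)) *v (x - \<xi>))"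
    unfolding v_def matrix_vector_mult_scaleR matrix_vector_mul_assoc ..
  also have "\<dots> = - \<gamma> *\<^sub>R (x - \<xi>)"
  proof -
    have "frame_matrix f c x ** matrix_inv (frame_matrix f c x) = mat 1"
      using someI_ex[OF inv[unfolded invertible_def]] by (simp add: matrix_inv_def)
    then show ?thesis by simp
  qed
  finally show ?thesis .
qed

lemma frame_matrix_invertible:
  fixes f :: "'m::finite \<Rightarrow> real ^ 'n \<Rightarrow> real ^ ('n::finite)"
  assumes c: "bij_betw c UNIV (S1 <+> S2)"
    and sp: "span ({f i x | i. i \<in> S1} \<union> {lie_bracket (f j1) (f j2) x | j1 j2. (j1, j2) \<in> S2}) = UNIV"
  shows "invertible (frame_matrix f c x)"
proof -
  have "columns (frame_matrix f c x) = (\<lambda>i. frame_field f (c i) x) ` UNIV"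
  proof -
    have "column i (frame_matrix f c x) = frame_field f (c i) x" for i
      by (simp add: column_def frame_matrix_def)
    then show ?thesis by (auto simp: columns_def)
  qed
  also have "\<dots> = (\<lambda>s. frame_field f s x) ` (S1 <+> S2)"
    unfolding bij_betw_imp_surj_on[OF c, symmetric] image_image ..
  also have "\<dots> = {f i x | i. i \<in> S1} \<union> {lie_bracket (f j1) (f j2) x | j1 j2. (j1, j2) \<in> S2}"
  proof -
    have "{f i x | i. i \<in> S1} = (\<lambda>i. f i x) ` S1"
      "{lie_bracket (f j1) (f j2) x | j1 j2. (j1, j2) \<in> S2} = (\<lambda>p. lie_bracket (f (fst p)) (f (snd p)) x) ` S2"
      by force+
    then show ?thesis
      by (simp add: Plus_def image_Un image_image frame_field_def case_prod_unfold)
  qed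
  finally have "\<exists>B. frame_matrix f c x ** B = mat 1"
    using sp by (simp add: matrix_right_invertible_span_columns span_vec_eq)
  then show ?thesis using invertible_right_inverse by blast
qed

definition stab_field ::
  "('m + 'm \<times> 'm \<Rightarrow> real) \<Rightarrow> ('m \<Rightarrow> 'a) \<Rightarrow> ('m \<times> 'm) + ('m \<times> 'm) \<Rightarrow> 'a::real_vector" where
  "stab_field a F b = (case b of
      Inl p \<Rightarrow> (sgn (a (Inr p)) * sqrt \<bar>a (Inr p)\<bar>) *\<^sub>R F (fst p)
    | Inr p \<Rightarrow> sqrt \<bar>a (Inr p)\<bar> *\<^sub>R F (snd p))"

text \<open>Brings the feedback into the form treated by \<open>dither_averaging\<close>, with the
  same inputs \<open>es_input\<close> as the extremum seeking part: \<kappa> moves from the square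
  root of the coefficient into the amplitude of the input.\<close>

lemma stab_input_sum:
  fixes F :: "'m::finite \<Rightarrow> 'a::real_vector" and \<xi> x :: "real ^ ('n::finite)"
    and f :: "'m \<Rightarrow> real ^ 'n \<Rightarrow> real ^ 'n" and \<gamma> :: real and c :: "'n \<Rightarrow> 'm + 'm \<times> 'm"
  assumes "\<epsilon> > 0"
  defines "a \<equiv> stab_coeff f c \<gamma> x \<xi>"
  shows "(\<Sum>i\<in>UNIV. stab_input f c S1 S2 \<kappa> \<gamma> \<epsilon> i x \<xi> t *\<^sub>R F i) =
    (\<Sum>i\<in>S1. a (Inl i) *\<^sub>R F i) + (\<Sum>b\<in>S2 <+> S2. es_input \<kappa> \<epsilon> b t *\<^sub>R stab_field a F b)"
proof -
  have delta: "(\<Sum>i\<in>UNIV. (w * of_bool (i = i')) *\<^sub>R F i) = w *\<^sub>R F i'" for w i'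
  proof -
    have "(\<Sum>i\<in>UNIV. (w * of_bool (i = i')) *\<^sub>R F i) = (\<Sum>i\<in>UNIV. if i = i' then w *\<^sub>R F i else 0)"
      by (intro sum.cong) auto
    then show ?thesis by simp
  qed
  define r where "r p = sqrt (4 * pi / \<epsilon>) * sqrt (real (\<kappa> p) * \<bar>a (Inr p)\<bar>)" for p
  define C where "C p = cos (2 * pi * real (\<kappa> p) * t / \<epsilon>)" for p
  define Sn where "Sn p = sin (2 * pi * real (\<kappa> p) * t / \<epsilon>)" for p
  have input: "stab_input f c S1 S2 \<kappa> \<gamma> \<epsilon> i x \<xi> t =
     (\<Sum>i1\<in>S1. a (Inl i1) * of_bool (i = i1)) +
     (\<Sum>p\<in>S2. (r p * sgn (a (Inr p)) * C p) * of_bool (i = fst p) + (r p * Sn p) * of_bool (i = snd p))" for i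
    unfolding stab_input_def Let_def a_def[symmetric] r_def C_def Sn_def
    by (simp add: sum_distrib_left algebra_simps case_prod_unfold)
  have r: "r p = sqrt (4 * pi * real (\<kappa> p) / \<epsilon>) * sqrt \<bar>a (Inr p)\<bar>" for p
    unfolding r_def real_sqrt_mult[symmetric] by simp
  have "(\<Sum>i\<in>UNIV. stab_input f c S1 S2 \<kappa> \<gamma> \<epsilon> i x \<xi> t *\<^sub>R F i) =
     (\<Sum>i1\<in>S1. \<Sum>i\<in>UNIV. (a (Inl i1) * of_bool (i = i1)) *\<^sub>R F i) +
     (\<Sum>p\<in>S2. (\<Sum>i\<in>UNIV. ((r p * sgn (a (Inr p)) * C p) * of_bool (i = fst p)) *\<^sub>R F i) +
         (\<Sum>i\<in>UNIV. ((r p * Sn p) * of_bool (i = snd p)) *\<^sub>R F i))"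
    unfolding input scaleR_add_left scaleR_sum_left sum.distrib sum.swap[of _ UNIV S1] sum.swap[of _ UNIV S2] ..
  also have "\<dots> = (\<Sum>i\<in>S1. a (Inl i) *\<^sub>R F i) +
     (\<Sum>p\<in>S2. (r p * sgn (a (Inr p)) * C p) *\<^sub>R F (fst p) + (r p * Sn p) *\<^sub>R F (snd p))"
    unfolding delta ..
  also have "(\<Sum>p\<in>S2. (r p * sgn (a (Inr p)) * C p) *\<^sub>R F (fst p) + (r p * Sn p) *\<^sub>R F (snd p)) =
     (\<Sum>b\<in>S2 <+> S2. es_input \<kappa> \<epsilon> b t *\<^sub>R stab_field a F b)"
    by (simp add: sum.Plus sum.distrib es_input_def stab_field_def r C_def Sn_def mult_ac)
  finally show ?thesis .
qed

lemma abs_continuous_on_imp_continuous_on: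
  assumes "abs_continuous_on {a..b} h"
  shows "continuous_on {a..b} h"
  unfolding continuous_on_iff
proof (intro ballI allI impI)
  fix s e :: real assume s: "s \<in> {a..b}" and e: "e > 0"
  obtain d where d: "d > 0" and *: "\<forall>I. finite I \<and> (\<forall>(u, v)\<in>I. u \<le> v \<and> {u..v} \<subseteq> {a..b}) \<and>
        pairwise (\<lambda>p q. {fst p<..<snd p} \<inter> {fst q<..<snd q} = {}) I \<and>
        (\<Sum>(u, v)\<in>I. v - u) < d \<longrightarrow> (\<Sum>(u, v)\<in>I. dist (h u) (h v)) < e"
    using assms e unfolding abs_continuous_on_def by blast
  have "dist (h t) (h s) < e" if t: "t \<in> {a..b}" "dist t s < d" for t
  proof (cases "s \<le> t")
    case True
    then show ?thesis
      using *[rule_format, of "{(s, t)}"] s t by (auto simp: dist_real_def dist_commute)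
  next
    case False
    then show ?thesis
      using *[rule_format, of "{(t, s)}"] s t by (auto simp: dist_real_def)
  qed
  then show "\<exists>d>0. \<forall>t\<in>{a..b}. dist t s < d \<longrightarrow> dist (h t) (h s) < e" using d by blast
qed

lemma pi_solution_continuous:
  assumes "pi_solution D f c S1 S2 \<kappa> J g k \<mu> \<gamma> \<epsilon> x0 x \<xi>" "0 \<le> a"
  shows "continuous_on {a..b} x" "continuous_on {a..b} \<xi>"
proof -
  have "continuous_on {0..max 0 b} (\<lambda>t. (x t, \<xi> t))"
    using assms(1) unfolding pi_solution_def by (intro abs_continuous_on_imp_continuous_on) auto
  then have *: "continuous_on {a..b} (\<lambda>t. (x t, \<xi> t))"
    by (rule continuous_on_subset) (use assms(2) in auto)
  show "continuous_on {a..b} x" "continuous_on {a..b} \<xi>"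
    using continuous_on_fst[OF *] continuous_on_snd[OF *] by simp_all
qed

lemma pi_solution_derivative:
  fixes j :: nat
  assumes sol: "pi_solution D f c S1 S2 \<kappa> J g k \<mu> \<gamma> \<epsilon> x0 x \<xi>" and t: "t \<in> {\<epsilon> * real j<..<\<epsilon> * real j + \<epsilon>}"
  shows "(x has_vector_derivative
           (\<Sum>i\<in>UNIV. stab_input f c S1 S2 \<kappa> \<gamma> \<epsilon> i (x (\<epsilon> * real j)) (\<xi> (\<epsilon> * real j)) t *\<^sub>R f i (x t))) (at t)"
    and "(\<xi> has_vector_derivative es_rhs g k \<mu> (J (x t)) t) (at t)"
proof -
  have tt: "t \<in> {\<epsilon> * real j..<\<epsilon> * real (j + 1)}" "{\<epsilon> * real j<..<\<epsilon> * real (j + 1)} \<subseteq> {\<epsilon> * real j..<\<epsilon> * real (j + 1)}"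
    "t \<in> {\<epsilon> * real j<..<\<epsilon> * real (j + 1)}"
    using t by (auto simp: algebra_simps)
  have *: "(h has_vector_derivative h') (at t)"
    if "(h has_vector_derivative h') (at t within {\<epsilon> * real j..<\<epsilon> * real (j + 1)})" for h :: "real \<Rightarrow> real ^ 'n" and h'
    using has_vector_derivative_within_subset[OF that tt(2)] at_within_open[OF tt(3)] by simp
  show "(x has_vector_derivative
           (\<Sum>i\<in>UNIV. stab_input f c S1 S2 \<kappa> \<gamma> \<epsilon> i (x (\<epsilon> * real j)) (\<xi> (\<epsilon> * real j)) t *\<^sub>R f i (x t))) (at t)"
     "(\<xi> has_vector_derivative es_rhs g k \<mu> (J (x t)) t) (at t)"
    using sol tt(1) unfolding pi_solution_def by (auto intro!: *)
qed

section \<open>Tracking\<close>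

lemma averaging_constant_nonneg:
  "N \<ge> 0 \<Longrightarrow> n \<ge> 0 \<Longrightarrow> \<Omega> \<ge> 0 \<Longrightarrow> M \<ge> 0 \<Longrightarrow> E \<ge> 0 \<Longrightarrow> averaging_constant N n \<Omega> M E \<ge> 0"
  by (simp add: averaging_constant_def)

text \<open>For frozen \<open>a\<close> only a constant factor is involved. Its square root is
  replaced by the bound \<open>1 + A\<close>, valid for small and large coefficients alike.\<close>

lemma jet_on_stab_field:
  assumes jet: "\<And>i. jet_on K M (f i) (f1 i) (f2 i)" and M: "M \<ge> 0" and a: "\<And>s. \<bar>a s\<bar> \<le> A"
  shows "jet_on K ((1 + A) * M) (\<lambda>z. stab_field a (\<lambda>i. f i z) b)
    (\<lambda>z v. stab_field a (\<lambda>i. f1 i z v) b) (\<lambda>z w v. stab_field a (\<lambda>i. f2 i z w v) b)"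
proof -
  have A: "0 \<le> 1 + A" using a abs_ge_zero order_trans[OF abs_ge_zero a] by (smt (verit))
  have sq: "sqrt \<bar>a s\<bar> \<le> 1 + A" for s
  proof (rule real_le_lsqrt)
    have "\<bar>a s\<bar> \<le> (1 + \<bar>a s\<bar>)\<^sup>2" by (simp add: power2_eq_square algebra_simps)
    also have "\<dots> \<le> (1 + A)\<^sup>2" using a[of s] by (intro power_mono) auto
    finally show "\<bar>a s\<bar> \<le> (1 + A)\<^sup>2" .
  qed (use A in auto)
  have sc: "jet_on K ((1 + A) * M) (\<lambda>z. r *\<^sub>R f i z) (\<lambda>z v. r *\<^sub>R f1 i z v) (\<lambda>z w v. r *\<^sub>R f2 i z w v)"
    if "\<bar>r\<bar> \<le> 1 + A" for r i
    by (rule jet_on_compose_linear[OF jet bounded_linear_scaleR_right])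
      (auto intro!: mult_right_mono that A)
  have "\<bar>sgn (a s) * sqrt \<bar>a s\<bar>\<bar> \<le> 1 + A" for s
    using sq[of s] A by (auto simp: abs_mult sgn_if)
  then show ?thesis
    using sq by (cases b) (auto simp: stab_field_def intro!: sc)
qed

text \<open>The mean value inequality along the trajectory instead of along a segment, so that
  derivative bounds at the points of the path suffice.\<close>

lemma path_image_increment:
  fixes x :: "real \<Rightarrow> 'a::euclidean_space" and G :: "'a \<Rightarrow> 'b::euclidean_space"
  assumes ab: "a \<le> b" and cont: "continuous_on {a..b} x"
    and der: "\<And>t. t \<in> {a<..<b} \<Longrightarrow> (x has_vector_derivative x' t) (at t)"
    and B: "\<And>t. t \<in> {a<..<b} \<Longrightarrow> norm (x' t) \<le> B" "B \<ge> 0"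
    and G: "\<And>t. t \<in> {a..b} \<Longrightarrow> (G has_derivative G' (x t)) (at (x t))"
      "\<And>t v. t \<in> {a..b} \<Longrightarrow> norm (G' (x t) v) \<le> M * norm v" and M: "M \<ge> 0"
  shows "norm (G (x b) - G (x a)) \<le> M * B * (b - a)"
proof (rule norm_diff_le_derivative_bound[OF ab finite.emptyI, where z' = "\<lambda>t. G' (x t) (x' t)"])
  show "continuous_on {a..b} (\<lambda>t. G (x t))"
  proof (rule continuous_on_compose2[OF _ cont order_refl])
    show "continuous_on (x ` {a..b}) G"
      by (rule continuous_at_imp_continuous_on) (use G(1) has_derivative_continuous in blast)
  qed
  show "0 \<le> M * B" using M B by simp
  show "((\<lambda>t. G (x t)) has_vector_derivative G' (x t) (x' t)) (at t)" if "t \<in> {a<..<b} - {}" for t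
    using vector_derivative_diff_chain_within[OF der, of t G "G' (x t)"] has_derivative_at_withinI[OF G(1)[of t]] that
    by (simp add: o_def)
  show "norm (G' (x t) (x' t)) \<le> M * B" if "t \<in> {a<..<b} - {}" for t
    using that by (intro order_trans[OF G(2) mult_left_mono[OF B(1) M]]) auto
qed

text \<open>The threshold depends neither on \<open>T\<close> nor on the solution, which the later
  first-exit argument requires. In \<open>(v + 2) / \<gamma>\<close>, the term \<open>v\<close>
  accounts for the motion of the target \<xi>, one unit for the averaging error per sampling
  interval, and one for the motion between sampling instants.\<close>

lemma tracking:
  fixes f :: "'m::finite \<Rightarrow> real ^ 'n \<Rightarrow> real ^ ('n::finite)"
  assumes c: "bij_betw c UNIV (S1 <+> S2)"
    and jet: "\<And>i. jet_on K M (f i) (f1 i) (f2 i)" and M: "M \<ge> 0"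
    and inv: "\<And>x. x \<in> K \<Longrightarrow> invertible (frame_matrix f c x)"
    and \<alpha>: "\<And>x. x \<in> K \<Longrightarrow> matrix_norm (matrix_inv (frame_matrix f c x)) \<le> \<alpha>" "\<alpha> > 0"
    and \<kappa>: "\<And>p. p \<in> S2 \<Longrightarrow> \<kappa> p > 0" "inj_on \<kappa> S2"
    and R: "\<And>x y. x \<in> K \<Longrightarrow> y \<in> K \<Longrightarrow> norm (x - y) \<le> R" "R \<ge> 0"
    and \<gamma>: "\<gamma> > 0" and v: "v \<ge> 0"
    and speed: "\<And>x t. x \<in> K \<Longrightarrow> norm (es_rhs g k \<mu> (J x) t) \<le> v"
  obtains \<epsilon>bar where "\<epsilon>bar > 0"
    "\<And>\<epsilon> x0 x \<xi> T t. 0 < \<epsilon> \<Longrightarrow> \<epsilon> \<le> \<epsilon>bar \<Longrightarrow> pi_solution D f c S1 S2 \<kappa> J g k \<mu> \<gamma> \<epsilon> x0 x \<xi> \<Longrightarrow>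
       (\<And>t. t \<in> {0..T} \<Longrightarrow> x t \<in> K \<and> \<xi> t \<in> K) \<Longrightarrow> t \<in> {0..T} \<Longrightarrow> norm (x t - \<xi> t) \<le> (v + 2) / \<gamma>"
proof -
  define N1 where "N1 = real (card S1)"
  define N2 where "N2 = real (card (S2 <+> S2))"
  define A where "A = \<gamma> * \<alpha> * R"
  define M' where "M' = (1 + A) * M"
  define E where "E = N1 * (A * M)"
  define \<Omega> where "\<Omega> = dither_amplitude S2 \<kappa>"
  have \<Omega>: "\<Omega> \<ge> 0" "\<And>\<epsilon> b t. \<epsilon> > 0 \<Longrightarrow> b \<in> S2 <+> S2 \<Longrightarrow> \<bar>es_input \<kappa> \<epsilon> b t\<bar> \<le> \<Omega> / sqrt \<epsilon>"
    unfolding \<Omega>_def by (rule dither_amplitude_nonneg, rule es_input_bound[OF finite])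
  define Y where "Y = E + N2 * \<Omega> * M'"
  define Ca where "Ca = averaging_constant N2 (real DIM(real ^ 'n)) \<Omega> M' E"
  define L where "L = N1 * (A * (M * Y))"
  define Z where "Z = L + Ca + \<gamma> * Y + \<gamma> * v"
  have A: "A \<ge> 0" using \<gamma> \<alpha>(2) R(2) by (simp add: A_def)
  have N: "N1 \<ge> 0" "N2 \<ge> 0" by (simp_all add: N1_def N2_def)
  have M': "M' \<ge> 0" using A M by (simp add: M'_def)
  have E: "E \<ge> 0" using N A M by (simp add: E_def)
  have Y: "Y \<ge> 0" using E N \<Omega>(1) M' by (simp add: Y_def)
  have Ca: "Ca \<ge> 0" using N \<Omega>(1) M' E by (simp add: Ca_def averaging_constant_nonneg)
  have L: "L \<ge> 0" using N A M Y by (simp add: L_def)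
  have Z: "Z \<ge> 0" using L Ca Y \<gamma> v by (simp add: Z_def)
  \<comment> \<open>\<open>Z\<close> collects all coefficients of sqrt \<epsilon>, so the last entry
    makes their total at most 1. The entry \<open>1 / \<gamma>\<close> keeps the contraction factor
    \<open>1 - \<epsilon> * \<gamma>\<close> nonnegative.\<close>
  define \<epsilon>bar where "\<epsilon>bar = Min {1, 1 / \<gamma>, (1 / (Z + 1))\<^sup>2}"
  have "\<epsilon>bar > 0" using \<gamma> Z by (simp add: \<epsilon>bar_def)
  moreover have "norm (x t - \<xi> t) \<le> (v + 2) / \<gamma>"
    if \<epsilon>: "0 < \<epsilon>" "\<epsilon> \<le> \<epsilon>bar" and sol: "pi_solution D f c S1 S2 \<kappa> J g k \<mu> \<gamma> \<epsilon> x0 x \<xi>"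
      and inK: "\<And>t. t \<in> {0..T} \<Longrightarrow> x t \<in> K \<and> \<xi> t \<in> K" and t: "t \<in> {0..T}"
    for \<epsilon> x0 x \<xi> T t
  proof -
    have \<epsilon>1: "\<epsilon> \<le> 1" "\<epsilon> * \<gamma> \<le> 1" "sqrt \<epsilon> \<le> 1 / (Z + 1)"
    proof -
      have *: "\<epsilon> \<le> 1" "\<epsilon> \<le> 1 / \<gamma>" "\<epsilon> \<le> (1 / (Z + 1))\<^sup>2"
        using \<epsilon>(2) by (auto simp: \<epsilon>bar_def)
      show "\<epsilon> \<le> 1" by (rule *(1))
      show "\<epsilon> * \<gamma> \<le> 1" using *(2) \<gamma> by (simp add: pos_le_divide_eq)
      show "sqrt \<epsilon> \<le> 1 / (Z + 1)" using Z by (intro real_le_lsqrt *(3)) simp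
    qed
    have se: "sqrt \<epsilon> > 0" "sqrt \<epsilon> \<le> 1" "\<epsilon> \<le> sqrt \<epsilon>"
      using \<epsilon> \<epsilon>1 by (auto intro!: real_le_rsqrt simp: power2_eq_square mult_left_le)
    have sq: "z / sqrt \<epsilon> * \<epsilon> = z * sqrt \<epsilon>" for z
      using \<epsilon> by (metis less_eq_real_def real_div_sqrt times_divide_eq_left times_divide_eq_right)
    have seZ: "sqrt \<epsilon> * Z \<le> 1"
    proof -
      have "sqrt \<epsilon> * Z \<le> 1 / (Z + 1) * Z" using \<epsilon>1(3) Z by (rule mult_right_mono)
      also have "\<dots> \<le> 1" using Z by (simp add: field_simps)
      finally show ?thesis .
    qed
    define \<tau> where "\<tau> j = \<epsilon> * real j" for j :: nat
    define a where "a j s = stab_coeff f c \<gamma> (x (\<tau> j)) (\<xi> (\<tau> j)) s" for j s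
    define e where "e j t = (\<Sum>i\<in>S1. a j (Inl i) *\<^sub>R f i (x t))" for j t
    define F where "F j b z = stab_field (a j) (\<lambda>i. f i z) b" for j b z
    define F1 where "F1 j b z v = stab_field (a j) (\<lambda>i. f1 i z v) b" for j b z v
    define F2 where "F2 j b z w v = stab_field (a j) (\<lambda>i. f2 i z w v) b" for j b z w v
    define x' where "x' j t = e j t + (\<Sum>b\<in>S2 <+> S2. es_input \<kappa> \<epsilon> b t *\<^sub>R F j b (x t))" for j t
    have \<tau>0: "\<tau> j \<ge> 0" for j using \<epsilon> by (simp add: \<tau>_def)
    have a: "\<bar>a j s\<bar> \<le> A" if "\<tau> j \<le> T" for j s
    proof -
      have K: "x (\<tau> j) \<in> K" "\<xi> (\<tau> j) \<in> K" using inK \<tau>0 that by auto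
      have "\<bar>a j s\<bar> \<le> \<gamma> * matrix_norm (matrix_inv (frame_matrix f c (x (\<tau> j)))) * norm (x (\<tau> j) - \<xi> (\<tau> j))"
        using stab_coeff_bound[of f c \<gamma> "x (\<tau> j)" "\<xi> (\<tau> j)" s] \<gamma> by (simp add: a_def)
      also have "\<dots> \<le> \<gamma> * \<alpha> * R"
        using \<gamma> \<alpha> R K by (intro mult_mono mult_left_mono) auto
      finally show ?thesis by (simp add: A_def)
    qed
    have jetF: "jet_on K M' (F j b) (F1 j b) (F2 j b)" if "\<tau> j \<le> T" for j b
      unfolding F_def[abs_def] F1_def[abs_def] F2_def[abs_def] M'_def
      by (rule jet_on_stab_field[OF jet M a[OF that]])
    have jf: "(f i has_derivative f1 i z) (at z)" "norm (f i z) \<le> M" "norm (f1 i z w) \<le> M * norm w" if "z \<in> K" for i z w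
      using jet[of i] that unfolding jet_on_def by blast+
    have xder: "(x has_vector_derivative x' j t) (at t)" "(\<xi> has_vector_derivative es_rhs g k \<mu> (J (x t)) t) (at t)"
      if "t \<in> {\<tau> j<..<\<tau> j + \<epsilon>}" for j t
      using pi_solution_derivative[OF sol that[unfolded \<tau>_def]]
      unfolding stab_input_sum[OF \<epsilon>(1)] x'_def e_def F_def a_def[abs_def] \<tau>_def by auto
    have eb: "norm (e j t) \<le> E" if "\<tau> j \<le> T" "t \<in> {0..T}" for j t
    proof -
      have "norm (e j t) \<le> (\<Sum>i\<in>S1. A * M)"
        unfolding e_def
      proof (rule sum_norm_le)
        fix i
        show "norm (a j (Inl i) *\<^sub>R f i (x t)) \<le> A * M"
          unfolding norm_scaleR real_norm_def using a[OF that(1)] jf(2) inK[OF that(2)] A M by (intro mult_mono) auto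
      qed
      then show ?thesis by (simp add: E_def N1_def)
    qed
    have x'b: "norm (x' j t) \<le> Y / sqrt \<epsilon>" if "\<tau> j \<le> T" "t \<in> {0..T}" for j t
    proof -
      have "norm (\<Sum>b\<in>S2 <+> S2. es_input \<kappa> \<epsilon> b t *\<^sub>R F j b (x t)) \<le> (\<Sum>b\<in>S2 <+> S2. \<Omega> / sqrt \<epsilon> * M')"
      proof (rule sum_norm_le)
        fix b assume "b \<in> S2 <+> S2"
        moreover have "norm (F j b (x t)) \<le> M'"
          using jetF[OF that(1), of b] inK[OF that(2)] unfolding jet_on_def by blast
        ultimately show "norm (es_input \<kappa> \<epsilon> b t *\<^sub>R F j b (x t)) \<le> \<Omega> / sqrt \<epsilon> * M'"
          unfolding norm_scaleR real_norm_def using \<Omega> se \<epsilon>(1) by (intro mult_mono) auto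
      qed
      then have "norm (\<Sum>b\<in>S2 <+> S2. es_input \<kappa> \<epsilon> b t *\<^sub>R F j b (x t)) \<le> N2 * \<Omega> * M' / sqrt \<epsilon>"
        by (simp add: N2_def)
      moreover have "norm (e j t) \<le> E / sqrt \<epsilon>"
      proof -
        have "E * sqrt \<epsilon> \<le> E" using E se by (simp add: mult_left_le)
        then have "E \<le> E / sqrt \<epsilon>" using se by (simp add: field_simps)
        then show ?thesis using eb[OF that] by linarith
      qed
      ultimately show ?thesis
        unfolding x'_def Y_def add_divide_distrib by (intro order_trans[OF norm_triangle_ineq]) linarith
    qed
    have inc_f: "norm (f i (x s) - f i (x (\<tau> j))) \<le> M * Y * sqrt \<epsilon>"
      and inc_x: "norm (x s - x (\<tau> j)) \<le> Y * sqrt \<epsilon>" and inc_\<xi>: "norm (\<xi> s - \<xi> (\<tau> j)) \<le> \<epsilon> * v"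
      if s: "s \<in> {\<tau> j..\<tau> j + \<epsilon>}" "s \<le> T" for i j s
    proof -
      have cont: "continuous_on {\<tau> j..s} x" "continuous_on {\<tau> j..s} \<xi>"
        using pi_solution_continuous[OF sol \<tau>0] by auto
      have sT: "\<tau> j \<le> T" "\<And>t. t \<in> {\<tau> j..s} \<Longrightarrow> t \<in> {0..T}" using s \<tau>0[of j] by auto
      have sub: "\<And>t. t \<in> {\<tau> j<..<s} \<Longrightarrow> t \<in> {\<tau> j<..<\<tau> j + \<epsilon>} \<and> t \<in> {0..T}" using s \<tau>0[of j] by auto
      have Yq: "Y / sqrt \<epsilon> * (s - \<tau> j) \<le> Y * sqrt \<epsilon>"
        using s Y se unfolding sq[symmetric] by (intro mult_left_mono) auto
      have "norm (f i (x s) - f i (x (\<tau> j))) \<le> M * (Y / sqrt \<epsilon>) * (s - \<tau> j)"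
        by (rule path_image_increment[OF _ cont(1) xder(1) x'b _ jf(1,3) M])
          (use sub s sT inK Y se in auto)
      also have "\<dots> \<le> M * (Y * sqrt \<epsilon>)"
        unfolding mult.assoc by (rule mult_left_mono[OF Yq M])
      finally show "norm (f i (x s) - f i (x (\<tau> j))) \<le> M * Y * sqrt \<epsilon>" by (simp add: mult.assoc)
      have "norm (x s - x (\<tau> j)) \<le> Y / sqrt \<epsilon> * (s - \<tau> j)"
        by (rule norm_diff_le_derivative_bound[OF _ finite.emptyI cont(1) _ xder(1) x'b])
          (use sub s sT Y se in auto)
      then show "norm (x s - x (\<tau> j)) \<le> Y * sqrt \<epsilon>" using Yq by linarith
      have "norm (\<xi> s - \<xi> (\<tau> j)) \<le> v * (s - \<tau> j)"
        by (rule norm_diff_le_derivative_bound[OF _ finite.emptyI cont(2) _ xder(2) speed])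
          (use sub s inK v in auto)
      also have "\<dots> \<le> v * \<epsilon>" using s v by (intro mult_left_mono) auto
      finally show "norm (\<xi> s - \<xi> (\<tau> j)) \<le> \<epsilon> * v" by (simp add: mult.commute)
    qed
    have step: "norm (x (\<tau> (Suc j)) - \<xi> (\<tau> (Suc j))) \<le> (1 - \<epsilon> * \<gamma>) * norm (x (\<tau> j) - \<xi> (\<tau> j)) + \<epsilon> * (v + 1)"
      if T: "\<tau> (Suc j) \<le> T" for j
    proof -
      define p where "p = x (\<tau> j)"
      have \<tau>S: "\<tau> (Suc j) = \<tau> j + \<epsilon>" by (simp add: \<tau>_def algebra_simps)
      have jT: "\<tau> j \<le> T" using T \<tau>S \<epsilon> by linarith
      have sub: "\<And>t. t \<in> {\<tau> j..\<tau> j + \<epsilon>} \<Longrightarrow> t \<in> {0..T}" using T \<tau>S \<tau>0[of j] by auto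
      have pK: "p \<in> K" using inK sub \<epsilon> by (simp add: p_def)
      have "norm (x (\<tau> j + \<epsilon>) - x (\<tau> j) - \<epsilon> *\<^sub>R
           (e j (\<tau> j) + (\<Sum>p\<in>S2. F1 j (Inr p) (x (\<tau> j)) (F j (Inl p) (x (\<tau> j))) - F1 j (Inl p) (x (\<tau> j)) (F j (Inr p) (x (\<tau> j))))))
         \<le> \<epsilon> * (L * sqrt \<epsilon> + Ca * sqrt \<epsilon>)"
        unfolding Ca_def N2_def \<Omega>_def
      proof (rule dither_averaging[OF finite \<kappa> \<epsilon>(1) \<epsilon>1(1) \<tau>_def finite.emptyI, where F = "F j" and ?F1.0 = "F1 j" and ?F2.0 = "F2 j" and e = "e j"])
        show "continuous_on {\<tau> j..\<tau> j + \<epsilon>} x" by (rule pi_solution_continuous[OF sol \<tau>0])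
        show "(x has_vector_derivative e j t + (\<Sum>b\<in>S2 <+> S2. es_input \<kappa> \<epsilon> b t *\<^sub>R F j b (x t))) (at t)"
          if "t \<in> {\<tau> j<..<\<tau> j + \<epsilon>} - {}" for t
          using xder(1)[of t j] that by (simp add: x'_def)
        show "norm (e j t) \<le> E" if "t \<in> {\<tau> j<..<\<tau> j + \<epsilon>} - {}" for t
          using eb[OF jT sub, of t] that by simp
        show "norm (e j t - e j (\<tau> j)) \<le> L * sqrt \<epsilon>" if t: "t \<in> {\<tau> j<..<\<tau> j + \<epsilon>} - {}" for t
        proof -
          have "norm (e j t - e j (\<tau> j)) \<le> (\<Sum>i\<in>S1. A * (M * Y * sqrt \<epsilon>))"
            unfolding e_def sum_subtractf[symmetric] scaleR_diff_right[symmetric]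
          proof (rule sum_norm_le)
            fix i
            show "norm (a j (Inl i) *\<^sub>R (f i (x t) - f i (x (\<tau> j)))) \<le> A * (M * Y * sqrt \<epsilon>)"
              unfolding norm_scaleR real_norm_def
              using a[OF jT] inc_f[of t j i] t T \<tau>S A by (intro mult_mono) auto
          qed
          then show ?thesis by (simp add: L_def N1_def mult.assoc)
        qed
        show "jet_on (x ` {\<tau> j..\<tau> j + \<epsilon>}) M' (F j b) (F1 j b) (F2 j b)" for b
          by (rule jet_on_mono[OF jetF[OF jT]]) (use sub inK in auto)
      qed (use L se E M' in auto)
      \<comment> \<open>The slow inputs contribute the columns from \<open>S1\<close>, the averaged
        pairs those from \<open>S2\<close>. Together they form the frame expansion whose
        coefficients \<open>stab_coeff\<close> was built from.\<close>
      moreover have "e j (\<tau> j) + (\<Sum>p\<in>S2. F1 j (Inr p) (x (\<tau> j)) (F j (Inl p) (x (\<tau> j))) - F1 j (Inl p) (x (\<tau> j)) (F j (Inr p) (x (\<tau> j))))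
         = - \<gamma> *\<^sub>R (x (\<tau> j) - \<xi> (\<tau> j))"
      proof -
        have "F1 j (Inr q) p (F j (Inl q) p) - F1 j (Inl q) p (F j (Inr q) p) = a j (Inr q) *\<^sub>R frame_field f (Inr q) p" for q
        proof -
          obtain q1 q2 where q: "q = (q1, q2)" by force
          note l = linear_cmul[OF has_derivative_linear[OF jf(1)[OF pK]]]
          have aa: "a j (Inr q) = sgn (a j (Inr q)) * sqrt \<bar>a j (Inr q)\<bar> * sqrt \<bar>a j (Inr q)\<bar>"
            by (simp add: mult.assoc sgn_mult_abs)
          have "frame_field f (Inr q) p = f1 q2 p (f q1 p) - f1 q1 p (f q2 p)"
            using lie_deriv_eq_derivative[OF jf(1)[OF pK]] by (simp add: frame_field_def q lie_bracket_def)
          moreover have "F1 j (Inr q) p (F j (Inl q) p) - F1 j (Inl q) p (F j (Inr q) p) =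
            (sgn (a j (Inr q)) * sqrt \<bar>a j (Inr q)\<bar> * sqrt \<bar>a j (Inr q)\<bar>) *\<^sub>R (f1 q2 p (f q1 p) - f1 q1 p (f q2 p))"
            by (simp add: F1_def F_def stab_field_def q l scaleR_diff_right mult_ac)
          ultimately show ?thesis unfolding aa[symmetric] by simp
        qed
        then have "e j (\<tau> j) + (\<Sum>q\<in>S2. F1 j (Inr q) p (F j (Inl q) p) - F1 j (Inl q) p (F j (Inr q) p)) =
           (\<Sum>s\<in>S1 <+> S2. a j s *\<^sub>R frame_field f s p)"
          by (simp add: sum.Plus e_def p_def) (simp add: frame_field_def)
        also have "\<dots> = - \<gamma> *\<^sub>R (x (\<tau> j) - \<xi> (\<tau> j))"
          using stab_coeff_sum[OF c inv[OF pK], of \<gamma> "\<xi> (\<tau> j)"] by (simp add: a_def p_def)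
        finally show ?thesis by (simp add: p_def)
      qed
      ultimately have 1: "norm (x (\<tau> j + \<epsilon>) - x (\<tau> j) - \<epsilon> *\<^sub>R (- \<gamma> *\<^sub>R (x (\<tau> j) - \<xi> (\<tau> j)))) \<le> \<epsilon> * (L * sqrt \<epsilon> + Ca * sqrt \<epsilon>)"
        by simp
      have "(L + Ca) * sqrt \<epsilon> \<le> sqrt \<epsilon> * Z"
        unfolding mult.commute[of "sqrt \<epsilon>"] using \<gamma> Y v se by (intro mult_right_mono) (auto simp: Z_def)
      then have "L * sqrt \<epsilon> + Ca * sqrt \<epsilon> \<le> 1" using seZ by (simp add: distrib_right)
      then have 2: "\<epsilon> * (L * sqrt \<epsilon> + Ca * sqrt \<epsilon>) \<le> \<epsilon>" using \<epsilon> by simp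
      have 3: "norm (\<xi> (\<tau> j + \<epsilon>) - \<xi> (\<tau> j)) \<le> \<epsilon> * v"
        using inc_\<xi>[of "\<tau> j + \<epsilon>" j] T \<tau>S \<epsilon> by simp
      have 4: "norm ((1 - \<epsilon> * \<gamma>) *\<^sub>R (x (\<tau> j) - \<xi> (\<tau> j))) = (1 - \<epsilon> * \<gamma>) * norm (x (\<tau> j) - \<xi> (\<tau> j))"
        using \<epsilon>1 by simp
      have "x (\<tau> j + \<epsilon>) - \<xi> (\<tau> j + \<epsilon>) = (x (\<tau> j + \<epsilon>) - x (\<tau> j) - \<epsilon> *\<^sub>R (- \<gamma> *\<^sub>R (x (\<tau> j) - \<xi> (\<tau> j))))
        + (1 - \<epsilon> * \<gamma>) *\<^sub>R (x (\<tau> j) - \<xi> (\<tau> j)) - (\<xi> (\<tau> j + \<epsilon>) - \<xi> (\<tau> j))"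
        by (simp add: algebra_simps)
      moreover have "norm (p + q - r) \<le> norm p + norm q + norm r" for p q r :: "real ^ 'n"
        using norm_triangle_ineq4[of "p + q" r] norm_triangle_ineq[of p q] by linarith
      ultimately have "norm (x (\<tau> j + \<epsilon>) - \<xi> (\<tau> j + \<epsilon>)) \<le> norm (x (\<tau> j + \<epsilon>) - x (\<tau> j) - \<epsilon> *\<^sub>R (- \<gamma> *\<^sub>R (x (\<tau> j) - \<xi> (\<tau> j))))
        + norm ((1 - \<epsilon> * \<gamma>) *\<^sub>R (x (\<tau> j) - \<xi> (\<tau> j))) + norm (\<xi> (\<tau> j + \<epsilon>) - \<xi> (\<tau> j))"
        by presburger
      then show ?thesis unfolding \<tau>S 4 using 1 2 3 by (simp add: distrib_left)
    qed
    \<comment> \<open>\<open>(v + 1) / \<gamma>\<close> is the fixed point of the affine bound in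
      \<open>step\<close>, and the initial error is 0.\<close>
    have sample: "\<tau> j \<le> T \<Longrightarrow> norm (x (\<tau> j) - \<xi> (\<tau> j)) \<le> (v + 1) / \<gamma>" for j
    proof (induction j)
      case 0
      then show ?case using sol v \<gamma> by (simp add: pi_solution_def \<tau>_def)
    next
      case (Suc j)
      have "\<tau> j \<le> T" using Suc.prems \<epsilon> by (simp add: \<tau>_def algebra_simps)
      then have "(1 - \<epsilon> * \<gamma>) * norm (x (\<tau> j) - \<xi> (\<tau> j)) \<le> (1 - \<epsilon> * \<gamma>) * ((v + 1) / \<gamma>)"
        using Suc.IH \<epsilon>1 by (intro mult_left_mono) auto
      also have "\<dots> = (v + 1) / \<gamma> - \<epsilon> * (v + 1)" using \<gamma> by (simp add: field_simps)
      finally show ?case using step[OF Suc.prems] by linarith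
    qed
    define j where "j = nat \<lfloor>t / \<epsilon>\<rfloor>"
    have "real j \<le> t / \<epsilon>" "t / \<epsilon> < real j + 1"
      using t \<epsilon> by (auto simp: j_def)
    then have tj: "t \<in> {\<tau> j..\<tau> j + \<epsilon>}" using \<epsilon> by (auto simp: \<tau>_def field_simps)
    have "\<gamma> * (Y * sqrt \<epsilon> + \<epsilon> * v) \<le> sqrt \<epsilon> * Z"
    proof -
      have "\<epsilon> * v \<le> sqrt \<epsilon> * v" using se v by (intro mult_right_mono) auto
      then have "\<gamma> * (Y * sqrt \<epsilon> + \<epsilon> * v) \<le> \<gamma> * (Y * sqrt \<epsilon> + sqrt \<epsilon> * v)" using \<gamma> by simp
      also have "\<dots> = sqrt \<epsilon> * (\<gamma> * Y + \<gamma> * v)" by (simp add: algebra_simps)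
      also have "\<dots> \<le> sqrt \<epsilon> * Z" using se L Ca by (intro mult_left_mono) (auto simp: Z_def)
      finally show ?thesis .
    qed
    then have "Y * sqrt \<epsilon> + \<epsilon> * v \<le> 1 / \<gamma>" using seZ \<gamma> by (simp add: field_simps)
    moreover have "norm (x t - \<xi> t) \<le> norm (x t - x (\<tau> j)) + norm (x (\<tau> j) - \<xi> (\<tau> j)) + norm (\<xi> t - \<xi> (\<tau> j))"
      using norm_triangle_ineq4[of "x t - x (\<tau> j) + (x (\<tau> j) - \<xi> (\<tau> j))" "\<xi> t - \<xi> (\<tau> j)"]
        norm_triangle_ineq[of "x t - x (\<tau> j)" "x (\<tau> j) - \<xi> (\<tau> j)"] by simp
    moreover have "(v + 2) / \<gamma> = (v + 1) / \<gamma> + 1 / \<gamma>" by (simp add: add_divide_distrib[symmetric])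
    ultimately show ?thesis
      using sample[of j] inc_x[OF tj] inc_\<xi>[OF tj] t tj by auto
  qed
  ultimately show ?thesis using that by blast
qed

section \<open>Descent of the cost along the estimate\<close>

lemma Ck_on_imp_jet_on_family:
  fixes F :: "'i::finite \<Rightarrow> 'a::euclidean_space \<Rightarrow> 'b::real_normed_vector"
  assumes F: "\<And>i. Ck_on 2 S (F i)" and K: "compact K" "K \<subseteq> S"
  obtains M F1 F2 where "M \<ge> 0" "\<And>i. jet_on K M (F i) (F1 i) (F2 i)"
proof -
  have "\<exists>M F1 F2. M \<ge> 0 \<and> jet_on K M (F i) F1 F2" for i
    using Ck_on_imp_jet_on[OF F K] by metis
  then obtain M F1 F2 where *: "\<And>i. M i \<ge> 0" "\<And>i. jet_on K (M i) (F i) (F1 i) (F2 i)"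
    by metis
  have "M i \<le> sum M UNIV" for i using *(1) by (intro member_le_sum) auto
  then have "jet_on K (sum M UNIV) (F i) (F1 i) (F2 i)" for i
    using jet_on_mono[OF *(2)] by blast
  moreover have "sum M UNIV \<ge> 0" using *(1) by (intro sum_nonneg) auto
  ultimately show ?thesis using that by blast
qed

text \<open>A connected set that meets both \<open>D\<close> and its complement meets the frontier,
  and frontier points lie farther away than \<open>r\<close>.\<close>

lemma cball_subset_of_boundary_dist:
  fixes x :: "'a::euclidean_space"
  assumes x: "x \<in> D" and r: "0 \<le> r" "ereal r < boundary_dist x D"
  shows "cball x r \<subseteq> D"
proof (rule ccontr)
  assume "\<not> cball x r \<subseteq> D"
  moreover have "x \<in> cball x r \<inter> D" using x r by simp
  ultimately have "cball x r \<inter> frontier D \<noteq> {}"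
    by (intro connected_Int_frontier convex_connected convex_cball) blast+
  then obtain y where y: "y \<in> frontier D" "dist x y \<le> r" by auto
  have "boundary_dist x D \<le> ereal (dist x y)"
    unfolding boundary_dist_def using y by (intro INF_lower)
  also have "\<dots> \<le> ereal r" using y by simp
  finally show False using r by simp
qed

text \<open>A solution supplies only right derivatives at the sampling instants. Finitely many of
  them lie in a bounded interval, and these form the exceptional set.\<close>

lemma pi_solution_estimator_derivative:
  assumes sol: "pi_solution D f c S1 S2 \<kappa> J g k \<mu> \<gamma> \<epsilon> x0 x \<xi>" and \<epsilon>: "\<epsilon> > 0"
  obtains S where "finite S"
    "\<And>t. t \<in> {0<..<b} - S \<Longrightarrow> (\<xi> has_vector_derivative es_rhs g k \<mu> (J (x t)) t) (at t)"
proof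
  show "finite ((\<lambda>j. \<epsilon> * real j) ` {..nat \<lceil>b / \<epsilon>\<rceil>})" by simp
  fix t assume t: "t \<in> {0<..<b} - (\<lambda>j. \<epsilon> * real j) ` {..nat \<lceil>b / \<epsilon>\<rceil>}"
  define j where "j = nat \<lfloor>t / \<epsilon>\<rfloor>"
  have j: "real j \<le> t / \<epsilon>" "t / \<epsilon> < real j + 1" using t \<epsilon> by (auto simp: j_def)
  have "t / \<epsilon> \<le> b / \<epsilon>" using t \<epsilon> by (intro divide_right_mono) auto
  then have "real j \<le> b / \<epsilon>" using j by linarith
  then have "j \<le> nat \<lceil>b / \<epsilon>\<rceil>" by linarith
  then have "t \<noteq> \<epsilon> * real j" using t by blast
  then have "t \<in> {\<epsilon> * real j<..<\<epsilon> * real j + \<epsilon>}" using j \<epsilon> by (auto simp: field_simps)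
  then show "(\<xi> has_vector_derivative es_rhs g k \<mu> (J (x t)) t) (at t)"
    by (rule pi_solution_derivative(2)[OF sol])
qed

lemma norm_es_dir [simp]: "norm (es_dir b) = 1"
  by (cases b) (simp_all add: es_dir_def)

text \<open>The values \<open>h\<close> are arbitrary because the bound is used twice: for the
  generating functions, giving the speed of \<xi>, and for their differences between
  \<open>x\<close> and \<xi>, giving the tracking error in the drift.\<close>

lemma es_rhs_bound:
  fixes k :: "'n::finite \<Rightarrow> nat"
  assumes "\<mu> > 0" and G: "\<And>b. \<bar>h b\<bar> \<le> G"
  shows "norm (\<Sum>b\<in>UNIV. (h b * es_input k \<mu> b t) *\<^sub>R es_dir b) \<le>
    real CARD('n + 'n) * dither_amplitude UNIV k * G / sqrt \<mu>"
proof -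
  have "norm (\<Sum>b\<in>UNIV. (h b * es_input k \<mu> b t) *\<^sub>R es_dir b) \<le>
    (\<Sum>b\<in>(UNIV :: ('n + 'n) set). G * (dither_amplitude UNIV k / sqrt \<mu>))"
  proof (rule sum_norm_le)
    fix b :: "'n + 'n"
    have "\<bar>es_input k \<mu> b t\<bar> \<le> dither_amplitude UNIV k / sqrt \<mu>"
      using assms(1) by (intro es_input_bound) auto
    then have "\<bar>h b\<bar> * \<bar>es_input k \<mu> b t\<bar> \<le> G * (dither_amplitude UNIV k / sqrt \<mu>)"
      using G[of b] by (intro mult_mono) auto
    then show "norm ((h b * es_input k \<mu> b t) *\<^sub>R es_dir b) \<le> G * (dither_amplitude UNIV k / sqrt \<mu>)"
      by (simp only: norm_scaleR norm_es_dir real_norm_def abs_mult mult_1_right)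
  qed
  then show ?thesis by (simp add: mult_ac)
qed

text \<open>The first summand comes from reading the cost at \<open>x\<close> instead of \<xi>, the
  second from averaging with that discrepancy as drift.\<close>

definition es_remainder :: "('n::finite \<Rightarrow> nat) \<Rightarrow> real \<Rightarrow> real \<Rightarrow> real" where
  "es_remainder k M L = (let N = real CARD('n + 'n); \<Omega> = dither_amplitude UNIV k in
     N * \<Omega> * L + averaging_constant N (real CARD('n)) \<Omega> M (N * \<Omega> * L))"

text \<open>The right-hand side is split into its value at \<xi>, which is averaged, and a
  discrepancy treated as drift and compared with 0. Closeness \<open>L * \<mu>\<close> times an
  amplitude of order 1 / sqrt \<mu> leaves a drift of order sqrt \<mu>.\<close>

lemma es_window:
  fixes g :: "'n::finite + 'n \<Rightarrow> real \<Rightarrow> real" and \<xi> :: "real \<Rightarrow> real ^ 'n"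
  assumes k: "\<And>j. k j > 0" "inj k"
    and jet: "\<And>b. jet_on A M (\<lambda>z. g b (J z)) (\<phi>1 b) (\<phi>2 b)" and M: "M \<ge> 0"
    and bracket: "\<And>j z. z \<in> A \<Longrightarrow> g (Inl j) (J z) * \<phi>1 (Inr j) z (axis j 1) - g (Inr j) (J z) * \<phi>1 (Inl j) z (axis j 1)
        = - \<gamma>2 * G z $ j"
    and \<mu>: "0 < \<mu>" "\<mu> \<le> 1" and a: "a = \<mu> * real j"
    and S: "finite S" and cont: "continuous_on {a..a + \<mu>} \<xi>"
    and der: "\<And>t. t \<in> {a<..<a + \<mu>} - S \<Longrightarrow> (\<xi> has_vector_derivative es_rhs g k \<mu> (J (x t)) t) (at t)"
    and inA: "\<And>t. t \<in> {a..a + \<mu>} \<Longrightarrow> \<xi> t \<in> A"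
    and close: "\<And>t b. t \<in> {a..a + \<mu>} \<Longrightarrow> \<bar>g b (J (x t)) - g b (J (\<xi> t))\<bar> \<le> L * \<mu>" and L: "L \<ge> 0"
  shows "norm (\<xi> (a + \<mu>) - \<xi> a + (\<mu> * \<gamma>2) *\<^sub>R G (\<xi> a)) \<le> es_remainder k M L * (\<mu> * sqrt \<mu>)"
proof -
  define N where "N = real CARD('n + 'n)"
  define \<Omega> where "\<Omega> = dither_amplitude UNIV k"
  define e where "e t = (\<Sum>b\<in>UNIV. ((g b (J (x t)) - g b (J (\<xi> t))) * es_input k \<mu> b t) *\<^sub>R (es_dir b :: real ^ 'n))" for t
  define F where "F b z = g b (J z) *\<^sub>R (es_dir b :: real ^ 'n)" for b z
  define F1 where "F1 b z v = \<phi>1 b z v *\<^sub>R (es_dir b :: real ^ 'n)" for b z v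
  define F2 where "F2 b z w v = \<phi>2 b z w v *\<^sub>R (es_dir b :: real ^ 'n)" for b z w v
  have \<Omega>: "\<Omega> \<ge> 0" by (simp add: \<Omega>_def dither_amplitude_nonneg)
  have s\<mu>: "0 < sqrt \<mu>" "sqrt \<mu> \<le> 1" using \<mu> by auto
  have e: "norm (e t) \<le> N * \<Omega> * L * sqrt \<mu>" if "t \<in> {a..a + \<mu>}" for t
  proof -
    have "norm (e t) \<le> N * \<Omega> * (L * \<mu>) / sqrt \<mu>"
      unfolding e_def N_def \<Omega>_def by (rule es_rhs_bound[OF \<mu>(1) close[OF that]])
    also have "\<dots> = N * \<Omega> * L * sqrt \<mu>"
      using \<mu> by (metis less_eq_real_def mult.assoc real_div_sqrt times_divide_eq_right)
    finally show ?thesis .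
  qed
  have NL: "N * \<Omega> * L \<ge> 0" using \<Omega> L by (simp add: N_def)
  have e': "norm (e t) \<le> N * \<Omega> * L" if "t \<in> {a..a + \<mu>}" for t
    using e[OF that] mult_left_le[OF s\<mu>(2) NL] by linarith
  have jetF: "jet_on (\<xi> ` {a..a + \<mu>}) M (F b) (F1 b) (F2 b)" for b
  proof (rule jet_on_mono)
    show "jet_on A (1 * M) (F b) (F1 b) (F2 b)"
      unfolding F_def[abs_def] F1_def[abs_def] F2_def[abs_def]
      by (rule jet_on_compose_linear[OF jet bounded_linear_scaleR_left]) auto
  qed (use inA in auto)
  have "norm (\<xi> (a + \<mu>) - \<xi> a - \<mu> *\<^sub>R
      (0 + (\<Sum>p\<in>UNIV. F1 (Inr p) (\<xi> a) (F (Inl p) (\<xi> a)) - F1 (Inl p) (\<xi> a) (F (Inr p) (\<xi> a)))))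
    \<le> \<mu> * (N * \<Omega> * L * sqrt \<mu> + averaging_constant (real (card ((UNIV :: 'n set) <+> (UNIV :: 'n set)))) (real DIM(real ^ 'n)) (dither_amplitude UNIV k) M (N * \<Omega> * L) * sqrt \<mu>)"
  proof (rule dither_averaging[OF finite k(1,2) \<mu> a S cont, where e = e and F = F and ?F2.0 = F2])
    fix t assume t: "t \<in> {a<..<a + \<mu>} - S"
    have "es_rhs g k \<mu> (J (x t)) t = e t + (\<Sum>b\<in>UNIV. es_input k \<mu> b t *\<^sub>R F b (\<xi> t))"
      by (simp add: es_rhs_def e_def F_def sum.distrib[symmetric] algebra_simps)
    then show "(\<xi> has_vector_derivative e t + (\<Sum>b\<in>UNIV <+> UNIV. es_input k \<mu> b t *\<^sub>R F b (\<xi> t))) (at t)"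
      using der[OF t] by simp
    show "norm (e t) \<le> N * \<Omega> * L" "norm (e t - 0) \<le> N * \<Omega> * L * sqrt \<mu>"
      using t e e' by auto
  qed (use NL M s\<mu> jetF in auto)
  also have "\<dots> = es_remainder k M L * (\<mu> * sqrt \<mu>)"
    by (simp add: es_remainder_def Let_def N_def \<Omega>_def algebra_simps)
  also have "(0 + (\<Sum>p\<in>UNIV. F1 (Inr p) (\<xi> a) (F (Inl p) (\<xi> a)) - F1 (Inl p) (\<xi> a) (F (Inr p) (\<xi> a)))) = - \<gamma>2 *\<^sub>R G (\<xi> a)"
  proof -
    have A: "\<xi> a \<in> A" using inA \<mu> by auto
    have lin: "\<phi>1 b (\<xi> a) (r *\<^sub>R w) = r * \<phi>1 b (\<xi> a) w" for b r w
    proof -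
      have "linear (\<phi>1 b (\<xi> a))"
        using jet[of b] A has_derivative_linear unfolding jet_on_def by blast
      from linear_cmul[OF this] show ?thesis by simp
    qed
    have "F1 (Inr p) (\<xi> a) (F (Inl p) (\<xi> a)) - F1 (Inl p) (\<xi> a) (F (Inr p) (\<xi> a)) = (- \<gamma>2 * G (\<xi> a) $ p) *\<^sub>R axis p 1" for p
      unfolding bracket[OF A, of p, symmetric] by (simp add: F_def F1_def es_dir_def lin scaleR_diff_left)
    then have "(\<Sum>p\<in>UNIV. F1 (Inr p) (\<xi> a) (F (Inl p) (\<xi> a)) - F1 (Inl p) (\<xi> a) (F (Inr p) (\<xi> a))) = (\<Sum>p\<in>UNIV. (- \<gamma>2 * G (\<xi> a) $ p) *\<^sub>R axis p 1)"
      by simp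
    also have "\<dots> = - \<gamma>2 *\<^sub>R G (\<xi> a)"
      by (simp add: vec_eq_iff axis_def if_distrib cong: if_cong)
    finally show ?thesis by simp
  qed
  finally show ?thesis by (simp add: mult.commute)
qed

text \<open>Taylor's formula with a crude second-order constant: the mean value inequality is
  applied along the segment to the first derivative, and then to \<open>J\<close> minus its linear
  part.\<close>

lemma descent_inequality:
  fixes J :: "'a::euclidean_space \<Rightarrow> real"
  assumes jet: "jet_on K M J J1 J2" and M: "M \<ge> 0" and K: "convex K" and p: "p \<in> K" "p + \<Delta> \<in> K"
  shows "J (p + \<Delta>) \<le> J p + J1 p \<Delta> + M * (norm \<Delta>)\<^sup>2"
proof -
  define y where "y s = p + s *\<^sub>R \<Delta>" for s
  have y: "y s \<in> K" if "s \<in> {0..1}" for s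
  proof -
    have "(1 - s) *\<^sub>R p + s *\<^sub>R (p + \<Delta>) \<in> K" using convexD_alt[OF K p, of s] that by auto
    then show ?thesis by (simp add: y_def algebra_simps)
  qed
  have dy: "(y has_vector_derivative \<Delta>) (at s)" for s
    unfolding y_def[abs_def] by (auto intro!: derivative_eq_intros)
  have cy: "continuous_on X y" for X
    unfolding y_def[abs_def] by (intro continuous_intros)
  have J: "(J has_derivative J1 (y s)) (at (y s))" "((\<lambda>z. J1 z w) has_derivative J2 (y s) w) (at (y s))"
    "norm (J2 (y s) w v) \<le> M * norm w * norm v" if "s \<in> {0..1}" for s w v
    using jet y[OF that] unfolding jet_on_def by blast+
  have J1: "norm (J1 (y s) \<Delta> - J1 (y 0) \<Delta>) \<le> M * (norm \<Delta>)\<^sup>2" if s: "s \<in> {0..1}" for s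
  proof -
    have "norm (J1 (y s) \<Delta> - J1 (y 0) \<Delta>) \<le> (M * norm \<Delta>) * norm \<Delta> * (s - 0)"
      by (rule path_image_increment[where G = "\<lambda>z. J1 z \<Delta>" and G' = "\<lambda>z v. J2 z \<Delta> v" and x' = "\<lambda>_. \<Delta>", OF _ cy dy])
        (use s M J(2,3) in auto)
    also have "\<dots> \<le> (M * norm \<Delta>) * norm \<Delta> * 1" using s M by (intro mult_left_mono) auto
    finally show ?thesis by (simp add: power2_eq_square mult.assoc)
  qed
  have "norm ((J (y 1) - 1 * J1 p \<Delta>) - (J (y 0) - 0 * J1 p \<Delta>)) \<le> M * (norm \<Delta>)\<^sup>2 * (1 - 0)"
  proof (rule norm_diff_le_derivative_bound[where z' = "\<lambda>s. J1 (y s) \<Delta> - J1 p \<Delta>" and S = "{}"])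
    show "continuous_on {0..1} (\<lambda>s. J (y s) - s * J1 p \<Delta>)"
    proof (intro continuous_intros continuous_on_compose2[OF _ cy order_refl])
      show "continuous_on (y ` {0..1}) J"
        by (rule continuous_at_imp_continuous_on) (use J(1) has_derivative_continuous in blast)
    qed
    fix s :: real assume s: "s \<in> {0<..<1} - {}"
    have "((\<lambda>s. J (y s)) has_vector_derivative J1 (y s) \<Delta>) (at s)"
      using vector_derivative_diff_chain_within[OF dy[of s], of J "J1 (y s)"] has_derivative_at_withinI[OF J(1)[of s]] s
      by (simp add: o_def)
    then show "((\<lambda>s. J (y s) - s * J1 p \<Delta>) has_vector_derivative J1 (y s) \<Delta> - J1 p \<Delta>) (at s)"
      by (auto intro!: derivative_eq_intros simp: has_real_derivative_iff_has_vector_derivative[symmetric])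
    show "norm (J1 (y s) \<Delta> - J1 p \<Delta>) \<le> M * (norm \<Delta>)\<^sup>2"
      using J1[of s] s by (simp add: y_def)
  qed (use M in auto)
  then show ?thesis by (simp add: y_def)
qed

text \<open>The level \<open>B\<close> is a trap: since \<open>q * B\<close> is at most
  \<open>B\<close>, a value that has fallen to it never rises above it again.\<close>

lemma discrete_decay:
  fixes V :: "nat \<Rightarrow> real"
  assumes q: "0 \<le> q" "q \<le> 1" and B: "0 \<le> B" and step: "\<And>i. i < n \<Longrightarrow> V (Suc i) \<le> max (q * V i) B"
  shows "i \<le> n \<Longrightarrow> V i \<le> max (q ^ i * V 0) B"
proof (induction i)
  case (Suc i)
  have "q * V i \<le> q * max (q ^ i * V 0) B" using Suc q by (intro mult_left_mono) auto
  also have "\<dots> \<le> max (q ^ Suc i * V 0) B"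
    using q B mult_left_le_one_le[of B q] by (auto simp: max_def mult.assoc)
  finally show ?case using step[of i] Suc.prems by auto
qed simp

text \<open>Continuation argument: at the first time with value \<open>c\<close> the bound holds up
  to that time, so \<open>step\<close> makes the value there strictly smaller than
  \<open>c\<close>.\<close>

lemma stays_below:
  fixes h :: "real \<Rightarrow> real"
  assumes cont: "\<And>T. continuous_on {0..T} h" and h0: "h 0 < c"
    and step: "\<And>T. 0 \<le> T \<Longrightarrow> (\<And>t. t \<in> {0..T} \<Longrightarrow> h t \<le> c) \<Longrightarrow> h T < c" and t: "0 \<le> t"
  shows "h t < c"
proof (rule ccontr)
  assume "\<not> h t < c"
  define S where "S = {s \<in> {0..t}. h s = c}"
  have ivt: "\<exists>s. 0 \<le> s \<and> s \<le> u \<and> h s = c" if "0 \<le> u" "h u \<ge> c" for u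
    using IVT'[of h 0 c u] that h0 cont by auto
  have "compact S"
  proof -
    have "closed S" unfolding S_def
      using continuous_closed_preimage_constant[OF cont closed_atLeastAtMost] by simp
    moreover have "S \<subseteq> {0..t}" by (auto simp: S_def)
    ultimately show ?thesis 
      by (meson bounded_subset compact_Icc compact_eq_bounded_closed)
  qed
  moreover have "S \<noteq> {}" using ivt[OF t] \<open>\<not> h t < c\<close> by (auto simp: S_def)
  ultimately obtain s where s: "s \<in> S" "\<And>u. u \<in> S \<Longrightarrow> s \<le> u"
    using compact_attains_inf[of S] by blast
  have "h u \<le> c" if u: "u \<in> {0..s}" for u
  proof (rule ccontr)
    assume "\<not> h u \<le> c"
    then obtain w where w: "0 \<le> w" "w \<le> u" "h w = c" using ivt[of u] u by auto
    then have "s \<le> w" using s u by (auto simp: S_def)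
    then have "w = u" using w u by auto
    then show False using w \<open>\<not> h u \<le> c\<close> by simp
  qed
  then show False using step[of s] s(1) by (auto simp: S_def)
qed

section \<open>Convergence\<close>

theorem theorem1:
  fixes D :: "(real ^ 'n::finite) set"
    and f :: "'m::finite \<Rightarrow> real ^ 'n \<Rightarrow> real ^ 'n"
    and J :: "real ^ 'n \<Rightarrow> real"
    and xs :: "real ^ 'n"
    and S1 :: "'m set" and S2 :: "('m \<times> 'm) set"
    and c :: "'n \<Rightarrow> 'm + 'm \<times> 'm"
    and \<kappa> :: "'m \<times> 'm \<Rightarrow> nat"
    and g :: "'n + 'n \<Rightarrow> real \<Rightarrow> real"
    and k :: "'n \<Rightarrow> nat"
    and \<sigma>11 \<sigma>12 \<sigma>21 \<sigma>22 \<sigma>3 \<alpha> \<gamma>2 :: real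
  assumes "CARD('m) < CARD('n)"
    and f_indep: "\<And>w :: 'm \<Rightarrow> real. (\<forall>x\<in>D. (\<Sum>i\<in>UNIV. w i *\<^sub>R f i x) = 0) \<Longrightarrow> (\<forall>i. w i = 0)"
    and J_C2: "Ck_on 2 D J"
    and "xs \<in> D"
    and "\<sigma>11 > 0" "\<sigma>12 > 0" "\<sigma>21 > 0" "\<sigma>22 > 0" "\<sigma>3 > 0"
    and J_quadratic: "\<And>x. x \<in> D \<Longrightarrow>
          \<sigma>11 * (norm (x - xs))\<^sup>2 \<le> J x - J xs \<and> J x - J xs \<le> \<sigma>12 * (norm (x - xs))\<^sup>2"
    and J_gradient: "\<And>x. x \<in> D \<Longrightarrow>
          \<sigma>21 * (J x - J xs) \<le> (norm (grad J x))\<^sup>2 \<and> (norm (grad J x))\<^sup>2 \<le> \<sigma>22 * (J x - J xs)"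
    and J_hessian: "\<And>x. x \<in> D \<Longrightarrow> matrix_norm (hessian J x) \<le> \<sigma>3"
    \<comment> \<open>assumption (1)\<close>
    and f_C2: "\<And>i. Ck_on 2 D (f i)"
    and S_card: "card S1 + card S2 = CARD('n)"
    and f_span: "\<And>x. x \<in> D \<Longrightarrow>
          span ({f i x | i. i \<in> S1} \<union> {lie_bracket (f j1) (f j2) x | j1 j2. (j1, j2) \<in> S2}) = UNIV"
    and c_order: "bij_betw c UNIV (S1 <+> S2)"
    and "\<alpha> > 0"
    and frame_inv: "\<And>x. x \<in> D \<Longrightarrow> matrix_norm (matrix_inv (frame_matrix f c x)) \<le> \<alpha>"
    \<comment> \<open>frequencies of the inputs\<close>
    and \<kappa>_freq: "\<And>p. p \<in> S2 \<Longrightarrow> \<kappa> p > 0" "inj_on \<kappa> S2"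
    and k_freq: "\<And>j. k j > 0" "inj k"
    \<comment> \<open>generating functions\<close>
    and "\<gamma>2 > 0"
    and g_bracket: "\<And>j z. z \<in> J ` (D - {xs}) \<Longrightarrow>
          g (Inl j) differentiable (at z) \<and> g (Inr j) differentiable (at z) \<and>
          g (Inl j) z * deriv (g (Inr j)) z - g (Inr j) z * deriv (g (Inl j)) z = - \<gamma>2"
    \<comment> \<open>assumption (2)\<close>
    and g_C2: "\<And>j. Ck_on 2 (D - {xs}) (\<lambda>x. g j (J x))"
    and g_lie1: "\<And>i j.
          (\<forall>x\<in>D. lie_differentiable (gen_field g J j) (\<lambda>y. g i (J y)) x) \<and>
          continuous_on D (gen_lie1 g J j i)"
    and g_lie2: "\<And>i j l.
          (\<forall>x\<in>D. lie_differentiable (gen_field g J l) (gen_lie1 g J j i) x) \<and>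
          continuous_on D (lie_deriv (gen_field g J l) (gen_lie1 g J j i))"
    \<comment> \<open>assumption (3); a Lie derivative at the point \<open>\<xi> = xs\<close> is only bounded if it exists,
        at the other points it exists by assumption (2)\<close>
    and g_bounds: "\<And>D'. compact D' \<Longrightarrow> D' \<subseteq> D \<Longrightarrow>
          \<exists>Lg\<ge>0. \<exists>L2g\<ge>0. \<exists>M3g\<ge>0. \<forall>x\<in>D'. \<forall>\<xi>\<in>D'. \<forall>i j1 j2 j3.
            \<bar>g i (J x) - g i (J \<xi>)\<bar> \<le> Lg * norm (x - \<xi>) \<and>
            (let h = (\<lambda>_. (g j2 (J x) - g j2 (J \<xi>)) *\<^sub>R es_dir j2) in
               lie_differentiable h (\<lambda>\<zeta>. g j1 (J \<zeta>)) \<xi> \<longrightarrow>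
               \<bar>lie_deriv h (\<lambda>\<zeta>. g j1 (J \<zeta>)) \<xi>\<bar> \<le> L2g * norm (x - \<xi>)) \<and>
            (let h = (\<lambda>_. g j3 (J x) *\<^sub>R es_dir j3) in
               lie_differentiable h (gen_lie1 g J j2 j1) \<xi> \<longrightarrow>
               \<bar>lie_deriv h (gen_lie1 g J j2 j1) \<xi>\<bar> \<le> M3g)"
  shows "\<forall>\<delta>>0. ereal \<delta> < ereal (sqrt (\<sigma>11 / \<sigma>12)) * boundary_dist xs D \<longrightarrow> (\<forall>\<rho>>0.
           \<exists>\<beta>>0. \<exists>lam>0.
           \<exists>\<mu>bar>0. \<forall>\<mu>. 0 < \<mu> \<and> \<mu> \<le> \<mu>bar \<longrightarrow>
           (\<exists>\<gamma>1bar>0. \<forall>\<gamma>1\<ge>\<gamma>1bar.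
           (\<exists>\<epsilon>bar>0. \<forall>\<epsilon>. 0 < \<epsilon> \<and> \<epsilon> \<le> \<epsilon>bar \<longrightarrow>
             (\<forall>x0 \<in> cball xs \<delta>. \<forall>x \<xi>.
                pi_solution D f c S1 S2 \<kappa> J g k \<mu> \<gamma>1 \<epsilon> x0 x \<xi> \<longrightarrow>
                (\<forall>t\<ge>0. norm (x t - xs) \<le> \<beta> * norm (x0 - xs) * exp (- lam * t) + \<rho>)))))"
proof (intro allI impI)
  fix \<delta> \<rho> :: real
  assume \<delta>: "\<delta> > 0" "ereal \<delta> < ereal (sqrt (\<sigma>11 / \<sigma>12)) * boundary_dist xs D" and \<rho>: "\<rho> > 0"
  note pos = \<open>\<sigma>11 > 0\<close> \<open>\<sigma>12 > 0\<close> \<open>\<sigma>21 > 0\<close> \<open>\<sigma>22 > 0\<close> \<open>\<gamma>2 > 0\<close>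

  \<comment> \<open>Radii and compact sets\<close>
  define V where "V z = J z - J xs" for z
  define q where "q = sqrt (\<sigma>12 / \<sigma>11)"
  have q: "q > 0" "q\<^sup>2 = \<sigma>12 / \<sigma>11" "q * sqrt (\<sigma>11 / \<sigma>12) = 1"
    using pos by (simp_all add: q_def real_sqrt_divide power_divide)
  \<comment> \<open>The sublevel set of the cost that contains the \<delta>-ball fits into the ball
    of radius \<open>q * \<delta>\<close>. The bound on \<delta> leaves room for a larger radius
    \<open>R\<close> inside \<open>D\<close>.\<close>
  have "ereal (q * \<delta>) < boundary_dist xs D"
  proof (cases "boundary_dist xs D")
    case (real b)
    then have "\<delta> < sqrt (\<sigma>11 / \<sigma>12) * b" using \<delta>(2) by simp
    then have "q * \<delta> < q * (sqrt (\<sigma>11 / \<sigma>12) * b)" using q(1) by simp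
    then show ?thesis using q(3) real by (simp add: mult.assoc[symmetric])
  next
    case MInf
    then show ?thesis using \<delta>(2) pos by simp
  qed simp
  then obtain R where R: "q * \<delta> < R" "ereal R < boundary_dist xs D"
    using ereal_dense2 by (metis less_ereal.simps(1))
  have R0: "R > 0" using R(1) q \<delta> by (meson less_trans mult_pos_pos)
  define K where "K = cball xs R"
  have K: "compact K" "convex K" "K \<subseteq> D"
    using cball_subset_of_boundary_dist[OF \<open>xs \<in> D\<close> _ R(2)] R0 by (auto simp: K_def)
  have inK: "z \<in> K \<longleftrightarrow> norm (z - xs) \<le> R" for z
    by (simp add: K_def dist_norm norm_minus_commute)
  have xsK: "xs \<in> K" using R0 by (simp add: inK)
  \<comment> \<open>Error budget. The motion of \<xi> within a period, the tracking error and the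
    trapping radius \<open>2 * q * r\<close> get \<open>m / 4\<close> each. The total stays below
    \<rho>, and the first two added to \<open>q * \<delta>\<close> stay below
    \<open>R\<close>.\<close>
  define m where "m = min \<rho> (R - q * \<delta>)"
  have m: "m > 0" "m \<le> \<rho>" "m \<le> R - q * \<delta>" using R(1) \<rho> by (auto simp: m_def)
  define r where "r = min (\<delta> / 2) (m / (8 * q))"
  have r: "r > 0" "2 * q * r \<le> q * \<delta>" "2 * q * r \<le> m / 4"
  proof -
    show "r > 0" using \<delta> m q by (simp add: r_def)
    have "q * (2 * r) \<le> q * \<delta>" using q by (intro mult_left_mono) (auto simp: r_def)
    then show "2 * q * r \<le> q * \<delta>" by (simp add: mult_ac)
    have "r \<le> m / (8 * q)" by (simp add: r_def)
    then show "2 * q * r \<le> m / 4" using q by (simp add: field_simps)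
  qed
  \<comment> \<open>Within one period \<xi> moves by at most \<open>r / 2\<close>, so a period begun
    at distance at least \<open>r\<close> from \<open>xs\<close> takes place in \<open>A\<close>,
    where second derivatives of the generating functions are bounded.\<close>
  define A where "A = {z \<in> K. r / 2 \<le> norm (z - xs)}"
  have A: "compact A" "A \<subseteq> D - {xs}"
  proof -
    have "A = K \<inter> {z. r / 2 \<le> norm (z - xs)}" by (auto simp: A_def)
    moreover have "closed {z. r / 2 \<le> norm (z - xs)}"
      by (intro closed_Collect_le continuous_intros)
    ultimately show "compact A" using K(1) by (simp add: compact_Int_closed)
    show "A \<subseteq> D - {xs}" using K(3) r by (auto simp: A_def)
  qed

  \<comment> \<open>Uniform bounds, and the bracket as a gradient\<close>
  obtain Mf f1 f2 where Mf: "Mf \<ge> 0" "\<And>i. jet_on K Mf (f i) (f1 i) (f2 i)"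
    using Ck_on_imp_jet_on_family[of D f, OF f_C2 K(1,3)] by blast
  obtain Mg \<phi>1 \<phi>2 where Mg: "Mg \<ge> 0" "\<And>b. jet_on A Mg (\<lambda>z. g b (J z)) (\<phi>1 b) (\<phi>2 b)"
    using Ck_on_imp_jet_on_family[of "D - {xs}" "\<lambda>b z. g b (J z)", OF g_C2 A] by blast
  obtain MJ J1 J2 where MJ: "MJ \<ge> 0" "jet_on K MJ J J1 J2"
    using Ck_on_imp_jet_on[OF J_C2 K(1,3)] by blast
  \<comment> \<open>Unlike \<open>Mg\<close>, this constant is valid on all of \<open>K\<close>,
    including \<open>xs\<close>; the speed bound and tracking hold there too.\<close>
  obtain L where L: "L \<ge> 0" "\<And>x \<xi> b. x \<in> K \<Longrightarrow> \<xi> \<in> K \<Longrightarrow> \<bar>g b (J x) - g b (J \<xi>)\<bar> \<le> L * norm (x - \<xi>)"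
    using g_bounds[OF K(1,3)] by blast
  have J1: "(J has_derivative J1 z) (at z)" if "z \<in> K" for z
    using MJ(2) that unfolding jet_on_def by blast
  have J1_grad: "J1 z v = grad J z \<bullet> v" if "z \<in> K" for z v
  proof -
    have lin: "linear (J1 z)" using J1[OF that] has_derivative_linear by blast
    have eq: "grad J z $ i = J1 z (axis i 1)" for i
      by (simp add: grad_def frechet_derivative_at[OF J1[OF that], symmetric])
    have "J1 z v = J1 z (\<Sum>i\<in>UNIV. v $ i *\<^sub>R axis i 1)"
      using basis_expansion[of v] by (simp add: scalar_mult_eq_scaleR)
    also have "\<dots> = (\<Sum>i\<in>UNIV. v $ i * J1 z (axis i 1))"
      by (simp add: linear_sum[OF lin] linear_cmul[OF lin])
    finally show ?thesis by (simp add: inner_vec_def eq mult.commute)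
  qed
  \<comment> \<open>By the chain rule and uniqueness of derivatives, \<open>\<phi>1 b z\<close> is
    g_b'(J z) times the derivative of \<open>J\<close>, so the one-variable bracket -\<gamma>2
    factors out of the partial derivative.\<close>
  have bracket: "g (Inl j) (J z) * \<phi>1 (Inr j) z (axis j 1) - g (Inr j) (J z) * \<phi>1 (Inl j) z (axis j 1)
      = - \<gamma>2 * grad J z $ j" if z: "z \<in> A" for z j
  proof -
    have zK: "z \<in> K" and zD: "J z \<in> J ` (D - {xs})" using z A(2) by (auto simp: A_def)
    have chain: "\<phi>1 b z (axis j 1) = deriv (g b) (J z) * grad J z $ j" if "g b differentiable (at (J z))" for b
    proof -
      have "(g b has_real_derivative deriv (g b) (J z)) (at (J z))"
        using that by (simp add: DERIV_deriv_iff_real_differentiable)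
      then have "((\<lambda>z. g b (J z)) has_derivative (\<lambda>v. deriv (g b) (J z) * J1 z v)) (at z)"
        using has_derivative_compose[OF J1[OF zK]] unfolding has_field_derivative_def by blast
      moreover have "((\<lambda>z. g b (J z)) has_derivative \<phi>1 b z) (at z)"
        using Mg(2)[of b] z unfolding jet_on_def by blast
      ultimately have "\<phi>1 b z = (\<lambda>v. deriv (g b) (J z) * J1 z v)"
        by (metis has_derivative_unique)
      then show ?thesis by (simp add: J1_grad[OF zK] inner_axis)
    qed
    note gb = g_bracket[OF zD, of j]
    have "g (Inl j) (J z) * \<phi>1 (Inr j) z (axis j 1) - g (Inr j) (J z) * \<phi>1 (Inl j) z (axis j 1) =
      (g (Inl j) (J z) * deriv (g (Inr j)) (J z) - g (Inr j) (J z) * deriv (g (Inl j)) (J z)) * grad J z $ j"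
      using gb by (simp add: chain algebra_simps)
    then show ?thesis using gb by simp
  qed
  have V_bounds: "\<sigma>11 * (norm (z - xs))\<^sup>2 \<le> V z" "V z \<le> \<sigma>12 * (norm (z - xs))\<^sup>2" if "z \<in> D" for z
    using J_quadratic[OF that] by (auto simp: V_def)
  define N where "N = real CARD('n + 'n)"
  define \<Omega> where "\<Omega> = dither_amplitude UNIV k"
  define Gb where "Gb = (\<Sum>b\<in>UNIV. \<bar>g b (J xs)\<bar>) + L * R"
  have Gb: "\<bar>g b (J z)\<bar> \<le> Gb" if "z \<in> K" for b z
  proof -
    have "\<bar>g b (J z) - g b (J xs)\<bar> \<le> L * norm (z - xs)" by (rule L(2)[OF that xsK])
    also have "\<dots> \<le> L * R" using that L(1) by (intro mult_left_mono) (auto simp: inK)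
    finally have "\<bar>g b (J z)\<bar> \<le> \<bar>g b (J xs)\<bar> + L * R" by linarith
    moreover have "\<bar>g b (J xs)\<bar> \<le> (\<Sum>b\<in>UNIV. \<bar>g b (J xs)\<bar>)" by (rule member_le_sum) auto
    ultimately show ?thesis by (simp add: Gb_def)
  qed

  \<comment> \<open>Constants and the threshold for sqrt \<mu>\<close>
  define Vs where "Vs = N * \<Omega> * Gb"
  have "Gb \<ge> 0" using order_trans[OF abs_ge_zero Gb[OF xsK]] .
  then have Vs: "Vs \<ge> 0" by (simp add: Vs_def N_def \<Omega>_def dither_amplitude_nonneg)
  define B where "B = sqrt (\<sigma>22 * \<sigma>12) * R"
  define C where "C = es_remainder k Mg L"
  \<comment> \<open>\<open>B * C\<close> comes from the remainder in the linear Taylor term, the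
    other summand from the quadratic term.\<close>
  define C2 where "C2 = B * C + MJ * (\<gamma>2 * B + C)\<^sup>2"
  \<comment> \<open>Half of the nominal decay rate \<open>\<gamma>2 * \<sigma>21\<close>; the other
    half absorbs the remainder with \<open>C2\<close>.\<close>
  define \<nu> where "\<nu> = \<gamma>2 * \<sigma>21 / 2"
  have B: "B \<ge> 0" using R0 pos by (simp add: B_def)
  have C: "C \<ge> 0"
    using L(1) Mg(1) dither_amplitude_nonneg[of UNIV k]
    by (auto simp: C_def es_remainder_def Let_def intro!: add_nonneg_nonneg averaging_constant_nonneg)
  have C2: "C2 \<ge> 0" using B C MJ(1) by (simp add: C2_def)
  have \<nu>: "\<nu> > 0" using pos by (simp add: \<nu>_def)
  have grad_bound: "norm (grad J z) \<le> B" if "z \<in> K" for z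
  proof -
    have zD: "z \<in> D" using that K by auto
    have "(norm (grad J z))\<^sup>2 \<le> \<sigma>22 * V z" using J_gradient[OF zD] by (simp add: V_def)
    also have "\<dots> \<le> \<sigma>22 * (\<sigma>12 * (norm (z - xs))\<^sup>2)" using V_bounds[OF zD] pos by (intro mult_left_mono) auto
    also have "\<dots> \<le> \<sigma>22 * (\<sigma>12 * R\<^sup>2)" using that pos by (intro mult_left_mono power_mono) (auto simp: inK)
    also have "\<dots> = B\<^sup>2" using pos by (simp add: B_def power_mult_distrib)
    finally show ?thesis using B by (rule power2_le_imp_le)
  qed
  \<comment> \<open>Each entry serves one inequality. The increments by 1 in the denominators avoid
    division by zero and are undone by \<open>scale\<close>.\<close>
  define s where "s = Min {1, r / (2 * (Vs + 1)), m / (4 * (Vs + 1)), m / 4, \<nu> * \<sigma>11 * r\<^sup>2 / (C2 + 1), 1 / (\<nu> + 1)}"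
  have s: "s > 0" using r m Vs \<nu> pos C2 by (simp add: s_def)
  have s_le: "s \<le> 1" "s \<le> r / (2 * (Vs + 1))" "s \<le> m / (4 * (Vs + 1))" "s \<le> m / 4"
    "s \<le> \<nu> * \<sigma>11 * r\<^sup>2 / (C2 + 1)" "s \<le> 1 / (\<nu> + 1)"
    unfolding s_def by (rule Min_le; simp)+
  have scale: "u * c \<le> w" if "0 \<le> u" "u \<le> s" "s \<le> w / (c + 1)" "0 \<le> c" for u c w
  proof -
    have "u * c \<le> u * (c + 1)" using that by (intro mult_left_mono) auto
    also have "\<dots> \<le> w / (c + 1) * (c + 1)" using that by (intro mult_right_mono) auto
    also have "\<dots> = w" using that by simp
    finally show ?thesis .
  qed
  show "\<exists>\<beta>>0. \<exists>lam>0.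
           \<exists>\<mu>bar>0. \<forall>\<mu>. 0 < \<mu> \<and> \<mu> \<le> \<mu>bar \<longrightarrow>
           (\<exists>\<gamma>1bar>0. \<forall>\<gamma>1\<ge>\<gamma>1bar.
           (\<exists>\<epsilon>bar>0. \<forall>\<epsilon>. 0 < \<epsilon> \<and> \<epsilon> \<le> \<epsilon>bar \<longrightarrow>
             (\<forall>x0 \<in> cball xs \<delta>. \<forall>x \<xi>.
                pi_solution D f c S1 S2 \<kappa> J g k \<mu> \<gamma>1 \<epsilon> x0 x \<xi> \<longrightarrow>
                (\<forall>t\<ge>0. norm (x t - xs) \<le> \<beta> * norm (x0 - xs) * exp (- lam * t) + \<rho>))))"
  \<comment> \<open>The factor \<open>exp (\<nu> / 2)\<close> pays for rounding \<open>t\<close>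
    down to a multiple of \<mu>, which is at most 1. The exponent will be \<open>\<nu> / 2\<close>,
    since the cost decays at rate \<nu> and the distance behaves like its square root.\<close>
  proof (rule exI[of _ "q * exp (\<nu> / 2)"], intro conjI, goal_cases)
    case 2
    show ?case
    proof (rule exI[of _ "\<nu> / 2"], intro conjI, goal_cases)
      case 2
      show ?case
      proof (rule exI[of _ "s\<^sup>2"], intro conjI allI impI, goal_cases)
        case (2 \<mu>)
        then have \<mu>: "0 < \<mu>" "\<mu> \<le> s\<^sup>2" by auto
        have s\<mu>: "sqrt \<mu> \<le> s" "0 < sqrt \<mu>" "sqrt \<mu> \<le> 1" "\<mu> \<le> sqrt \<mu>" "\<mu> \<le> 1"
        proof -
          show 1: "sqrt \<mu> \<le> s" using \<mu> s by (intro real_le_lsqrt) auto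
          show "0 < sqrt \<mu>" using \<mu> by simp
          show 2: "sqrt \<mu> \<le> 1" using 1 s_le by linarith
          then show "\<mu> \<le> 1" by simp
          then show "\<mu> \<le> sqrt \<mu>" using \<mu> by (intro real_le_rsqrt) (simp add: power2_eq_square mult_left_le)
        qed
        define v where "v = Vs / sqrt \<mu>"
        have v: "v \<ge> 0" using Vs \<mu> by (simp add: v_def)
        have v\<mu>: "v * \<mu> = Vs * sqrt \<mu>"
          using \<mu> by (metis less_eq_real_def real_div_sqrt times_divide_eq_left times_divide_eq_right v_def)
        have Vr: "Vs * sqrt \<mu> \<le> r / 2" and Vm: "Vs * sqrt \<mu> \<le> m / 4" and C2s: "C2 * sqrt \<mu> \<le> \<nu> * \<sigma>11 * r\<^sup>2"
          and \<mu>m: "\<mu> \<le> m / 4" and \<mu>\<nu>: "\<mu> * \<nu> \<le> 1"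
          using scale[of "sqrt \<mu>" "r / 2" Vs] scale[of "sqrt \<mu>" "m / 4" Vs] scale[of "sqrt \<mu>" "\<nu> * \<sigma>11 * r\<^sup>2" C2]
            scale[of \<mu> 1 \<nu>] s\<mu> s_le Vs C2 \<nu> \<mu> by (auto simp: mult.commute)
        have speed: "norm (es_rhs g k \<mu> (J z) t) \<le> v" if "z \<in> K" for z t
          unfolding es_rhs_def v_def Vs_def N_def \<Omega>_def by (rule es_rhs_bound[OF \<mu>(1) Gb[OF that]])
        show ?case
        \<comment> \<open>This makes the tracking error of \<open>tracking\<close> at most
          \<mu>.\<close>
        proof (rule exI[of _ "(v + 2) / \<mu>"], intro conjI allI impI, goal_cases)
          case 1
          show ?case using v \<mu> by simp
        next
          case (2 \<gamma>1)
          have \<gamma>1: "\<gamma>1 > 0" "(v + 2) / \<gamma>1 \<le> \<mu>"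
          proof -
            have "0 < (v + 2) / \<mu>" using v \<mu> by simp
            then show "\<gamma>1 > 0" using 2 by linarith
            then show "(v + 2) / \<gamma>1 \<le> \<mu>" using 2 \<mu> by (simp add: field_simps)
          qed
          have inv: "invertible (frame_matrix f c z)" if "z \<in> K" for z
            using frame_matrix_invertible[OF c_order f_span] that K by blast
          have inv_norm: "matrix_norm (matrix_inv (frame_matrix f c z)) \<le> \<alpha>" if "z \<in> K" for z
            using frame_inv that K by blast
          have diam: "norm (y - z) \<le> 2 * R" if "y \<in> K" "z \<in> K" for y z
            using norm_triangle_ineq4[of "y - xs" "z - xs"] that by (simp add: inK)
          obtain \<epsilon>bar where \<epsilon>bar: "\<epsilon>bar > 0"
            and track: "\<And>\<epsilon> x0 x \<xi> T t. 0 < \<epsilon> \<Longrightarrow> \<epsilon> \<le> \<epsilon>bar \<Longrightarrow> pi_solution D f c S1 S2 \<kappa> J g k \<mu> \<gamma>1 \<epsilon> x0 x \<xi> \<Longrightarrow>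
              (\<And>t. t \<in> {0..T} \<Longrightarrow> x t \<in> K \<and> \<xi> t \<in> K) \<Longrightarrow> t \<in> {0..T} \<Longrightarrow> norm (x t - \<xi> t) \<le> (v + 2) / \<gamma>1"
            by (rule tracking[OF c_order Mf(2,1) inv inv_norm \<open>\<alpha> > 0\<close> \<kappa>_freq diam _ \<gamma>1(1) v speed, where D = D])
              (use R0 in auto)
          show ?case
          proof (rule exI[of _ \<epsilon>bar], intro conjI allI impI ballI, goal_cases)
            case 1
            show ?case by (rule \<epsilon>bar)
          next
            case (2 \<epsilon> x0 x \<xi> t)
            then have \<epsilon>: "0 < \<epsilon>" "\<epsilon> \<le> \<epsilon>bar" and x0: "norm (x0 - xs) \<le> \<delta>" and t0: "0 \<le> t"
              and sol: "pi_solution D f c S1 S2 \<kappa> J g k \<mu> \<gamma>1 \<epsilon> x0 x \<xi>"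
              by (auto simp: dist_norm norm_minus_commute)
            have solD: "x t \<in> D" "\<xi> t \<in> D" if "t \<ge> 0" for t
              using sol that by (auto simp: pi_solution_def)
            have init: "x 0 = x0" "\<xi> 0 = x0" using sol by (auto simp: pi_solution_def)
            define d0 where "d0 = norm (x0 - xs)"
            \<comment> \<open>Decay over the completed periods, or the radius
              \<open>2 * q * r\<close> that corresponds to the trapping level
              \<open>4 * \<sigma>12 * r\<^sup>2\<close> of the cost.\<close>
            define env where "env t = max (q * d0 * exp (- (\<nu> * (\<mu> * real (nat \<lfloor>t / \<mu>\<rfloor>))) / 2)) (2 * q * r)" for t
            have d0: "d0 \<ge> 0" "d0 \<le> \<delta>" "d0 \<le> q * d0"
            proof -
              show "d0 \<ge> 0" "d0 \<le> \<delta>" using x0 by (auto simp: d0_def)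
              have "x0 \<in> D" using solD(1)[of 0] init by simp
              then have "d0\<^sup>2 * \<sigma>11 \<le> \<sigma>12 * d0\<^sup>2"
                using V_bounds[of x0] by (simp add: d0_def mult.commute)
              then have "d0\<^sup>2 \<le> \<sigma>12 * d0\<^sup>2 / \<sigma>11" using pos by (simp add: pos_le_divide_eq)
              also have "\<dots> = (q * d0)\<^sup>2" unfolding power_mult_distrib q(2) by simp
              finally show "d0 \<le> q * d0" 
                by (rule power2_le_imp_le) (simp add: q(1) less_imp_le d0_def)
            qed

            \<comment> \<open>Estimates up to \<open>T\<close>, provided the trajectory is in
              \<open>K\<close> until then\<close>
            have est: "norm (\<xi> T - xs) \<le> Vs * sqrt \<mu> + env T \<and> norm (x T - xs) \<le> Vs * sqrt \<mu> + env T + \<mu>"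
              if T: "0 \<le> T" and stay: "\<And>t. t \<in> {0..T} \<Longrightarrow> x t \<in> K \<and> \<xi> t \<in> K" for T
            proof -
              obtain S where S: "finite S"
                "\<And>t. t \<in> {0<..<T} - S \<Longrightarrow> (\<xi> has_vector_derivative es_rhs g k \<mu> (J (x t)) t) (at t)"
                using pi_solution_estimator_derivative[OF sol \<epsilon>(1)] by blast
              have near: "norm (x t - \<xi> t) \<le> \<mu>" if "t \<in> {0..T}" for t
                using track[OF \<epsilon> sol stay that] \<gamma>1 by linarith
              define \<tau> where "\<tau> i = \<mu> * real i" for i :: nat
              have \<tau>0: "\<tau> i \<ge> 0" for i using \<mu> by (simp add: \<tau>_def)
              have \<tau>S: "\<tau> (Suc i) = \<tau> i + \<mu>" for i by (simp add: \<tau>_def algebra_simps)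
              have inc: "norm (\<xi> u - \<xi> (\<tau> i)) \<le> Vs * sqrt \<mu>" if u: "u \<in> {\<tau> i..\<tau> i + \<mu>}" "u \<le> T" for u i
              proof -
                have "norm (\<xi> u - \<xi> (\<tau> i)) \<le> v * (u - \<tau> i)"
                  by (rule norm_diff_le_derivative_bound[OF _ S(1) pi_solution_continuous(2)[OF sol \<tau>0] v S(2) speed])
                    (use u stay \<tau>0[of i] in auto)
                also have "\<dots> \<le> v * \<mu>" using u v by (intro mult_left_mono) auto
                finally show ?thesis by (simp add: v\<mu>)
              qed
              define W where "W i = V (\<xi> (\<tau> i))" for i
              have step: "W (Suc i) \<le> max ((1 - \<mu> * \<nu>) * W i) (4 * \<sigma>12 * r\<^sup>2)" if i: "\<tau> (Suc i) \<le> T" for i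
              proof (cases "r \<le> norm (\<xi> (\<tau> i) - xs)")
                case False
                have "norm (\<xi> (\<tau> (Suc i)) - xs) \<le> norm (\<xi> (\<tau> (Suc i)) - \<xi> (\<tau> i)) + norm (\<xi> (\<tau> i) - xs)"
                  using norm_triangle_ineq[of "\<xi> (\<tau> (Suc i)) - \<xi> (\<tau> i)" "\<xi> (\<tau> i) - xs"] by simp
                also have "\<dots> \<le> 2 * r"
                  using inc[of "\<tau> (Suc i)" i] i \<mu> False Vr r by (auto simp: \<tau>S)
                finally have "(norm (\<xi> (\<tau> (Suc i)) - xs))\<^sup>2 \<le> (2 * r)\<^sup>2" by (intro power_mono) auto
                then have "\<sigma>12 * (norm (\<xi> (\<tau> (Suc i)) - xs))\<^sup>2 \<le> \<sigma>12 * (2 * r)\<^sup>2"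
                  using pos by (intro mult_left_mono) auto
                then have "W (Suc i) \<le> 4 * \<sigma>12 * r\<^sup>2"
                  using V_bounds(2)[OF solD(2)[OF \<tau>0[of "Suc i"]]] by (simp add: W_def power_mult_distrib)
                then show ?thesis by simp
              next
                case True
                define p where "p = \<xi> (\<tau> i)"
                define \<Delta> where "\<Delta> = \<xi> (\<tau> i + \<mu>) - p"
                have sub: "u \<in> {0..T}" if "u \<in> {\<tau> i..\<tau> i + \<mu>}" for u using that i \<tau>0[of i] by (auto simp: \<tau>S)
                have pK: "p \<in> K" "p + \<Delta> \<in> K" using stay sub \<mu> by (auto simp: p_def \<Delta>_def)
                have pD: "p \<in> D" using pK K by auto
                have inA: "\<xi> u \<in> A" if u: "u \<in> {\<tau> i..\<tau> i + \<mu>}" for u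
                proof -
                  have "norm (\<xi> (\<tau> i) - xs) \<le> norm (\<xi> u - xs) + norm (\<xi> u - \<xi> (\<tau> i))"
                    using norm_triangle_ineq4[of "\<xi> u - xs" "\<xi> u - \<xi> (\<tau> i)"] by simp
                  then have "r / 2 \<le> norm (\<xi> u - xs)"
                    using True inc[OF u] Vr sub[OF u] by auto
                  then show ?thesis using stay[OF sub[OF u]] by (simp add: A_def)
                qed
                have rem: "norm (\<Delta> + (\<mu> * \<gamma>2) *\<^sub>R grad J p) \<le> C * (\<mu> * sqrt \<mu>)"
                  unfolding \<Delta>_def p_def C_def
                proof (rule es_window[OF k_freq Mg(2,1) bracket \<mu>(1) s\<mu>(5) \<tau>_def S(1) pi_solution_continuous(2)[OF sol \<tau>0] _ inA _ L(1)])
                  show "(\<xi> has_vector_derivative es_rhs g k \<mu> (J (x u)) u) (at u)" if "u \<in> {\<tau> i<..<\<tau> i + \<mu>} - S" for u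
                    using S(2)[of u] that i \<tau>0[of i] by (auto simp: \<tau>S)
                  show "\<bar>g b (J (x u)) - g b (J (\<xi> u))\<bar> \<le> L * \<mu>" if "u \<in> {\<tau> i..\<tau> i + \<mu>}" for u b
                  proof -
                    have "\<bar>g b (J (x u)) - g b (J (\<xi> u))\<bar> \<le> L * norm (x u - \<xi> u)"
                      using stay[OF sub[OF that]] by (intro L(2)) auto
                    also have "\<dots> \<le> L * \<mu>" using near[OF sub[OF that]] L(1) by (intro mult_left_mono) auto
                    finally show ?thesis .
                  qed
                qed auto
                define w where "w = \<Delta> + (\<mu> * \<gamma>2) *\<^sub>R grad J p"
                have w: "norm w \<le> C * (\<mu> * sqrt \<mu>)" using rem by (simp add: w_def)
                have \<Delta>: "\<Delta> = w - (\<mu> * \<gamma>2) *\<^sub>R grad J p" by (simp add: w_def)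
                have "norm \<Delta> \<le> (\<gamma>2 * B + C) * \<mu>"
                proof -
                  have "norm \<Delta> \<le> norm w + norm ((\<mu> * \<gamma>2) *\<^sub>R grad J p)" unfolding \<Delta> by (rule norm_triangle_ineq4)
                  moreover have "norm ((\<mu> * \<gamma>2) *\<^sub>R grad J p) \<le> \<mu> * \<gamma>2 * B"
                    using grad_bound[OF pK(1)] \<mu> pos by (simp add: abs_mult)
                  moreover have "C * (\<mu> * sqrt \<mu>) \<le> C * \<mu>" using C \<mu> s\<mu> by (simp add: mult_left_le mult_left_mono)
                  ultimately show ?thesis using w by (simp add: algebra_simps)
                qed
                then have "(norm \<Delta>)\<^sup>2 \<le> ((\<gamma>2 * B + C) * \<mu>)\<^sup>2" by (intro power_mono) auto
                also have "\<dots> = (\<gamma>2 * B + C)\<^sup>2 * (\<mu> * \<mu>)" by (simp add: power_mult_distrib power2_eq_square)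
                also have "\<dots> \<le> (\<gamma>2 * B + C)\<^sup>2 * (\<mu> * sqrt \<mu>)" using \<mu> s\<mu> by (intro mult_left_mono) auto
                finally have "MJ * (norm \<Delta>)\<^sup>2 \<le> MJ * ((\<gamma>2 * B + C)\<^sup>2 * (\<mu> * sqrt \<mu>))"
                  using MJ(1) by (intro mult_left_mono)
                moreover have "J1 p \<Delta> \<le> B * (C * (\<mu> * sqrt \<mu>)) - (\<mu> * \<gamma>2) * (norm (grad J p))\<^sup>2"
                proof -
                  have "J1 p \<Delta> = grad J p \<bullet> w - (\<mu> * \<gamma>2) * (norm (grad J p))\<^sup>2"
                    unfolding J1_grad[OF pK(1)] \<Delta> by (simp add: inner_diff_right power2_norm_eq_inner)
                  moreover have "grad J p \<bullet> w \<le> norm (grad J p) * norm w" by (rule norm_cauchy_schwarz)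
                  moreover have "\<dots> \<le> B * (C * (\<mu> * sqrt \<mu>))"
                    using grad_bound[OF pK(1)] w B by (intro mult_mono) auto
                  ultimately show ?thesis by linarith
                qed
                moreover have "J (p + \<Delta>) \<le> J p + J1 p \<Delta> + MJ * (norm \<Delta>)\<^sup>2"
                  by (rule descent_inequality[OF MJ(2,1) K(2) pK])
                moreover have "B * (C * (\<mu> * sqrt \<mu>)) + MJ * ((\<gamma>2 * B + C)\<^sup>2 * (\<mu> * sqrt \<mu>)) = \<mu> * (C2 * sqrt \<mu>)"
                  by (simp add: C2_def algebra_simps)
                \<comment> \<open>Outside the ball of radius \<open>r\<close> the cost excess is at
                  least \<open>\<sigma>11 * r\<^sup>2\<close>, so the choice of \<open>s\<close>
                  turns the fixed remainder into a multiple of \<open>V p\<close>, half of the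
                  nominal decrease.\<close>
                moreover have "\<mu> * (C2 * sqrt \<mu>) \<le> \<mu> * (\<nu> * V p)"
                proof -
                  have "\<sigma>11 * r\<^sup>2 \<le> \<sigma>11 * (norm (p - xs))\<^sup>2"
                    using True r pos by (intro mult_left_mono power_mono) (auto simp: p_def)
                  then have "\<sigma>11 * r\<^sup>2 \<le> V p" using V_bounds(1)[OF pD] by linarith
                  then have "\<nu> * (\<sigma>11 * r\<^sup>2) \<le> \<nu> * V p" using \<nu> by (intro mult_left_mono) auto
                  then show ?thesis using C2s \<mu> by (intro mult_left_mono) (auto simp: mult.assoc)
                qed
                moreover have "(\<mu> * \<gamma>2) * (\<sigma>21 * V p) \<le> (\<mu> * \<gamma>2) * (norm (grad J p))\<^sup>2"
                  using J_gradient[OF pD] \<mu> pos by (intro mult_left_mono) (auto simp: V_def)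
                moreover have "(\<mu> * \<gamma>2) * (\<sigma>21 * V p) = 2 * (\<mu> * (\<nu> * V p))" by (simp add: \<nu>_def)
                ultimately have "V (p + \<Delta>) \<le> V p - \<mu> * (\<nu> * V p)" unfolding V_def by linarith
                then have "W (Suc i) \<le> (1 - \<mu> * \<nu>) * W i"
                  by (simp add: W_def \<tau>S p_def \<Delta>_def algebra_simps)
                then show ?thesis by simp
              qed
              define n where "n = nat \<lfloor>T / \<mu>\<rfloor>"
              have n: "real n \<le> T / \<mu>" "T / \<mu> < real n + 1" using T \<mu> by (auto simp: n_def)
              have Tn: "T \<in> {\<tau> n..\<tau> n + \<mu>}" using n \<mu> by (auto simp: \<tau>_def field_simps)
              have "W n \<le> max ((1 - \<mu> * \<nu>) ^ n * W 0) (4 * \<sigma>12 * r\<^sup>2)"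
              proof (rule discrete_decay[OF _ _ _ _ order_refl])
                show "W (Suc i) \<le> max ((1 - \<mu> * \<nu>) * W i) (4 * \<sigma>12 * r\<^sup>2)" if "i < n" for i
                proof (rule step)
                  have "\<tau> (Suc i) \<le> \<tau> n" unfolding \<tau>_def using that \<mu> by (intro mult_left_mono) auto
                  then show "\<tau> (Suc i) \<le> T" using Tn by auto
                qed
              qed (use \<mu>\<nu> \<mu> \<nu> pos in auto)
              \<comment> \<open>Both entries of the maximum are at most \<sigma>11 times the square
                of the matching entry of \<open>env\<close>, because
                \<open>\<sigma>12 = \<sigma>11 * q\<^sup>2\<close>.\<close>
              also have "\<dots> \<le> \<sigma>11 * (env T)\<^sup>2"
              proof (rule max.boundedI)
                have e1: "(1 - \<mu> * \<nu>) ^ n \<le> exp (- (\<nu> * (\<mu> * real n)))"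
                proof -
                  have "(1 - \<mu> * \<nu>) ^ n \<le> exp (- (\<mu> * \<nu>)) ^ n"
                    using exp_ge_add_one_self[of "- (\<mu> * \<nu>)"] \<mu>\<nu> by (intro power_mono) auto
                  then show ?thesis by (simp add: exp_of_nat_mult[symmetric] mult_ac)
                qed
                have "W 0 \<le> \<sigma>12 * d0\<^sup>2"
                  using V_bounds(2)[OF solD(2)[of 0]] by (simp add: W_def \<tau>_def init d0_def)
                then have "(1 - \<mu> * \<nu>) ^ n * W 0 \<le> exp (- (\<nu> * (\<mu> * real n))) * (\<sigma>12 * d0\<^sup>2)"
                  using e1 \<mu>\<nu> V_bounds(1)[OF solD(2)[of 0]] pos
                  by (intro mult_mono) (auto simp: W_def \<tau>_def intro: order_trans[rotated])
                also have "\<dots> = \<sigma>11 * (q * d0 * exp (- (\<nu> * (\<mu> * real n)) / 2))\<^sup>2"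
                  using pos by (simp add: power_mult_distrib q(2) exp_double[symmetric] power2_eq_square[of "exp _"] exp_add[symmetric])
                also have "\<dots> \<le> \<sigma>11 * (env T)\<^sup>2"
                  using pos q d0 by (intro mult_left_mono power_mono) (auto simp: env_def n_def)
                finally show "(1 - \<mu> * \<nu>) ^ n * W 0 \<le> \<sigma>11 * (env T)\<^sup>2" .
                have "4 * \<sigma>12 * r\<^sup>2 = \<sigma>11 * (2 * q * r)\<^sup>2"
                  using pos by (simp add: power_mult_distrib q(2))
                also have "\<dots> \<le> \<sigma>11 * (env T)\<^sup>2"
                  using pos q r by (intro mult_left_mono power_mono) (auto simp: env_def)
                finally show "4 * \<sigma>12 * r\<^sup>2 \<le> \<sigma>11 * (env T)\<^sup>2" .
              qed
              finally have "\<sigma>11 * (norm (\<xi> (\<tau> n) - xs))\<^sup>2 \<le> \<sigma>11 * (env T)\<^sup>2"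
                using V_bounds(1)[OF solD(2)[OF \<tau>0[of n]]] by (simp add: W_def)
              then have "(norm (\<xi> (\<tau> n) - xs))\<^sup>2 \<le> (env T)\<^sup>2" using pos by simp
              moreover have "0 \<le> env T" using q r by (simp add: env_def le_max_iff_disj)
              ultimately have "norm (\<xi> (\<tau> n) - xs) \<le> env T" by (rule power2_le_imp_le)
              moreover have "norm (\<xi> T - xs) \<le> norm (\<xi> T - \<xi> (\<tau> n)) + norm (\<xi> (\<tau> n) - xs)"
                using norm_triangle_ineq[of "\<xi> T - \<xi> (\<tau> n)" "\<xi> (\<tau> n) - xs"] by simp
              ultimately have "norm (\<xi> T - xs) \<le> Vs * sqrt \<mu> + env T" using inc[OF Tn] by simp
              moreover have "norm (x T - xs) \<le> norm (x T - \<xi> T) + norm (\<xi> T - xs)"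
                using norm_triangle_ineq[of "x T - \<xi> T" "\<xi> T - xs"] by simp
              ultimately show ?thesis using near[of T] T by auto
            qed

            \<comment> \<open>First-exit argument and conclusion\<close>
            have env_le: "env T \<le> q * \<delta>" for T
            proof -
              have "q * d0 * exp (- (\<nu> * (\<mu> * real (nat \<lfloor>T / \<mu>\<rfloor>))) / 2) \<le> q * \<delta> * 1"
                using q d0 \<nu> \<mu> by (intro mult_mono) auto
              then show ?thesis using r by (simp add: env_def)
            qed
            have below: "max (norm (x u - xs)) (norm (\<xi> u - xs)) < R" if "0 \<le> u" for u
            proof (rule stays_below[OF _ _ _ that])
              show "continuous_on {0..T} (\<lambda>u. max (norm (x u - xs)) (norm (\<xi> u - xs)))" for T
                by (intro continuous_intros pi_solution_continuous[OF sol]) auto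
              have "d0 \<le> q * \<delta>" using d0 q by (meson mult_left_mono less_imp_le order_trans)
              then show "max (norm (x 0 - xs)) (norm (\<xi> 0 - xs)) < R"
                using R(1) by (simp add: init d0_def)
              show "max (norm (x T - xs)) (norm (\<xi> T - xs)) < R"
                if "0 \<le> T" "\<And>u. u \<in> {0..T} \<Longrightarrow> max (norm (x u - xs)) (norm (\<xi> u - xs)) \<le> R" for T
                using est[OF that(1)] that(2) env_le[of T] Vm \<mu>m m \<mu> by (auto simp: inK)
            qed
            then have "norm (x t - xs) \<le> Vs * sqrt \<mu> + env t + \<mu>"
              using est[OF t0] by (auto simp: inK less_imp_le)
            also have "\<dots> \<le> 3 / 4 * m + q * d0 * exp (- (\<nu> * (\<mu> * real (nat \<lfloor>t / \<mu>\<rfloor>))) / 2)"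
            proof -
              have "0 \<le> q * d0 * exp (- (\<nu> * (\<mu> * real (nat \<lfloor>t / \<mu>\<rfloor>))) / 2)" using q(1) d0(1) by simp
              then have "env t \<le> m / 4 + q * d0 * exp (- (\<nu> * (\<mu> * real (nat \<lfloor>t / \<mu>\<rfloor>))) / 2)"
                unfolding env_def using r(3) m(1) by linarith
              then show ?thesis using Vm \<mu>m by linarith
            qed
            also have "\<dots> \<le> q * d0 * exp (\<nu> / 2 + - (\<nu> / 2) * t) + \<rho>"
            proof -
              have "t / \<mu> < real (nat \<lfloor>t / \<mu>\<rfloor>) + 1" using t0 \<mu> by simp
              then have "t \<le> \<mu> * real (nat \<lfloor>t / \<mu>\<rfloor>) + \<mu>" using \<mu> by (simp add: field_simps)
              then have "\<nu> * t \<le> \<nu> * (\<mu> * real (nat \<lfloor>t / \<mu>\<rfloor>) + 1)"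
                using \<nu> s\<mu>(5) by (intro mult_left_mono) auto
              then have "exp (- (\<nu> * (\<mu> * real (nat \<lfloor>t / \<mu>\<rfloor>))) / 2) \<le> exp (\<nu> / 2 + - (\<nu> / 2) * t)"
                by (simp add: algebra_simps)
              then have "q * d0 * exp (- (\<nu> * (\<mu> * real (nat \<lfloor>t / \<mu>\<rfloor>))) / 2) \<le> q * d0 * exp (\<nu> / 2 + - (\<nu> / 2) * t)"
                using q d0 by (intro mult_left_mono) auto
              then show ?thesis using m by linarith
            qed
            finally show ?case by (simp only: exp_add d0_def mult_ac)
          qed
        qed
      qed (use s in auto)
    qed (use \<nu> in auto)
  qed (use q in auto)
qed

end
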